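(* In the setting described in the context: (a) $N$ is a vector space and $\mathcal H_\pi=\mathcal H_\pi'=\mathcal H_\pi''=N^\perp$. (b) For every $\phi\in\mathcal H_\pi\setminus\{0\}$ there exists a unique probability measure $\mathbb P_\phi$ on $(\Omega,\Sigma)$ such that $$\mathbb P_\phi(X_{t_i}=a_i,\ i=1,\dots,k)=\|p^{t_1,\dots,t_k}_{a_1,\dots,a_k}\hat\phi\|^2=\|p^{t_k}_{a_k}\cdots p^{t_1}_{a_1}\hat\phi\|^2$$ for all $t_1,\dots,t_k\in S$ and $a_i\in\Gamma(t_i)$. (c) To each $A\in\Sigma$ there corresponds a closed subspace $\mathcal H_A\subset\mathcal H_\pi$ such that, if $p_A$ denotes the projection of $\mathcal H$ onto $\mathcal H_A$ and $\tilde p_A$ its restriction to $\mathcal H_\pi$, then $\{\tilde p_A:A\in\Sigma\}$ is the unique projection valued measure from $\Sigma$ to projections in $\mathcal H_\pi$ satisfying $\tilde p_{\{X_{t_1}=a_1,\dots,X_{t_k}=a_k\}}\phi=p^{t_1,\dots,t_k}_{a_1,\dots,a_k}\phi$ for all $t_i$, $a_i$ and all $\phi\in\mathcal H_\pi$. In particular $\mathcal H_\Omega=\mathcal H_\pi$, and for every $A\in\Sigma$, $$\mathcal H=\mathcal H_A\oplus\mathcal H_{A^c}\oplus\mathcal H_\pi^\perp=\mathcal H_A\oplus\mathcal H_{A^c}\oplus\overline N .$$ (d) For every $\phi\in\mathcal H_\pi\setminus\{0\}$ and $A\in\Sigma$, $\mathbb P_\phi(A)=\|p_A\hat\phi\|^2$.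 For every $A\in\Sigma$, $\mathcal H_A=\{\phi\in\mathcal H_\pi:\phi=0\text{ or }\mathbb P_\phi(A)=1\}$ and $\mathcal H_A^\perp=\{\phi\in\mathcal H:\phi_\pi=0\text{ or }\mathbb P_{\phi_\pi}(A)=0\}$. (e) For every $\phi\in\mathcal H_\pi\setminus\{0\}$ and $A,B\in\Sigma$ with $\mathbb P_\phi(A)\neq0$, $\mathbb P_\phi(B\mid A)=\mathbb P_{p_A\phi}(B)$. (f) To each measurable $f:\Omega\to\mathbb R$ (with the Borel σ-algebra $\mathcal R$ on $\mathbb R$) there corresponds a self-adjoint operator $Q_f$ in the Hilbert space $\mathcal H_\pi$, with domain $\mathcal D_f=\{\phi\in\mathcal H_\pi:\phi=0\text{ or }\int f^2\,d\mathbb P_\phi<\infty\}$, such that $\int f\,d\mathbb P_\phi=\langle\hat\phi,Q_f\hat\phi\rangle$ for every $\phi\in\mathcal D_f\setminus\{0\}$. The spectral decomposition of $Q_f$ is given by the projection valued measure $\{p_{\{f\in B\}}:B\in\mathcal R\}$ (restricted to $\mathcal H_\pi$). All such operators $Q_f$ commute with each other, in the sense that the projections in their spectral decompositions all commute with each other.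
   Context: Let $\mathcal H$ be a Hilbert space over $\mathbb C$ (not necessarily separable), with inner product linear in the first argument. A projection is a bounded self-adjoint idempotent operator; for a family of projections $\{p_\alpha\}$, $\wedge_\alpha p_\alpha$ denotes the projection onto the intersection of their ranges. For $\phi\neq0$, $\hat\phi=\|\phi\|^{-1}\phi$; $\overline V$ denotes the closure of $V\subset\mathcal H$. A countable sum $\sum_iQ_i=Q$ of bounded operators means $\sum_iQ_i\phi=Q\phi$ for every $\phi\in\mathcal H$. Let $S$ be an arbitrary set. For each $t\in S$ let $\Gamma(t)$ be a countable set and for each $a\in\Gamma(t)$ let $p^t_a$ be a projection on $\mathcal H$ with range $\mathcal H^t_a$, such that $\sum_{a\in\Gamma(t)}p^t_a=I$. Put $\pi=\{p^t_a:t\in S,a\in\Gamma(t)\}$. For $t_1,\dots,t_k\in S$ and $a_i\in\Gamma(t_i)$, let $p^{t_1,\dots,t_k}_{a_1,\dots,a_k}=\wedge_{i=1}^kp^{t_i}_{a_i}$, the projection onto $\bigcap_{i=1}^k\mathcal H^{t_i}_{a_i}$. Say that $\pi$ commutes on $\phi\in\mathcal H$ if $W\phi=V\phi$ whenever $W,V$ are finite products of elements of $\pi$ made of the same factors (with multiplicity) in possibly different orders; $\mathcal H_\pi$ is the set of such $\phi$ (a closed subspace), $p_\pi$ is the projection onto $\mathcal H_\pi$, and $\phi_\pi=p_\pi\phi$. Define $\mathcal H_\pi'=\{\phi\in\mathcal H: p^{t_1,\dots,t_k}_{a_1,\dots,a_k}\phi=p^{t_1}_{a_1}\cdots p^{t_k}_{a_k}\phi$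 for all $t_1,\dots,t_k$, $a_1,\dots,a_k\}$, $\mathcal H_\pi''=\{\phi\in\mathcal H:\sum_{a_1,\dots,a_k}p^{t_1,\dots,t_k}_{a_1,\dots,a_k}\phi=\phi$ for all $t_1,\dots,t_k\}$, $N=\{\phi\in\mathcal H:$ for some $t_1,\dots,t_k\in S$, $p^{t_1,\dots,t_k}_{a_1,\dots,a_k}\phi=0$ for all $a_1,\dots,a_k\}$. Let $\Omega=\prod_{t\in S}\Gamma(t)$, $X_t(\omega)=\omega_t$, and let $\Sigma$ be the smallest σ-algebra on $\Omega$ containing all sets $\{X_t=a\}$; $\{X_{t_i}=a_i,\ i=1,\dots,k\}$ denotes $\{\omega:\omega_{t_i}=a_i,\ i=1,\dots,k\}$. A projection valued measure from $\Sigma$ to projections in a Hilbert space $\mathcal K$ is a map $A\mapsto q_A$ into projections on $\mathcal K$ with $q_\Omega=I$ and $q_A=\sum_i q_{A_i}$ whenever $A=\bigcup_iA_i$ is a countable disjoint union of sets in $\Sigma$. For $\phi\in\mathcal H_\pi\setminus\{0\}$ with $\mathbb P_\phi(A)\neq 0$, $\mathbb P_\phi(B\mid A)=\mathbb P_\phi(A\cap B)/\mathbb P_\phi(A)$. *)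

theory Defs
  imports "HOL-Probability.Probability"
begin

class chilbert = banach +
  fixes hscale :: "complex \<Rightarrow> 'a \<Rightarrow> 'a"
    and hinner :: "'a \<Rightarrow> 'a \<Rightarrow> complex"
  assumes hscale_of_real: "hscale (complex_of_real r) x = scaleR r x"
    and hscale_add_right: "hscale c (x + y) = hscale c x + hscale c y"
    and hscale_add_left: "hscale (c + d) x = hscale c x + hscale d x"
    and hscale_assoc: "hscale c (hscale d x) = hscale (c * d) x"
    and hinner_add_left: "hinner (x + y) z = hinner x z + hinner y z"
    and hinner_scale_left: "hinner (hscale c x) y = c * hinner x y"
    and hinner_commute: "hinner y x = cnj (hinner x y)"
    and hinner_norm: "hinner x x = complex_of_real ((norm x)\<^sup>2)"

definition csubspace :: "'h::chilbert set \<Rightarrow> bool" where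
  "csubspace V \<longleftrightarrow> 0 \<in> V \<and> (\<forall>x\<in>V. \<forall>y\<in>V. x + y \<in> V) \<and> (\<forall>c. \<forall>x\<in>V. hscale c x \<in> V)"

definition orth :: "'h::chilbert set \<Rightarrow> 'h set" where
  "orth V = {x. \<forall>y\<in>V. hinner x y = 0}"

definition proj_onto :: "'h::chilbert set \<Rightarrow> 'h \<Rightarrow> 'h" where
  "proj_onto V x = (THE y. y \<in> V \<and> (\<forall>z\<in>V. hinner (x - y) z = 0))"

definition hat :: "'h::chilbert \<Rightarrow> 'h" where
  "hat x = scaleR (inverse (norm x)) x"

definition is_proj :: "('h::chilbert \<Rightarrow> 'h) \<Rightarrow> bool" where
  "is_proj q \<longleftrightarrow>
     (\<forall>x y. q (x + y) = q x + q y) \<and> (\<forall>c x. q (hscale c x) = hscale c (q x)) \<and>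
     (\<exists>K. \<forall>x. norm (q x) \<le> K * norm x) \<and>
     (\<forall>x. q (q x) = q x) \<and> (\<forall>x y. hinner (q x) y = hinner x (q y))"

definition is_proj_on :: "'h::chilbert set \<Rightarrow> ('h \<Rightarrow> 'h) \<Rightarrow> bool" where
  "is_proj_on K q \<longleftrightarrow>
     (\<forall>x\<in>K. q x \<in> K) \<and>
     (\<forall>x\<in>K. \<forall>y\<in>K. q (x + y) = q x + q y) \<and> (\<forall>c. \<forall>x\<in>K. q (hscale c x) = hscale c (q x)) \<and>
     (\<exists>B. \<forall>x\<in>K. norm (q x) \<le> B * norm x) \<and>
     (\<forall>x\<in>K. q (q x) = q x) \<and> (\<forall>x\<in>K. \<forall>y\<in>K. hinner (q x) y = hinner x (q y))"

definition is_pvm :: "'h::chilbert set \<Rightarrow> 'b set \<Rightarrow> 'b set set \<Rightarrow> ('b set \<Rightarrow> 'h \<Rightarrow> 'h) \<Rightarrow> bool" where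
  "is_pvm K X F q \<longleftrightarrow>
     (\<forall>A\<in>F. is_proj_on K (q A)) \<and> (\<forall>x\<in>K. q X x = x) \<and>
     (\<forall>A::nat \<Rightarrow> 'b set. range A \<subseteq> F \<longrightarrow> disjoint_family A \<longrightarrow>
        (\<forall>x\<in>K. (\<lambda>i. q (A i) x) sums q (\<Union>(range A)) x))"

definition orth_decomp3 :: "'h::chilbert set \<Rightarrow> 'h set \<Rightarrow> 'h set \<Rightarrow> bool" where
  "orth_decomp3 U V W \<longleftrightarrow>
     (\<forall>u\<in>U. \<forall>v\<in>V. hinner u v = 0) \<and> (\<forall>u\<in>U. \<forall>w\<in>W. hinner u w = 0) \<and>
     (\<forall>v\<in>V. \<forall>w\<in>W. hinner v w = 0) \<and>
     (\<forall>x. \<exists>u\<in>U. \<exists>v\<in>V. \<exists>w\<in>W. x = u + v + w)"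

definition self_adjoint_in :: "'h::chilbert set \<Rightarrow> ('h \<Rightarrow> 'h) \<Rightarrow> 'h set \<Rightarrow> bool" where
  "self_adjoint_in K Q D \<longleftrightarrow>
     D \<subseteq> K \<and> csubspace D \<and> K \<subseteq> closure D \<and> (\<forall>x\<in>D. Q x \<in> K) \<and>
     (\<forall>x\<in>D. \<forall>y\<in>D. Q (x + y) = Q x + Q y) \<and> (\<forall>c. \<forall>x\<in>D. Q (hscale c x) = hscale c (Q x)) \<and>
     (\<forall>x\<in>D. \<forall>y\<in>D. hinner (Q x) y = hinner x (Q y)) \<and>
     (\<forall>y\<in>K. (\<exists>z\<in>K. \<forall>x\<in>D. hinner (Q x) y = hinner x z) \<longrightarrow> y \<in> D)"

definition spec_meas :: "(real set \<Rightarrow> 'h::chilbert \<Rightarrow> 'h) \<Rightarrow> 'h \<Rightarrow> real measure" where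
  "spec_meas E x = measure_of UNIV (sets borel) (\<lambda>B. ennreal ((norm (E B x))\<^sup>2))"

text \<open>\<open>E\<close> is the spectral decomposition of \<open>Q\<close> (domain \<open>D\<close>) in \<open>K\<close>, i.e.
  \<open>Q = \<integral> \<lambda> dE(\<lambda>)\<close>: \<open>D = {x. \<integral> \<lambda>\<^sup>2 d\<parallel>E x\<parallel>\<^sup>2 < \<infinity>}\<close> and
  \<open>\<langle>x, Q x\<rangle> = \<integral> \<lambda> d\<parallel>E x\<parallel>\<^sup>2\<close> on \<open>D\<close> (which determines \<open>Q\<close> by polarization).\<close>
definition has_spec_decomp :: "'h::chilbert set \<Rightarrow> ('h \<Rightarrow> 'h) \<Rightarrow> 'h set \<Rightarrow> (real set \<Rightarrow> 'h \<Rightarrow> 'h) \<Rightarrow> bool" where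
  "has_spec_decomp K Q D E \<longleftrightarrow>
     is_pvm K UNIV (sets borel) E \<and>
     D = {x\<in>K. (\<integral>\<^sup>+ l. ennreal (l\<^sup>2) \<partial>spec_meas E x) < \<infinity>} \<and>
     (\<forall>x\<in>D. Q x \<in> K) \<and>
     (\<forall>x\<in>D. \<forall>y\<in>D. Q (x + y) = Q x + Q y) \<and> (\<forall>c. \<forall>x\<in>D. Q (hscale c x) = hscale c (Q x)) \<and>
     (\<forall>x\<in>D. hinner x (Q x) = complex_of_real (integral\<^sup>L (spec_meas E x) (\<lambda>l. l)))"

definition setting :: "'s set \<Rightarrow> ('s \<Rightarrow> 'a set) \<Rightarrow> ('s \<Rightarrow> 'a \<Rightarrow> 'h::chilbert \<Rightarrow> 'h) \<Rightarrow> bool" where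
  "setting S \<Gamma> p \<longleftrightarrow>
     (\<forall>t\<in>S. countable (\<Gamma> t) \<and> (\<forall>a\<in>\<Gamma> t. is_proj (p t a)) \<and>
            (\<forall>x. ((\<lambda>a. p t a x) has_sum x) (\<Gamma> t)))"

definition pi_list :: "'s set \<Rightarrow> ('s \<Rightarrow> 'a set) \<Rightarrow> ('s \<times> 'a) list set" where
  "pi_list S \<Gamma> = {xs. \<forall>(t, a)\<in>set xs. t \<in> S \<and> a \<in> \<Gamma> t}"

text \<open>\<open>prod_apply p [(t\<^sub>1,a\<^sub>1),\<dots>,(t\<^sub>k,a\<^sub>k)] x = p\<^sup>t\<^sup>k\<^sub>a\<^sub>k \<cdots> p\<^sup>t\<^sup>1\<^sub>a\<^sub>1 x\<close> (first element applied first).\<close>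
definition prod_apply :: "('s \<Rightarrow> 'a \<Rightarrow> 'h \<Rightarrow> 'h) \<Rightarrow> ('s \<times> 'a) list \<Rightarrow> 'h \<Rightarrow> 'h" where
  "prod_apply p xs x = fold (\<lambda>(t, a) v. p t a v) xs x"

definition commutes_on :: "'s set \<Rightarrow> ('s \<Rightarrow> 'a set) \<Rightarrow> ('s \<Rightarrow> 'a \<Rightarrow> 'h \<Rightarrow> 'h) \<Rightarrow> 'h \<Rightarrow> bool" where
  "commutes_on S \<Gamma> p x \<longleftrightarrow>
     (\<forall>xs\<in>pi_list S \<Gamma>. \<forall>ys\<in>pi_list S \<Gamma>.
        mset (map (\<lambda>(t, a). p t a) xs) = mset (map (\<lambda>(t, a). p t a) ys) \<longrightarrow>
        prod_apply p xs x = prod_apply p ys x)"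

definition Hpi :: "'s set \<Rightarrow> ('s \<Rightarrow> 'a set) \<Rightarrow> ('s \<Rightarrow> 'a \<Rightarrow> 'h \<Rightarrow> 'h) \<Rightarrow> 'h set" where
  "Hpi S \<Gamma> p = {x. commutes_on S \<Gamma> p x}"

definition pw :: "('s \<Rightarrow> 'a \<Rightarrow> 'h::chilbert \<Rightarrow> 'h) \<Rightarrow> ('s \<times> 'a) list \<Rightarrow> 'h \<Rightarrow> 'h" where
  "pw p xs = proj_onto {v. \<forall>(t, a)\<in>set xs. v \<in> range (p t a)}"

definition Hpi' :: "'s set \<Rightarrow> ('s \<Rightarrow> 'a set) \<Rightarrow> ('s \<Rightarrow> 'a \<Rightarrow> 'h::chilbert \<Rightarrow> 'h) \<Rightarrow> 'h set" where
  "Hpi' S \<Gamma> p = {x. \<forall>xs\<in>pi_list S \<Gamma>. pw p xs x = prod_apply p (rev xs) x}"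

definition Hpi'' :: "'s set \<Rightarrow> ('s \<Rightarrow> 'a set) \<Rightarrow> ('s \<Rightarrow> 'a \<Rightarrow> 'h::chilbert \<Rightarrow> 'h) \<Rightarrow> 'h set" where
  "Hpi'' S \<Gamma> p = {x. \<forall>ts\<in>lists S. ((\<lambda>as. pw p (zip ts as) x) has_sum x) (listset (map \<Gamma> ts))}"

definition Nset :: "'s set \<Rightarrow> ('s \<Rightarrow> 'a set) \<Rightarrow> ('s \<Rightarrow> 'a \<Rightarrow> 'h::chilbert \<Rightarrow> 'h) \<Rightarrow> 'h set" where
  "Nset S \<Gamma> p = {x. \<exists>ts\<in>lists S. \<forall>as\<in>listset (map \<Gamma> ts). pw p (zip ts as) x = 0}"

definition Omega :: "'s set \<Rightarrow> ('s \<Rightarrow> 'a set) \<Rightarrow> ('s \<Rightarrow> 'a) set" where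
  "Omega S \<Gamma> = PiE S \<Gamma>"

definition Msig :: "'s set \<Rightarrow> ('s \<Rightarrow> 'a set) \<Rightarrow> ('s \<Rightarrow> 'a) measure" where
  "Msig S \<Gamma> = sigma (Omega S \<Gamma>) {{w \<in> Omega S \<Gamma>. w t = a} | t a. t \<in> S \<and> a \<in> \<Gamma> t}"

definition cyl :: "'s set \<Rightarrow> ('s \<Rightarrow> 'a set) \<Rightarrow> ('s \<times> 'a) list \<Rightarrow> ('s \<Rightarrow> 'a) set" where
  "cyl S \<Gamma> xs = {w \<in> Omega S \<Gamma>. \<forall>(t, a)\<in>set xs. w t = a}"

definition is_Pphi :: "'s set \<Rightarrow> ('s \<Rightarrow> 'a set) \<Rightarrow> ('s \<Rightarrow> 'a \<Rightarrow> 'h::chilbert \<Rightarrow> 'h) \<Rightarrow> 'h \<Rightarrow> ('s \<Rightarrow> 'a) measure \<Rightarrow> bool" where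
  "is_Pphi S \<Gamma> p x P \<longleftrightarrow>
     sets P = sets (Msig S \<Gamma>) \<and> prob_space P \<and>
     (\<forall>xs\<in>pi_list S \<Gamma>.
        measure P (cyl S \<Gamma> xs) = (norm (pw p xs (hat x)))\<^sup>2 \<and>
        measure P (cyl S \<Gamma> xs) = (norm (prod_apply p xs (hat x)))\<^sup>2)"

definition Pphi :: "'s set \<Rightarrow> ('s \<Rightarrow> 'a set) \<Rightarrow> ('s \<Rightarrow> 'a \<Rightarrow> 'h::chilbert \<Rightarrow> 'h) \<Rightarrow> 'h \<Rightarrow> ('s \<Rightarrow> 'a) measure" where
  "Pphi S \<Gamma> p x = (THE P. is_Pphi S \<Gamma> p x P)"

end

theory Submission
  imports Defs
begin

text \<open>
  For fixed \<open>t\<^sub>1, \<dots>, t\<^sub>k\<close> the intersections of the ranges of \<open>p\<^bsub>t\<^sub>i,a\<^sub>i\<^esub>\<close> are pairwise orthogonal in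
  \<open>(a\<^sub>1, \<dots>, a\<^sub>k)\<close>, so the sum of the projections onto them is the projection onto the orthogonal
  complement of their common kernel; the union of these kernels is \<open>N\<close>, which gives
  \<open>H\<^sub>\<pi>'' = N\<^sup>\<bottom>\<close>. The summands of \<open>\<phi> \<in> H\<^sub>\<pi>''\<close> are joint eigenvectors
  of the projections involved, on which all orders of multiplication agree, and conversely products
  applied to a vector of \<open>H\<^sub>\<pi>\<close> resolve it completely, so that it is orthogonal to \<open>N\<close>.

  On \<open>H\<^sub>\<pi>\<close> the weights \<open>\<parallel>p \<phi>\<parallel>\<^sup>2\<close> form a consistent family of discrete laws, and Kolmogorov's extension
  theorem, applied after enumerating each \<open>\<Gamma>(t)\<close> by real numbers, yields \<open>P\<^sub>\<phi>\<close>. The sets \<open>A\<close> for which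
  \<open>\<phi> \<mapsto> \<parallel>\<phi>\<parallel>\<^sup>2 P\<^sub>\<phi>(A)\<close> is the squared norm of the projection onto a closed subspace form a Dynkin system
  containing the cylinders, whence the projection valued measure.

  The operator \<open>Q\<^sub>f\<close> is the pointwise limit of the integrals of simple functions approximating \<open>f\<close>;
  it is self-adjoint because a vector \<open>y\<close> in the domain of the adjoint satisfies
  \<open>\<parallel>Q\<^sub>f p\<^bsub>{|f| \<le> n}\<^esub> y\<parallel> \<le> \<parallel>Q\<^sub>f\<^sup>* y\<parallel>\<close> for every \<open>n\<close>.
\<close>

section \<open>Complex Hilbert spaces\<close>

text \<open>Two obstacles shape the construction. The vectors of full probability for an event do
  not visibly form a linear space, since the measure depends on the vector quadratically. A closed
  subspace is therefore sought whose projection computes the weight ||phi||^2 P_phi(A); such a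
  subspace is determined by A, and it must consist of the vectors of full probability. Closure of
  these events under disjoint unions rests on one fact: full probability on one event leaves none
  for a disjoint one, so the two subspaces are orthogonal. The setting, moreover, only says that the
  projections for fixed t sum to the identity. Their mutual orthogonality has to be derived, and so
  do contractivity and multiplicativity of a projection valued measure, in each case by comparing
  norms. Real codes enter because a countable set of values carries no topology, while the extension
  theorem is about Polish coordinates. For the unbounded operators, lying in the domain is restated
  as boundedness of the approximating vectors, so that linearity of the approximants gives linearity
  of the domain.\<close>

lemma hscale_zero_right [simp]: "hscale c (0::'h::chilbert) = 0"
  using hscale_add_right[of c "0::'h" 0] by simp

lemma hscale_minus_one [simp]: "hscale (-1) x = - (x::'h::chilbert)"
  using hscale_of_real[of "-1" x] by simp

lemma hinner_add_right: "hinner x (y + z) = hinner x y + hinner (x::'h::chilbert) z"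
  by (metis hinner_commute hinner_add_left complex_cnj_add)

lemma hinner_scale_right: "hinner x (hscale c y) = cnj c * hinner (x::'h::chilbert) y"
  by (metis hinner_commute hinner_scale_left complex_cnj_mult)

lemma hinner_scaleR_left: "hinner (scaleR r x) y = r *\<^sub>R hinner (x::'h::chilbert) y"
  by (metis hscale_of_real hinner_scale_left scaleR_conv_of_real)

lemma hinner_scaleR_right: "hinner x (scaleR r y) = r *\<^sub>R hinner (x::'h::chilbert) y"
  by (metis hscale_of_real hinner_scale_right complex_cnj_complex_of_real scaleR_conv_of_real)

lemma hinner_zero_left [simp]: "hinner 0 (y::'h::chilbert) = 0"
  using hinner_add_left[of 0 0 y] by simp

lemma hinner_zero_right [simp]: "hinner (x::'h::chilbert) 0 = 0"
  using hinner_add_right[of x 0 0] by simp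

lemma hinner_minus_left [simp]: "hinner (- x) y = - hinner (x::'h::chilbert) y"
  using hinner_scaleR_left[of "-1" x y] by simp

lemma hinner_minus_right [simp]: "hinner x (- y) = - hinner (x::'h::chilbert) y"
  using hinner_scaleR_right[of x "-1" y] by simp

lemma hinner_diff_left: "hinner (x - y) z = hinner x z - hinner (y::'h::chilbert) z"
  using hinner_add_left[of x "- y" z] by simp

lemma hinner_eq_zero_iff [simp]: "hinner x x = 0 \<longleftrightarrow> x = (0::'h::chilbert)"
  by (simp add: hinner_norm)

lemma hinner_eq_zero_commute: "hinner x y = 0 \<longleftrightarrow> hinner y (x::'h::chilbert) = 0"
  by (metis hinner_commute complex_cnj_zero_iff)

lemma Re_hinner_self: "Re (hinner x x) = (norm (x::'h::chilbert))\<^sup>2"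
  by (simp add: hinner_norm)

lemma norm_add_sq:
  "(norm (x + y))\<^sup>2 = (norm x)\<^sup>2 + (norm y)\<^sup>2 + 2 * Re (hinner x (y::'h::chilbert))"
proof -
  have "Re (hinner y x) = Re (hinner x y)"
    by (subst hinner_commute) simp
  then show ?thesis
    unfolding Re_hinner_self[symmetric] by (simp add: hinner_add_left hinner_add_right)
qed

lemma norm_add_sq_orth:
  "hinner x y = 0 \<Longrightarrow> (norm (x + y))\<^sup>2 = (norm x)\<^sup>2 + (norm (y::'h::chilbert))\<^sup>2"
  by (simp add: norm_add_sq)

lemma norm_diff_sq:
  "(norm (x - y))\<^sup>2 = (norm x)\<^sup>2 + (norm y)\<^sup>2 - 2 * Re (hinner x (y::'h::chilbert))"
  using norm_add_sq[of x "- y"] by simp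

lemma parallelogram_law:
  "(norm (x - y))\<^sup>2 = 2 * (norm x)\<^sup>2 + 2 * (norm y)\<^sup>2 - (norm (x + (y::'h::chilbert)))\<^sup>2"
  by (simp add: norm_add_sq norm_diff_sq)

lemma norm_hscale: "norm (hscale c x) = cmod c * norm (x::'h::chilbert)"
proof -
  have "(norm (hscale c x))\<^sup>2 = (cmod c * norm x)\<^sup>2"
    unfolding Re_hinner_self[symmetric] hinner_scale_left hinner_scale_right
    by (simp add: hinner_norm cmod_power2 power_mult_distrib) (simp add: power2_eq_square algebra_simps)
  then show ?thesis by (simp add: power2_eq_iff_nonneg)
qed

text \<open>With this \<open>c\<close> the vector \<open>x - hscale c y\<close> is the residual of x
  against the line through y; its squared norm is ||x||^2 - |<x,y>|^2 / ||y||^2 and cannot be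
  negative.\<close>

lemma hinner_Cauchy_Schwarz: "cmod (hinner x y) \<le> norm x * norm (y::'h::chilbert)"
proof (cases "y = 0")
  case False
  define c where "c = hinner x y / complex_of_real ((norm y)\<^sup>2)"
  have n: "(norm y)\<^sup>2 > 0" using False by simp
  have "0 \<le> (norm (x - hscale c y))\<^sup>2" by simp
  also have "\<dots> = (norm x)\<^sup>2 + (cmod c * norm y)\<^sup>2 - 2 * Re (cnj c * hinner x y)"
    by (simp add: norm_diff_sq norm_hscale hinner_scale_right)
  also have "cnj c * hinner x y = complex_of_real ((cmod (hinner x y))\<^sup>2 / (norm y)\<^sup>2)"
    unfolding c_def by (simp add: complex_norm_square[symmetric] mult.commute)
  also have "(cmod c * norm y)\<^sup>2 = (cmod (hinner x y))\<^sup>2 / (norm y)\<^sup>2"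
    using n by (simp add: c_def norm_divide power_mult_distrib power_divide norm_power power4_eq_xxxx)
       (simp add: power2_eq_square)
  finally have "(cmod (hinner x y))\<^sup>2 / (norm y)\<^sup>2 \<le> (norm x)\<^sup>2" by simp
  then have "(cmod (hinner x y))\<^sup>2 \<le> (norm x * norm y)\<^sup>2"
    using n by (simp add: field_simps power_mult_distrib)
  then show ?thesis by (simp add: power2_le_iff_abs_le)
qed simp

text \<open>Only real scalars are involved, so conjugate linearity in the second slot does no harm.
  The interpretation supplies limits and sums in either slot.\<close>

interpretation hinner: bounded_bilinear "hinner :: 'h::chilbert \<Rightarrow> 'h \<Rightarrow> complex"
proof
  show "\<exists>K. \<forall>a b::'h. norm (hinner a b) \<le> norm a * norm b * K"
    using hinner_Cauchy_Schwarz by (intro exI[of _ 1]) auto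
qed (simp_all add: hinner_add_left hinner_add_right hinner_scaleR_left hinner_scaleR_right)

lemma bounded_linear_hscale: "bounded_linear (hscale c :: 'h::chilbert \<Rightarrow> 'h)"
proof (rule bounded_linear_intro[where K = "cmod c"])
  show "hscale c (r *\<^sub>R x) = r *\<^sub>R hscale c x" for r and x :: 'h
    by (simp flip: hscale_of_real add: hscale_assoc mult.commute)
qed (simp_all add: hscale_add_right norm_hscale mult.commute)

section \<open>Orthogonal projections\<close>

definition closed_csubspace :: "'h::chilbert set \<Rightarrow> bool" where
  "closed_csubspace V \<longleftrightarrow> closed V \<and> csubspace V"

lemma csubspaceD:
  assumes "csubspace V"
  shows csubspace_0: "0 \<in> V"
    and csubspace_add: "x \<in> V \<Longrightarrow> y \<in> V \<Longrightarrow> x + y \<in> V"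
    and csubspace_hscale: "x \<in> V \<Longrightarrow> hscale c x \<in> V"
    and csubspace_scaleR: "x \<in> V \<Longrightarrow> r *\<^sub>R x \<in> V"
    and csubspace_minus: "x \<in> V \<Longrightarrow> - x \<in> V"
  using assms unfolding csubspace_def
  by (auto simp flip: hscale_of_real hscale_minus_one)

lemma csubspace_diff: "csubspace V \<Longrightarrow> x \<in> V \<Longrightarrow> y \<in> V \<Longrightarrow> x - y \<in> V"
  using csubspace_add[of V x "- y"] csubspace_minus[of V y] by simp

lemma csubspace_sum: "csubspace V \<Longrightarrow> (\<And>i. i \<in> F \<Longrightarrow> g i \<in> V) \<Longrightarrow> sum g F \<in> V"
  by (induction F rule: infinite_finite_induct) (auto simp: csubspaceD)

lemma closed_csubspaceD:
  "closed_csubspace V \<Longrightarrow> closed V" "closed_csubspace V \<Longrightarrow> csubspace V"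
  by (auto simp: closed_csubspace_def)

lemma closed_csubspace_zero [simp]: "closed_csubspace {0}"
  by (auto simp: closed_csubspace_def csubspace_def)

lemma closed_csubspace_Inter:
  "(\<And>i. i \<in> I \<Longrightarrow> closed_csubspace (V i)) \<Longrightarrow> closed_csubspace (\<Inter>i\<in>I. V i)"
  unfolding closed_csubspace_def csubspace_def by auto

lemma closed_csubspace_Int:
  "closed_csubspace V \<Longrightarrow> closed_csubspace W \<Longrightarrow> closed_csubspace (V \<inter> W)"
  unfolding closed_csubspace_def csubspace_def by auto

lemma orthD:
  assumes "x \<in> orth V" "y \<in> V"
  shows "hinner x y = 0" "hinner y x = 0"
  using assms hinner_eq_zero_commute[of x y] by (auto simp: orth_def)

lemma closed_csubspace_orth [simp]: "closed_csubspace (orth (V::'h::chilbert set))"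
proof -
  have "orth V = (\<Inter>y\<in>V. (\<lambda>x. hinner x y) -` {0})" by (auto simp: orth_def)
  moreover have "closed ((\<lambda>x. hinner x y) -` {0})" for y :: 'h
    by (intro closed_vimage closed_singleton linear_continuous_on hinner.bounded_linear_left)
  moreover have "csubspace (orth V)"
    by (auto simp: csubspace_def orth_def hinner_add_left hinner_scale_left)
  ultimately show ?thesis unfolding closed_csubspace_def by auto
qed

lemma csubspace_closure:
  assumes "csubspace (V::'h::chilbert set)" shows "csubspace (closure V)"
  unfolding csubspace_def
proof (intro conjI ballI allI)
  show "0 \<in> closure V" using csubspace_0[OF assms] closure_subset by blast
next
  fix x y assume "x \<in> closure V" "y \<in> closure V"
  then obtain f g where "\<forall>n. f n \<in> V" "f \<longlonglongrightarrow> x" "\<forall>n. g n \<in> V" "g \<longlonglongrightarrow> y"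
    unfolding closure_sequential by blast
  then show "x + y \<in> closure V" unfolding closure_sequential
    by (intro exI[of _ "\<lambda>n. f n + g n"]) (auto intro!: tendsto_add csubspace_add[OF assms])
next
  fix c x assume "x \<in> closure V"
  then obtain f where "\<forall>n. f n \<in> V" "f \<longlonglongrightarrow> x" unfolding closure_sequential by blast
  then show "hscale c x \<in> closure V" unfolding closure_sequential
    by (intro exI[of _ "\<lambda>n. hscale c (f n)"])
       (auto intro!: bounded_linear.tendsto[OF bounded_linear_hscale] csubspace_hscale[OF assms])
qed

lemma closed_csubspace_closure: "csubspace V \<Longrightarrow> closed_csubspace (closure V)"
  by (simp add: closed_csubspace_def csubspace_closure)

lemma closed_csubspace_LIMSEQ:
  "closed_csubspace V \<Longrightarrow> (\<And>n. g n \<in> V) \<Longrightarrow> g \<longlonglongrightarrow> l \<Longrightarrow> l \<in> V"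
  using closed_sequentially[of V g l] by (auto simp: closed_csubspace_def)

section \<open>Nearest points and existence of orthogonal projections\<close>

text \<open>Moving y by the best multiple of z lowers the squared distance to x by |<x-y,z>|^2 /
  ||z||^2, which minimality allows only if it is 0.\<close>

lemma nearest_point_orthogonal:
  fixes x :: "'h::chilbert"
  assumes V: "csubspace V" and y: "y \<in> V" and min: "\<And>v. v \<in> V \<Longrightarrow> norm (x - y) \<le> norm (x - v)"
    and z: "z \<in> V"
  shows "hinner (x - y) z = 0"
proof (cases "z = 0")
  case False
  define c where "c = hinner (x - y) z / complex_of_real ((norm z)\<^sup>2)"
  have n: "(norm z)\<^sup>2 > 0" using False by simp
  have "y + hscale c z \<in> V" using V y z by (intro csubspaceD)
  then have "norm (x - y) \<le> norm (x - y - hscale c z)" using min[of "y + hscale c z"] by (simp add: algebra_simps)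
  then have "(norm (x - y))\<^sup>2 \<le> (norm (x - y - hscale c z))\<^sup>2" by simp
  also have "\<dots> = (norm (x - y))\<^sup>2 + (cmod c * norm z)\<^sup>2 - 2 * Re (cnj c * hinner (x - y) z)"
    by (simp add: norm_diff_sq[of "x - y"] norm_hscale hinner_scale_right)
  also have "cnj c * hinner (x - y) z = complex_of_real ((cmod (hinner (x - y) z))\<^sup>2 / (norm z)\<^sup>2)"
    unfolding c_def by (simp add: complex_norm_square[symmetric] mult.commute)
  also have "(cmod c * norm z)\<^sup>2 = (cmod (hinner (x - y) z))\<^sup>2 / (norm z)\<^sup>2"
    using n by (simp add: c_def norm_divide power_mult_distrib power_divide norm_power power4_eq_xxxx)
       (simp add: power2_eq_square)
  finally have "(cmod (hinner (x - y) z))\<^sup>2 / (norm z)\<^sup>2 \<le> 0" by simp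
  then have "(cmod (hinner (x - y) z))\<^sup>2 \<le> 0"
    using n by (simp add: divide_le_0_iff)
  then show ?thesis by simp
qed simp

text \<open>A minimizing sequence is Cauchy: the midpoint of two of its members lies in V, hence at
  distance at least d from x, and the parallelogram law turns this into a bound on the distance of
  the two members.\<close>

lemma nearest_point_exists:
  fixes x :: "'h::chilbert"
  assumes "closed_csubspace V"
  obtains y where "y \<in> V" "\<And>v. v \<in> V \<Longrightarrow> norm (x - y) \<le> norm (x - v)"
proof -
  note V = closed_csubspaceD[OF assms]
  define d where "d = (INF v\<in>V. norm (x - v))"
  have ne: "V \<noteq> {}" using csubspace_0[OF V(2)] by auto
  have bdd: "bdd_below ((\<lambda>v. norm (x - v)) ` V)" by (rule bdd_belowI2[of _ 0]) simp
  have d_le: "d \<le> norm (x - v)" if "v \<in> V" for v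
    unfolding d_def by (rule cINF_lower[OF bdd that])
  have d0: "d \<ge> 0" unfolding d_def by (rule cINF_greatest[OF ne]) simp
  have "\<exists>v\<in>V. norm (x - v) < d + 1 / real (Suc n)" for n
    using cInf_lessD[of "(\<lambda>v. norm (x - v)) ` V" "d + 1 / real (Suc n)"] ne
    unfolding d_def by auto
  then obtain g where g: "\<And>n. g n \<in> V" "\<And>n. norm (x - g n) < d + 1 / real (Suc n)"
    by metis
  have lim: "(\<lambda>n. norm (x - g n)) \<longlonglongrightarrow> d"
  proof (rule tendsto_sandwich[OF _ _ tendsto_const])
    show "(\<lambda>n. d + 1 / real (Suc n)) \<longlonglongrightarrow> d"
      using tendsto_add[OF tendsto_const LIMSEQ_inverse_real_of_nat, of d] by (simp add: divide_inverse)
  qed (use g d_le in \<open>auto intro: less_imp_le always_eventually\<close>)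
  have key: "(norm (g m - g n))\<^sup>2 \<le> 2 * (norm (x - g m))\<^sup>2 + 2 * (norm (x - g n))\<^sup>2 - 4 * d\<^sup>2" for m n
  proof -
    have "(1/2) *\<^sub>R (g m + g n) \<in> V" using g V by (intro csubspaceD)
    then have "d \<le> norm (x - (1/2) *\<^sub>R (g m + g n))" by (rule d_le)
    then have "d\<^sup>2 \<le> (norm (x - (1/2) *\<^sub>R (g m + g n)))\<^sup>2" using d0 by (rule power_mono)
    moreover have "(x - g n) + (x - g m) = 2 *\<^sub>R (x - (1/2) *\<^sub>R (g m + g n))"
      by (simp add: algebra_simps scaleR_2)
    then have "(norm ((x - g n) + (x - g m)))\<^sup>2 = 4 * (norm (x - (1/2) *\<^sub>R (g m + g n)))\<^sup>2"
      by (simp add: power_mult_distrib)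
    ultimately show ?thesis using parallelogram_law[of "x - g n" "x - g m"] by simp
  qed
  have "Cauchy g"
  proof (rule CauchyI)
    fix e :: real assume e: "e > 0"
    have "(\<lambda>n. 2 * (norm (x - g n))\<^sup>2) \<longlonglongrightarrow> 2 * d\<^sup>2"
      by (intro tendsto_intros lim)
    then have "eventually (\<lambda>n. 2 * (norm (x - g n))\<^sup>2 < 2 * d\<^sup>2 + e\<^sup>2 / 2) sequentially"
      by (rule order_tendstoD) (use e in simp)
    then obtain M where M: "\<And>n. n \<ge> M \<Longrightarrow> 2 * (norm (x - g n))\<^sup>2 < 2 * d\<^sup>2 + e\<^sup>2 / 2"
      unfolding eventually_sequentially by auto
    have "norm (g m - g n) < e" if "m \<ge> M" "n \<ge> M" for m n
    proof (rule power2_less_imp_less)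
      show "(norm (g m - g n))\<^sup>2 < e\<^sup>2" using key[of m n] M[OF that(1)] M[OF that(2)] by simp
    qed (use e in simp)
    then show "\<exists>M. \<forall>m\<ge>M. \<forall>n\<ge>M. norm (g m - g n) < e" by blast
  qed
  then obtain y where y: "g \<longlonglongrightarrow> y" by (auto simp: Cauchy_convergent_iff convergent_def)
  have "y \<in> V" using closed_csubspace_LIMSEQ[OF assms g(1) y] .
  moreover have "norm (x - y) = d"
    by (rule LIMSEQ_unique[OF _ lim]) (intro tendsto_intros y)
  ultimately show thesis using d_le by (intro that) auto
qed

text \<open>Two candidates differ by a vector of V that is orthogonal to V, hence to itself.
  Projections are computed by this criterion throughout, which also resolves the definite
  description in \<open>proj_onto\<close>.\<close>

lemma proj_onto_unique:
  fixes x :: "'h::chilbert"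
  assumes "csubspace V" "y \<in> V" "\<And>z. z \<in> V \<Longrightarrow> hinner (x - y) z = 0"
  shows "proj_onto V x = y"
  unfolding proj_onto_def
proof (rule the_equality)
  fix y' assume y': "y' \<in> V \<and> (\<forall>z\<in>V. hinner (x - y') z = 0)"
  have *: "y - y' \<in> V" using assms y' by (auto intro: csubspace_diff)
  have "hinner (x - y') (y - y') - hinner (x - y) (y - y') = 0"
    using y' assms(3) * by auto
  then have "hinner (y - y') (y - y') = 0" by (simp add: hinner_diff_left)
  then show "y' = y" by simp
qed (use assms in auto)

lemma proj_onto_props:
  assumes "closed_csubspace V"
  shows proj_onto_in [simp]: "proj_onto V x \<in> V"
    and hinner_proj_residual: "z \<in> V \<Longrightarrow> hinner (x - proj_onto V x) z = 0"
proof -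
  note V = closed_csubspaceD[OF assms]
  obtain y where y: "y \<in> V" "\<And>v. v \<in> V \<Longrightarrow> norm (x - y) \<le> norm (x - v)"
    using nearest_point_exists[OF assms] by blast
  have o: "\<And>z. z \<in> V \<Longrightarrow> hinner (x - y) z = 0"
    using nearest_point_orthogonal[OF V(2) y] by blast
  have "proj_onto V x = y" by (rule proj_onto_unique[OF V(2) y(1) o])
  then show "proj_onto V x \<in> V" "z \<in> V \<Longrightarrow> hinner (x - proj_onto V x) z = 0"
    using y o by auto
qed

context
  fixes V :: "'h::chilbert set"
  assumes V: "closed_csubspace V"
begin

lemma hinner_proj_right: "z \<in> V \<Longrightarrow> hinner (proj_onto V x) z = hinner x z"
  using hinner_proj_residual[OF V, of z x] by (simp add: hinner_diff_left)

lemma hinner_proj_left: "z \<in> V \<Longrightarrow> hinner z (proj_onto V x) = hinner z x"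
  using hinner_proj_right[of z x] by (metis hinner_commute)

lemma proj_onto_id: "x \<in> V \<Longrightarrow> proj_onto V x = x"
  using V by (intro proj_onto_unique) (auto dest: closed_csubspaceD)

lemma proj_onto_idem [simp]: "proj_onto V (proj_onto V x) = proj_onto V x"
  using V by (simp add: proj_onto_id)

lemma proj_onto_iff: "proj_onto V x = x \<longleftrightarrow> x \<in> V"
  using proj_onto_id proj_onto_in[OF V] by metis

lemma proj_onto_add: "proj_onto V (x + y) = proj_onto V x + proj_onto V y"
  by (rule proj_onto_unique)
     (use V closed_csubspaceD[OF V] hinner_proj_right in
       \<open>auto simp: hinner_diff_left hinner_add_left intro!: csubspace_add\<close>)

lemma proj_onto_hscale: "proj_onto V (hscale c x) = hscale c (proj_onto V x)"
  by (rule proj_onto_unique)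
     (use V closed_csubspaceD[OF V] hinner_proj_right in
       \<open>auto simp: hinner_diff_left hinner_scale_left intro!: csubspace_hscale\<close>)

lemma hinner_proj_commute: "hinner (proj_onto V x) y = hinner x (proj_onto V y)"
  using hinner_proj_left[OF proj_onto_in[OF V], of x y] hinner_proj_right[OF proj_onto_in[OF V], of x y]
  by simp

lemma hinner_proj_self: "hinner (proj_onto V x) x = complex_of_real ((norm (proj_onto V x))\<^sup>2)"
  by (metis hinner_norm hinner_proj_left proj_onto_in[OF V])

lemma norm_proj_Pythagoras:
  "(norm x)\<^sup>2 = (norm (proj_onto V x))\<^sup>2 + (norm (x - proj_onto V x))\<^sup>2"
proof -
  have "hinner (proj_onto V x) (x - proj_onto V x) = 0"
    using hinner_proj_residual[OF V proj_onto_in[OF V]] hinner_eq_zero_commute by blast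
  from norm_add_sq_orth[OF this] show ?thesis by simp
qed

lemma norm_proj_le: "norm (proj_onto V x) \<le> norm x"
proof (rule power2_le_imp_le)
  show "(norm (proj_onto V x))\<^sup>2 \<le> (norm x)\<^sup>2"
    using norm_proj_Pythagoras[of x] zero_le_power2[of "norm (x - proj_onto V x)"] by linarith
qed simp

lemma norm_proj_eq_iff: "norm (proj_onto V x) = norm x \<longleftrightarrow> x \<in> V"
proof
  assume "norm (proj_onto V x) = norm x"
  then have "(norm (x - proj_onto V x))\<^sup>2 = 0" using norm_proj_Pythagoras[of x] by (metis add_cancel_right_right)
  then show "x \<in> V" using proj_onto_iff[of x] by simp
qed (simp add: proj_onto_id)

lemma bounded_linear_proj_onto: "bounded_linear (proj_onto V)"
proof (rule bounded_linear_intro[where K = 1])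
  show "proj_onto V (r *\<^sub>R x) = r *\<^sub>R proj_onto V x" for r x
    using proj_onto_hscale[of "complex_of_real r" x] by (simp add: hscale_of_real)
qed (simp_all add: proj_onto_add norm_proj_le)

lemma proj_onto_eq_0_iff: "proj_onto V x = 0 \<longleftrightarrow> x \<in> orth V"
proof
  assume "proj_onto V x = 0"
  then show "x \<in> orth V" using hinner_proj_residual[OF V, of _ x] by (simp add: orth_def)
next
  assume "x \<in> orth V"
  then have "hinner x (proj_onto V x) = 0" using V by (simp add: orth_def)
  then have "hinner (proj_onto V x) (proj_onto V x) = 0" by (simp add: hinner_proj_commute)
  then show "proj_onto V x = 0" by simp
qed

lemma proj_onto_subset: "closed_csubspace W \<Longrightarrow> V \<subseteq> W \<Longrightarrow> proj_onto V (proj_onto W x) = proj_onto V x"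
proof -
  assume W: "closed_csubspace W" "V \<subseteq> W"
  have "x - proj_onto W x \<in> orth V"
    using hinner_proj_residual[OF W(1)] W(2) by (auto simp: orth_def)
  then have "proj_onto V (x - proj_onto W x) = 0" by (simp add: proj_onto_eq_0_iff)
  then show ?thesis using linear_diff[OF bounded_linear.linear[OF bounded_linear_proj_onto], of x "proj_onto W x"]
    by simp
qed

lemma proj_onto_residual_in_orth: "x - proj_onto V x \<in> orth V"
  using hinner_proj_residual[OF V] by (auto simp: orth_def)

lemma proj_onto_orth: "proj_onto (orth V) x = x - proj_onto V x"
proof (rule proj_onto_unique)
  show "csubspace (orth V)" using closed_csubspaceD(2)[OF closed_csubspace_orth] .
  show "hinner (x - (x - proj_onto V x)) z = 0" if "z \<in> orth V" for z
    using orthD(2)[OF that proj_onto_in[OF V]] by simp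
qed (rule proj_onto_residual_in_orth)

lemma orth_orth: "orth (orth V) = V"
proof -
  have "x \<in> orth (orth V) \<longleftrightarrow> x - proj_onto V x = 0" for x
  proof -
    have "proj_onto (orth V) x = 0 \<longleftrightarrow> x \<in> orth (orth V)"
    proof
      assume "x \<in> orth (orth V)"
      then have "hinner (x - proj_onto V x) (x - proj_onto V x) + hinner (proj_onto V x) (x - proj_onto V x) = 0"
        using proj_onto_residual_in_orth[of x] by (simp add: orth_def hinner_diff_left)
      moreover have "hinner (proj_onto V x) (x - proj_onto V x) = 0"
        using orthD(2)[OF proj_onto_residual_in_orth proj_onto_in[OF V]] .
      ultimately show "proj_onto (orth V) x = 0" by (simp add: proj_onto_orth)
    next
      assume "proj_onto (orth V) x = 0"
      then have "x \<in> V" by (metis eq_iff_diff_eq_0 proj_onto_iff proj_onto_orth)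
      then show "x \<in> orth (orth V)" using orthD(2) unfolding orth_def[of "orth V"] by blast
    qed
    then show ?thesis by (simp add: proj_onto_orth)
  qed
  then show ?thesis using proj_onto_iff by force
qed

end

text \<open>Orthogonality to a fixed x is a closed condition: \<open>orth {x}\<close> is a closed
  set, so it contains \<open>closure V\<close> as soon as it contains V.\<close>

lemma orth_closure: "orth (closure V) = orth (V::'h::chilbert set)"
proof
  show "orth (closure V) \<subseteq> orth V" using closure_subset by (auto simp: orth_def)
  show "orth V \<subseteq> orth (closure V)"
  proof
    fix x assume x: "x \<in> orth V"
    have "V \<subseteq> orth {x}" using orthD(2)[OF x] unfolding orth_def[of "{x}"] by blast
    then have "closure V \<subseteq> orth {x}"
      using closed_csubspaceD(1)[OF closed_csubspace_orth] by (intro closure_minimal) auto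
    then show "x \<in> orth (closure V)"
      using orthD(2)[of _ "{x}" x] unfolding orth_def[of "closure V"] by blast
  qed
qed

lemma orth_orth_closure: "csubspace V \<Longrightarrow> orth (orth V) = closure (V::'h::chilbert set)"
  by (metis orth_closure orth_orth closed_csubspace_closure)

section \<open>Bounded self-adjoint idempotents and their ranges\<close>

lemma is_proj_bounded_linear:
  assumes "is_proj (q::'h::chilbert \<Rightarrow> 'h)" shows "bounded_linear q"
proof -
  obtain K where K: "\<And>x. norm (q x) \<le> K * norm x" using assms unfolding is_proj_def by blast
  show ?thesis
  proof (rule bounded_linear_intro)
    show "q (r *\<^sub>R x) = r *\<^sub>R q x" for r x
      using assms unfolding is_proj_def by (metis hscale_of_real)
    show "norm (q x) \<le> norm x * K" for x using K[of x] by (simp add: mult.commute)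
  qed (use assms in \<open>auto simp: is_proj_def\<close>)
qed

lemma is_proj_range_iff: "is_proj q \<Longrightarrow> x \<in> range q \<longleftrightarrow> q x = (x::'h::chilbert)"
  unfolding is_proj_def by (metis rangeE rangeI)

lemma is_proj_closed_csubspace_range:
  assumes "is_proj (q::'h::chilbert \<Rightarrow> 'h)" shows "closed_csubspace (range q)"
proof -
  have "range q = {x. q x = x}" using is_proj_range_iff[OF assms] by blast
  moreover have "closed {x. q x = x}"
    by (intro closed_Collect_eq linear_continuous_on is_proj_bounded_linear assms continuous_on_id)
  moreover have "csubspace {x. q x = x}"
    using assms linear_0[OF bounded_linear.linear[OF is_proj_bounded_linear[OF assms]]]
    by (auto simp: csubspace_def is_proj_def)
  ultimately show ?thesis by (simp add: closed_csubspace_def)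
qed

section \<open>Orthogonal families of subspaces\<close>

text \<open>Needed three times: for tuples of values along a list of indices, for functions on a
  finite index set, and for the subspaces of disjoint events.\<close>

locale orthogonal_family =
  fixes V :: "'i \<Rightarrow> 'h::chilbert set" and I :: "'i set"
  assumes sub: "i \<in> I \<Longrightarrow> closed_csubspace (V i)"
    and orthogonal: "i \<in> I \<Longrightarrow> j \<in> I \<Longrightarrow> i \<noteq> j \<Longrightarrow> x \<in> V i \<Longrightarrow> y \<in> V j \<Longrightarrow> hinner x y = 0"
begin

text \<open>The orthogonal complement of the closed span of the family, that is, its defect from
  completeness.\<close>

definition annih where "annih = (\<Inter>i\<in>I. orth (V i))"

lemma annih_iff: "z \<in> annih \<longleftrightarrow> (\<forall>i\<in>I. proj_onto (V i) z = 0)"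
  by (auto simp: annih_def sub proj_onto_eq_0_iff)

lemma closed_csubspace_annih: "closed_csubspace annih"
  unfolding annih_def by (intro closed_csubspace_Inter) simp

lemma norm_sum_sq:
  assumes "finite F" "F \<subseteq> I" "\<And>i. i \<in> F \<Longrightarrow> g i \<in> V i"
  shows "(norm (sum g F))\<^sup>2 = (\<Sum>i\<in>F. (norm (g i))\<^sup>2)"
  using assms
proof (induction F rule: finite_induct)
  case (insert i F)
  have "hinner (g i) (sum g F) = (\<Sum>j\<in>F. hinner (g i) (g j))" by (rule hinner.sum_right)
  also have "\<dots> = 0"
  proof (intro sum.neutral ballI)
    fix j assume "j \<in> F"
    then show "hinner (g i) (g j) = 0"
      using insert.hyps insert.prems by (intro orthogonal[of i j]) auto
  qed
  finally show ?case using insert by (simp add: norm_add_sq_orth)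
qed simp

text \<open>The partial sum s satisfies Re <x,s> = ||s||^2, so 0 \<le> ||x-s||^2 = ||x||^2 -
  ||s||^2.\<close>

lemma Bessel:
  assumes "finite F" "F \<subseteq> I"
  shows "(\<Sum>i\<in>F. (norm (proj_onto (V i) x))\<^sup>2) \<le> (norm x)\<^sup>2"
proof -
  let ?s = "\<Sum>i\<in>F. proj_onto (V i) x"
  have "hinner x ?s = (\<Sum>i\<in>F. complex_of_real ((norm (proj_onto (V i) x))\<^sup>2))"
    unfolding hinner.sum_right
  proof (rule sum.cong[OF refl])
    fix i assume "i \<in> F"
    then have V: "closed_csubspace (V i)" using assms sub by auto
    show "hinner x (proj_onto (V i) x) = complex_of_real ((norm (proj_onto (V i) x))\<^sup>2)"
      using hinner_proj_self[OF V, of x] hinner_proj_commute[OF V, of x x] by simp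
  qed
  then have "Re (hinner x ?s) = (\<Sum>i\<in>F. (norm (proj_onto (V i) x))\<^sup>2)" by simp
  moreover have "(norm ?s)\<^sup>2 = (\<Sum>i\<in>F. (norm (proj_onto (V i) x))\<^sup>2)"
    using assms sub by (intro norm_sum_sq) auto
  moreover have "0 \<le> (norm (x - ?s))\<^sup>2" by simp
  ultimately show ?thesis unfolding norm_diff_sq by simp
qed

lemma norm_sq_summable: "(\<lambda>i. (norm (proj_onto (V i) x))\<^sup>2) summable_on I"
  by (rule nonneg_bdd_above_summable_on)
     (auto intro!: bdd_aboveI2[of _ _ "(norm x)\<^sup>2"] Bessel)

text \<open>Cauchy criterion along finite subsets: by Pythagoras the squared norm of a block of
  components is the block of their squared norms, and those are summable by Bessel's
  inequality.\<close>

lemma proj_summable: "(\<lambda>i. proj_onto (V i) x) summable_on I"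
proof -
  let ?g = "\<lambda>i. proj_onto (V i) x" and ?n = "\<lambda>i. (norm (proj_onto (V i) x))\<^sup>2"
  obtain L where L: "(?n has_sum L) I" using norm_sq_summable unfolding summable_on_def by blast
  have "cauchy_filter (filtermap (sum ?g) (finite_subsets_at_top I))"
    unfolding cauchy_filter_metric_filtermap
  proof (intro allI impI)
    fix e :: real assume e: "e > 0"
    then have "(e / 2)\<^sup>2 > 0" by simp
    \<comment> \<open>Two large finite sets are each compared with \<open>F0\<close>, so each
      distance may be at most half of e; the bound is squared because it applies to sums of squared
      norms.\<close>
    then have "eventually (\<lambda>F. dist (sum ?n F) L < (e / 2)\<^sup>2) (finite_subsets_at_top I)"
      using L unfolding has_sum_def by (rule tendstoD[rotated])
    then obtain F0 where F0: "finite F0" "F0 \<subseteq> I"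
        "\<forall>F. finite F \<and> F0 \<subseteq> F \<and> F \<subseteq> I \<longrightarrow> dist (sum ?n F) L < (e / 2)\<^sup>2"
      unfolding eventually_finite_subsets_at_top by (elim exE conjE)
    define P where "P F \<longleftrightarrow> finite F \<and> F0 \<subseteq> F \<and> F \<subseteq> I" for F
    have P: "eventually P (finite_subsets_at_top I)"
      unfolding eventually_finite_subsets_at_top P_def using F0(1,2) by blast
    have half: "dist (sum ?g F) (sum ?g F0) < e / 2" if "P F" for F
    proof -
      have F: "finite F" "F0 \<subseteq> F" "F \<subseteq> I" using that by (auto simp: P_def)
      have "sum ?g F - sum ?g F0 = sum ?g (F - F0)" using F by (simp add: sum_diff)
      then have "(dist (sum ?g F) (sum ?g F0))\<^sup>2 = (norm (sum ?g (F - F0)))\<^sup>2" by (simp add: dist_norm)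
      also have "\<dots> = sum ?n (F - F0)" using F sub by (intro norm_sum_sq) auto
      also have "\<dots> = sum ?n F - sum ?n F0" using F by (simp add: sum_diff)
      also have "\<dots> \<le> L - sum ?n F0"
        using has_sum_mono2[OF has_sum_finite[OF F(1), of ?n] L F(3)] by simp
      also have "\<dots> < (e / 2)\<^sup>2" using F0(3)[rule_format, of F0] F0(1,2) by (simp add: dist_real_def)
      finally show ?thesis by (rule power2_less_imp_less) (use e in simp)
    qed
    have "dist (sum ?g F) (sum ?g G) < e" if "P F" "P G" for F G
      using half[OF that(1)] half[OF that(2)] dist_triangle_half_l[of "sum ?g F" "sum ?g F0" e "sum ?g G"]
      by (simp add: dist_commute)
    then show "\<exists>P. eventually P (finite_subsets_at_top I) \<and>
        (\<forall>x y. P x \<and> P y \<longrightarrow> dist (sum ?g x) (sum ?g y) < e)"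
      using P by blast
  qed
  moreover have "Topological_Spaces.complete (UNIV::'h set)"
    by (rule complete_UNIV)
  ultimately obtain l where "(sum ?g \<longlongrightarrow> l) (finite_subsets_at_top I)"
    using complete_uniform[where S=UNIV] by (force simp add: filterlim_def)
  then show ?thesis using summable_on_def has_sum_def by blast
qed

text \<open>Let s be the sum. Pairing with a vector of V j kills every term but the j-th, so x - s
  annihilates the family; pairing with an annihilating vector kills every term, so s is orthogonal
  to \<open>annih\<close>. Hence x - s is the projection of x onto \<open>annih\<close>.\<close>

lemma has_sum_proj: "((\<lambda>i. proj_onto (V i) x) has_sum (x - proj_onto annih x)) I"
proof -
  obtain s where s: "((\<lambda>i. proj_onto (V i) x) has_sum s) I"
    using proj_summable[of x] unfolding summable_on_def by (elim exE)
  have "hinner (x - s) v = 0" if j: "j \<in> I" and v: "v \<in> V j" for j v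
  proof -
    have "((\<lambda>i. hinner (proj_onto (V i) x) v) has_sum hinner s v) I"
      by (rule has_sum_bounded_linear[OF hinner.bounded_linear_left s])
    moreover have "((\<lambda>i. hinner (proj_onto (V i) x) v) has_sum hinner (proj_onto (V j) x) v) I"
    proof (rule has_sum_finite_neutralI[of "{j}"])
      show "hinner (proj_onto (V i) x) v = 0" if "i \<in> I - {j}" for i
        by (rule orthogonal[of i j]) (use that j v sub[of i] in simp_all)
    qed (use j in auto)
    ultimately have "hinner s v = hinner (proj_onto (V j) x) v" by (rule has_sum_unique)
    then show ?thesis unfolding hinner_proj_right[OF sub[OF j] v] hinner_diff_left by simp
  qed
  then have "x - s \<in> annih" unfolding annih_def orth_def by blast
  moreover have "hinner (x - (x - s)) z = 0" if "z \<in> annih" for z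
  proof -
    have "((\<lambda>i. hinner (proj_onto (V i) x) z) has_sum hinner s z) I"
      by (rule has_sum_bounded_linear[OF hinner.bounded_linear_left s])
    moreover have "((\<lambda>i. hinner (proj_onto (V i) x) z) has_sum 0) I"
    proof (rule has_sum_0)
      fix i assume i: "i \<in> I"
      then have "z \<in> orth (V i)" using that by (auto simp: annih_def)
      then show "hinner (proj_onto (V i) x) z = 0" by (rule orthD(2)) (rule proj_onto_in[OF sub[OF i]])
    qed
    ultimately have "hinner s z = 0" by (rule has_sum_unique)
    then show ?thesis by simp
  qed
  ultimately have "proj_onto annih x = x - s"
    by (rule proj_onto_unique[OF closed_csubspaceD(2)[OF closed_csubspace_annih]])
  then show ?thesis using s by simp
qed

text \<open>Parseval's identity with defect, obtained by applying the bounded functional y \<mapsto>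
  Re <y,x> to the vector sum.\<close>

lemma has_sum_norm_proj:
  "((\<lambda>i. (norm (proj_onto (V i) x))\<^sup>2) has_sum (norm (x - proj_onto annih x))\<^sup>2) I"
proof -
  have bl: "bounded_linear (\<lambda>y. Re (hinner y x))"
    by (rule bounded_linear_compose[OF bounded_linear_Re hinner.bounded_linear_left])
  have "((\<lambda>i. Re (hinner (proj_onto (V i) x) x)) has_sum Re (hinner (x - proj_onto annih x) x)) I"
    by (rule has_sum_bounded_linear[OF bl has_sum_proj])
  also have "Re (hinner (x - proj_onto annih x) x) = (norm (x - proj_onto annih x))\<^sup>2"
    unfolding proj_onto_orth[OF closed_csubspace_annih, symmetric]
    by (simp add: hinner_proj_self)
  finally show ?thesis
    by (rule iffD1[OF has_sum_cong, rotated]) (simp add: hinner_proj_self sub)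
qed

lemma proj_orth_annih: "proj_onto (orth annih) x = x - proj_onto annih x"
  by (rule proj_onto_orth[OF closed_csubspace_annih])

end

section \<open>The commuting subspace\<close>

lemma has_sum_real_ge_two:
  fixes g :: "'i \<Rightarrow> real"
  assumes "(g has_sum L) I" "i \<in> I" "j \<in> I" "i \<noteq> j" "\<And>k. k \<in> I \<Longrightarrow> g k \<ge> 0"
  shows "g i + g j \<le> L"
  using has_sum_mono2[OF has_sum_finite[of "{i, j}" g] assms(1)] assms by auto

lemma listset_map_iff: "as \<in> listset (map \<Gamma> ts) \<longleftrightarrow> list_all2 (\<lambda>t a. a \<in> \<Gamma> t) ts as"
  by (induction ts arbitrary: as) (auto simp: set_Cons_def list_all2_Cons1)

locale projection_family =
  fixes S :: "'s set" and \<Gamma> :: "'s \<Rightarrow> 'a set" and p :: "'s \<Rightarrow> 'a \<Rightarrow> 'h::chilbert \<Rightarrow> 'h"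
  assumes setting: "setting S \<Gamma> p"
begin

lemma countable_\<Gamma>: "t \<in> S \<Longrightarrow> countable (\<Gamma> t)"
  and is_proj_p: "t \<in> S \<Longrightarrow> a \<in> \<Gamma> t \<Longrightarrow> is_proj (p t a)"
  and has_sum_p: "t \<in> S \<Longrightarrow> ((\<lambda>a. p t a x) has_sum x) (\<Gamma> t)"
  using setting unfolding setting_def by auto

lemma p_idem: "t \<in> S \<Longrightarrow> a \<in> \<Gamma> t \<Longrightarrow> p t a (p t a x) = p t a x"
  and p_adjoint: "t \<in> S \<Longrightarrow> a \<in> \<Gamma> t \<Longrightarrow> hinner (p t a x) y = hinner x (p t a y)"
  using is_proj_p[of t a] unfolding is_proj_def by auto

lemma p_range_iff: "t \<in> S \<Longrightarrow> a \<in> \<Gamma> t \<Longrightarrow> x \<in> range (p t a) \<longleftrightarrow> p t a x = x"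
  by (rule is_proj_range_iff[OF is_proj_p])

text \<open>Orthogonality of the projections belonging to one t follows from their summing to the
  identity: pairing the sum with x gives ||x||^2 as the sum of all ||p t c x||^2, and the term c = a
  already exhausts it.\<close>

lemma p_distinct:
  assumes t: "t \<in> S" and a: "a \<in> \<Gamma> t" and b: "b \<in> \<Gamma> t" and ab: "a \<noteq> b" and x: "p t a x = x"
  shows "p t b x = 0"
proof -
  have bl: "bounded_linear (\<lambda>y. Re (hinner y x))"
    by (rule bounded_linear_compose[OF bounded_linear_Re hinner.bounded_linear_left])
  have "((\<lambda>c. Re (hinner (p t c x) x)) has_sum (norm x)\<^sup>2) (\<Gamma> t)"
    using has_sum_bounded_linear[OF bl has_sum_p[OF t, of x]] by (simp add: Re_hinner_self)
  moreover have eq: "Re (hinner (p t c x) x) = (norm (p t c x))\<^sup>2" if "c \<in> \<Gamma> t" for c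
    using p_adjoint[OF t that, of "p t c x" x] p_idem[OF t that, of x] by (simp add: Re_hinner_self)
  ultimately have "((\<lambda>c. (norm (p t c x))\<^sup>2) has_sum (norm x)\<^sup>2) (\<Gamma> t)"
    by (subst has_sum_cong[where g = "\<lambda>c. Re (hinner (p t c x) x)"]) auto
  from has_sum_real_ge_two[OF this a b ab] show ?thesis using x by simp
qed

section \<open>Joint ranges, their common kernels and the space N\<close>

text \<open>Indexed by sets of pairs because an intersection of ranges ignores order and repetition;
  lists of pairs and graphs of functions then lead to the same subspaces.\<close>

definition Rng :: "('s \<times> 'a) set \<Rightarrow> 'h set" where
  "Rng X = {v. \<forall>(t, a)\<in>X. v \<in> range (p t a)}"

abbreviation "\<Lambda> \<equiv> Sigma S \<Gamma>"

lemma pw_eq: "pw p xs = proj_onto (Rng (set xs))"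
  by (simp add: pw_def Rng_def)

lemma pi_list_iff: "xs \<in> pi_list S \<Gamma> \<longleftrightarrow> set xs \<subseteq> \<Lambda>"
  by (auto simp: pi_list_def)

lemma closed_csubspace_Rng [simp]: "X \<subseteq> \<Lambda> \<Longrightarrow> closed_csubspace (Rng X)"
proof -
  assume X: "X \<subseteq> \<Lambda>"
  have "Rng X = (\<Inter>u\<in>X. range (p (fst u) (snd u)))" by (auto simp: Rng_def)
  also have "closed_csubspace \<dots>"
    using X is_proj_closed_csubspace_range[OF is_proj_p] by (intro closed_csubspace_Inter) auto
  finally show ?thesis .
qed

lemma Rng_D: "v \<in> Rng X \<Longrightarrow> X \<subseteq> \<Lambda> \<Longrightarrow> (t, a) \<in> X \<Longrightarrow> p t a v = v"
proof -
  assume "v \<in> Rng X" "X \<subseteq> \<Lambda>" and ta: "(t, a) \<in> X"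
  then have "t \<in> S" "a \<in> \<Gamma> t" "v \<in> range (p t a)" unfolding Rng_def by blast+
  then show ?thesis using p_range_iff by blast
qed

lemma Rng_I: "X \<subseteq> \<Lambda> \<Longrightarrow> (\<And>t a. (t, a) \<in> X \<Longrightarrow> p t a v = v) \<Longrightarrow> v \<in> Rng X"
  by (auto simp: Rng_def) (metis rangeI)

lemma Rng_antimono: "X \<subseteq> Y \<Longrightarrow> Rng Y \<subseteq> Rng X"
  by (auto simp: Rng_def)

text \<open>\<open>p t b\<close> fixes y, can be moved to x by self-adjointness, and there it gives
  0 because \<open>p t a\<close> fixes x.\<close>

lemma Rng_orthogonal:
  assumes X: "X \<subseteq> \<Lambda>" "Y \<subseteq> \<Lambda>" and t: "(t, a) \<in> X" "(t, b) \<in> Y" and "a \<noteq> b"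
    and x: "x \<in> Rng X" and y: "y \<in> Rng Y"
  shows "hinner x y = 0"
proof -
  have m: "t \<in> S" "a \<in> \<Gamma> t" "b \<in> \<Gamma> t" using X t by auto
  have "hinner x y = hinner x (p t b y)" using Rng_D[OF y X(2) t(2)] by simp
  also have "\<dots> = hinner (p t b x) y" by (simp add: p_adjoint m)
  also have "p t b x = 0" using p_distinct[OF m \<open>a \<noteq> b\<close> Rng_D[OF x X(1) t(1)]] .
  finally show ?thesis by simp
qed

lemma zip_listset:
  assumes "ts \<in> lists S" "as \<in> listset (map \<Gamma> ts)"
  shows "set (zip ts as) \<subseteq> \<Lambda>" "length as = length ts"
  using assms by (auto simp: listset_map_iff list_all2_iff dest: set_zip_leftD)

text \<open>Different tuples disagree at some position, and there both carry the same index.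
  Repetitions in \<open>ts\<close> are harmless: a tuple with two values for one index only
  contributes the zero subspace.\<close>

lemma orthogonal_family_zip:
  assumes ts: "ts \<in> lists S"
  shows "orthogonal_family (\<lambda>as. Rng (set (zip ts as))) (listset (map \<Gamma> ts))"
proof
  fix as assume "as \<in> listset (map \<Gamma> ts)"
  then show "closed_csubspace (Rng (set (zip ts as)))" using zip_listset[OF ts] by simp
next
  fix as bs x y
  assume as: "as \<in> listset (map \<Gamma> ts)" and bs: "bs \<in> listset (map \<Gamma> ts)" and "as \<noteq> bs"
    and xy: "x \<in> Rng (set (zip ts as))" "y \<in> Rng (set (zip ts bs))"
  note za = zip_listset[OF ts as] and zb = zip_listset[OF ts bs]
  obtain i where i: "i < length ts" "as ! i \<noteq> bs ! i"
    using \<open>as \<noteq> bs\<close> za(2) zb(2) by (metis nth_equalityI)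
  have "(ts ! i, as ! i) \<in> set (zip ts as)" "(ts ! i, bs ! i) \<in> set (zip ts bs)"
    using i za(2) zb(2) by (auto simp: set_zip)
  then show "hinner x y = 0" using Rng_orthogonal[OF za(1) zb(1) _ _ i(2) xy] by blast
qed

definition ann :: "'s list \<Rightarrow> 'h set" where
  "ann ts = orthogonal_family.annih (\<lambda>as. Rng (set (zip ts as))) (listset (map \<Gamma> ts))"

lemma ann_iff: "ts \<in> lists S \<Longrightarrow> z \<in> ann ts \<longleftrightarrow> (\<forall>as\<in>listset (map \<Gamma> ts). pw p (zip ts as) z = 0)"
  unfolding ann_def pw_eq by (rule orthogonal_family.annih_iff[OF orthogonal_family_zip])

lemma closed_csubspace_ann: "ts \<in> lists S \<Longrightarrow> closed_csubspace (ann ts)"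
  unfolding ann_def by (rule orthogonal_family.closed_csubspace_annih[OF orthogonal_family_zip])

lemma has_sum_pw_zip:
  "ts \<in> lists S \<Longrightarrow> ((\<lambda>as. pw p (zip ts as) x) has_sum (x - proj_onto (ann ts) x)) (listset (map \<Gamma> ts))"
  unfolding ann_def pw_eq by (rule orthogonal_family.has_sum_proj[OF orthogonal_family_zip])

lemma Nset_eq: "Nset S \<Gamma> p = (\<Union>ts\<in>lists S. ann ts)"
  unfolding Nset_def using ann_iff by auto

lemma pw_antimono_zero:
  assumes "set xs \<subseteq> set ys" "set ys \<subseteq> \<Lambda>" "pw p xs z = 0" shows "pw p ys z = 0"
proof -
  have xs: "set xs \<subseteq> \<Lambda>" using assms by auto
  have "pw p ys z = proj_onto (Rng (set ys)) (proj_onto (Rng (set xs)) z)"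
    unfolding pw_eq using proj_onto_subset[OF _ _ Rng_antimono[OF assms(1)]] xs assms(2) by simp
  also have "\<dots> = 0" using assms(3) proj_onto_id[of "Rng (set ys)" 0] assms(2)
    by (simp add: pw_eq csubspace_0 closed_csubspaceD)
  finally show ?thesis .
qed

text \<open>The kernels form a directed family: a tuple along \<open>ts @ us\<close> imposes at
  least the conditions of its two parts. This is why their union N is closed under addition.\<close>

lemma ann_append:
  assumes ts: "ts \<in> lists S" "us \<in> lists S"
  shows "ann ts \<subseteq> ann (ts @ us)" "ann us \<subseteq> ann (ts @ us)"
proof -
  have tu: "ts @ us \<in> lists S" using ts by simp
  have *: "pw p (zip (ts @ us) cs) z = 0" if cs: "cs \<in> listset (map \<Gamma> (ts @ us))"
    and z: "z \<in> ann ts \<or> z \<in> ann us" for cs z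
  proof -
    obtain as bs where c: "cs = as @ bs" "as \<in> listset (map \<Gamma> ts)" "bs \<in> listset (map \<Gamma> us)"
      using cs unfolding listset_map_iff list_all2_append1 by auto
    have "set (zip ts as) \<subseteq> set (zip (ts @ us) cs)" "set (zip us bs) \<subseteq> set (zip (ts @ us) cs)"
      using zip_listset(2)[OF ts(1) c(2)] by (auto simp: c(1) zip_append)
    moreover have "pw p (zip ts as) z = 0 \<or> pw p (zip us bs) z = 0"
      using z c ann_iff ts by auto
    ultimately show ?thesis using pw_antimono_zero zip_listset(1)[OF tu cs] by metis
  qed
  show "ann ts \<subseteq> ann (ts @ us)" "ann us \<subseteq> ann (ts @ us)"
    using * unfolding subset_iff ann_iff[OF tu] by blast+
qed

lemma csubspace_Nset: "csubspace (Nset S \<Gamma> p)"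
  unfolding csubspace_def Nset_eq
proof (intro conjI ballI allI)
  show "0 \<in> (\<Union>ts\<in>lists S. ann ts)"
    using csubspace_0[OF closed_csubspaceD(2)[OF closed_csubspace_ann[of "[]"]]] by auto
next
  fix x y assume "x \<in> (\<Union>ts\<in>lists S. ann ts)" "y \<in> (\<Union>ts\<in>lists S. ann ts)"
  then obtain ts us where *: "ts \<in> lists S" "x \<in> ann ts" "us \<in> lists S" "y \<in> ann us" by auto
  then have tu: "ts @ us \<in> lists S" by simp
  have "x \<in> ann (ts @ us)" "y \<in> ann (ts @ us)" using ann_append * by blast+
  then have "x + y \<in> ann (ts @ us)" by (rule csubspace_add[OF closed_csubspaceD(2)[OF closed_csubspace_ann[OF tu]]])
  then show "x + y \<in> (\<Union>ts\<in>lists S. ann ts)" using tu by blast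
next
  fix c x assume "x \<in> (\<Union>ts\<in>lists S. ann ts)"
  then obtain ts where *: "ts \<in> lists S" "x \<in> ann ts" by auto
  then show "hscale c x \<in> (\<Union>ts\<in>lists S. ann ts)"
    using csubspace_hscale[OF closed_csubspaceD(2)[OF closed_csubspace_ann[OF *(1)]]] by blast
qed

text \<open>The sum over the tuples along \<open>ts\<close> always exists and equals x minus its
  component in \<open>ann ts\<close>; it returns x exactly when that component vanishes.\<close>

lemma Hpi''_eq_orth: "Hpi'' S \<Gamma> p = orth (Nset S \<Gamma> p)"
proof -
  have "((\<lambda>as. pw p (zip ts as) x) has_sum x) (listset (map \<Gamma> ts)) \<longleftrightarrow> x \<in> orth (ann ts)"
    if ts: "ts \<in> lists S" for ts x
  proof -
    have "((\<lambda>as. pw p (zip ts as) x) has_sum x) (listset (map \<Gamma> ts)) \<longleftrightarrow> x - proj_onto (ann ts) x = x"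
      using has_sum_pw_zip[OF ts, of x] has_sum_unique by metis
    then show ?thesis using proj_onto_eq_0_iff[OF closed_csubspace_ann[OF ts], of x] by simp
  qed
  then have "Hpi'' S \<Gamma> p = {x. \<forall>ts\<in>lists S. x \<in> orth (ann ts)}" unfolding Hpi''_def by blast
  also have "\<dots> = orth (Nset S \<Gamma> p)" unfolding Nset_eq orth_def by blast
  finally show ?thesis .
qed

section \<open>Products of the given projections and the characterizations of the commuting
  subspace\<close>

lemma prod_apply_simps [simp]:
  "prod_apply p [] x = x"
  "prod_apply p ((t, a) # xs) x = prod_apply p xs (p t a x)"
  "prod_apply p (xs @ ys) x = prod_apply p ys (prod_apply p xs x)"
  by (simp_all add: prod_apply_def)

lemma bounded_linear_prod_apply:
  "set xs \<subseteq> \<Lambda> \<Longrightarrow> bounded_linear (prod_apply p xs)"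
proof (induction xs)
  case (Cons u xs)
  obtain t a where u: "u = (t, a)" by (cases u)
  have "bounded_linear (\<lambda>x. prod_apply p xs (p t a x))"
    using Cons u by (intro bounded_linear_compose[OF _ is_proj_bounded_linear[OF is_proj_p]]) auto
  then show ?case by (simp add: u)
next
  case Nil
  have "prod_apply p [] = (\<lambda>x. x)" by auto
  then show ?case by (simp only: bounded_linear_ident)
qed

lemma prod_apply_adjoint:
  "set xs \<subseteq> \<Lambda> \<Longrightarrow> hinner (prod_apply p xs x) z = hinner x (prod_apply p (rev xs) z)"
  by (induction xs arbitrary: x) (auto simp: p_adjoint)

lemma prod_apply_fixed:
  "(\<And>t a. (t, a) \<in> set xs \<Longrightarrow> p t a z = z) \<Longrightarrow> prod_apply p xs z = z"
  by (induction xs) auto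

text \<open>\<open>commutes_on\<close> compares multisets of operators, where different pairs may
  name the same projection. Equality of the multisets of pairs is stronger and passes to the
  operators.\<close>

lemma prod_apply_perm:
  assumes "x \<in> Hpi S \<Gamma> p" "set xs \<subseteq> \<Lambda>" "mset xs = mset ys"
  shows "prod_apply p xs x = prod_apply p ys x"
proof -
  have "set ys \<subseteq> \<Lambda>" using assms(2,3) by (metis mset_eq_setD)
  moreover have "mset (map (\<lambda>(t, a). p t a) xs) = mset (map (\<lambda>(t, a). p t a) ys)"
    using assms(3) by (simp only: mset_map)
  ultimately show ?thesis
    using assms(1,2) unfolding Hpi_def commutes_on_def mem_Collect_eq Ball_def pi_list_iff by metis
qed

text \<open>Applying \<open>zs\<close> beforehand amounts to putting the prefix \<open>zs\<close> in
  front of both words, which keeps their factors equal.\<close>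

lemma Hpi_invariant:
  assumes x: "x \<in> Hpi S \<Gamma> p" and zs: "set zs \<subseteq> \<Lambda>"
  shows "prod_apply p zs x \<in> Hpi S \<Gamma> p"
  unfolding Hpi_def commutes_on_def mem_Collect_eq
proof (intro ballI impI)
  fix xs ys assume "xs \<in> pi_list S \<Gamma>" "ys \<in> pi_list S \<Gamma>"
    "mset (map (\<lambda>(t, a). p t a) xs) = mset (map (\<lambda>(t, a). p t a) ys)"
  then have "zs @ xs \<in> pi_list S \<Gamma>" "zs @ ys \<in> pi_list S \<Gamma>"
    "mset (map (\<lambda>(t, a). p t a) (zs @ xs)) = mset (map (\<lambda>(t, a). p t a) (zs @ ys))"
    using zs by (auto simp: pi_list_iff)
  then have "prod_apply p (zs @ xs) x = prod_apply p (zs @ ys) x"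
    using x unfolding Hpi_def commutes_on_def by blast
  then show "prod_apply p xs (prod_apply p zs x) = prod_apply p ys (prod_apply p zs x)" by simp
qed

text \<open>The product lands in the joint range because an extra factor can be absorbed by its
  twin. The residual is orthogonal to that range because the adjoint of the product is the reversed
  product, which fixes every vector there.\<close>

lemma pw_eq_prod_apply:
  assumes x: "x \<in> Hpi S \<Gamma> p" and xs: "set xs \<subseteq> \<Lambda>"
  shows "pw p xs x = prod_apply p xs x"
  unfolding pw_eq
proof (rule proj_onto_unique)
  show "csubspace (Rng (set xs))" using xs by (simp add: closed_csubspaceD)
  show "prod_apply p xs x \<in> Rng (set xs)"
  proof (rule Rng_I[OF xs])
    fix t a assume ta: "(t, a) \<in> set xs"
    then obtain us vs where sp: "xs = us @ (t, a) # vs" by (meson split_list)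
    have m: "t \<in> S" "a \<in> \<Gamma> t" using ta xs by auto
    have "p t a (prod_apply p xs x) = prod_apply p (xs @ [(t, a)]) x" by simp
    \<comment> \<open>The extra factor and its twin are brought together at the front, where
      idempotence merges them; the remaining one is then moved back to its place.\<close>
    also have "\<dots> = prod_apply p ((t, a) # (t, a) # us @ vs) x"
      using xs m by (intro prod_apply_perm[OF x]) (auto simp: sp)
    also have "\<dots> = prod_apply p ((t, a) # us @ vs) x" by (simp add: p_idem m)
    also have "\<dots> = prod_apply p xs x"
      using xs m by (intro prod_apply_perm[OF x]) (auto simp: sp)
    finally show "p t a (prod_apply p xs x) = prod_apply p xs x" .
  qed
  fix z assume z: "z \<in> Rng (set xs)"
  have "prod_apply p (rev xs) z = z" using Rng_D[OF z xs] by (intro prod_apply_fixed) auto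
  then show "hinner (x - prod_apply p xs x) z = 0"
    by (simp add: hinner_diff_left prod_apply_adjoint[OF xs])
qed

lemma Hpi_subset_Hpi': "Hpi S \<Gamma> p \<subseteq> Hpi' S \<Gamma> p"
proof
  fix x assume x: "x \<in> Hpi S \<Gamma> p"
  have "pw p xs x = prod_apply p (rev xs) x" if "xs \<in> pi_list S \<Gamma>" for xs
    using that pw_eq_prod_apply[OF x, of xs] prod_apply_perm[OF x, of xs "rev xs"]
    by (simp add: pi_list_iff)
  then show "x \<in> Hpi' S \<Gamma> p" unfolding Hpi'_def by simp
qed

text \<open>The projection onto the joint range depends only on the set of operators occurring in
  the word, so words with the same factors act alike.\<close>

lemma Hpi'_subset_Hpi: "Hpi' S \<Gamma> p \<subseteq> Hpi S \<Gamma> p"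
proof
  fix x assume x: "x \<in> Hpi' S \<Gamma> p"
  have *: "prod_apply p xs x = pw p xs x" if "xs \<in> pi_list S \<Gamma>" for xs
  proof -
    have "rev xs \<in> pi_list S \<Gamma>" using that by (simp add: pi_list_iff)
    then have "pw p (rev xs) x = prod_apply p (rev (rev xs)) x" using x unfolding Hpi'_def by blast
    then show ?thesis by (simp add: pw_eq)
  qed
  have "pw p xs x = pw p ys x" if "mset (map (\<lambda>(t, a). p t a) xs) = mset (map (\<lambda>(t, a). p t a) ys)" for xs ys
  proof -
    have Rng: "Rng (set zs) = (\<Inter>q\<in>set (map (\<lambda>(t, a). p t a) zs). range q)" for zs
      unfolding Rng_def by auto
    show ?thesis unfolding pw_eq Rng using mset_eq_setD[OF that] by simp
  qed
  with * show "x \<in> Hpi S \<Gamma> p" unfolding Hpi_def commutes_on_def mem_Collect_eq by (intro ballI impI) metis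
qed

text \<open>The identity is resolved one index at a time, with y generalized to
  \<open>p t a y\<close> in the induction; only iterated sums of scalars occur and no sum over
  tuples has to be rearranged.\<close>

lemma prod_apply_zip_orthogonal:
  assumes "ts \<in> lists S" "\<And>as. as \<in> listset (map \<Gamma> ts) \<Longrightarrow> hinner (prod_apply p (zip ts as) y) z = 0"
  shows "hinner y z = 0"
  using assms
proof (induction ts arbitrary: y rule: list.induct)
  case Nil
  then show ?case by simp
next
  case (Cons t ts)
  have t: "t \<in> S" and ts: "ts \<in> lists S" using Cons.prems(1) by auto
  have "hinner (p t a y) z = 0" if "a \<in> \<Gamma> t" for a
  proof (rule Cons.IH[OF ts])
    fix as assume "as \<in> listset (map \<Gamma> ts)"
    then show "hinner (prod_apply p (zip ts as) (p t a y)) z = 0"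
      using Cons.prems(2)[of "a # as"] that by (simp add: set_Cons_def)
  qed
  then have "((\<lambda>a. hinner (p t a y) z) has_sum 0) (\<Gamma> t)" by (intro has_sum_0)
  moreover have "((\<lambda>a. hinner (p t a y) z) has_sum hinner y z) (\<Gamma> t)"
    by (rule has_sum_bounded_linear[OF hinner.bounded_linear_left has_sum_p[OF t]])
  ultimately show ?case by (rule has_sum_unique[symmetric])
qed

text \<open>On x each product is a projection onto a joint range, which can be moved to z, where it
  gives 0 by the choice of z.\<close>

lemma Hpi_subset_orth: "Hpi S \<Gamma> p \<subseteq> orth (Nset S \<Gamma> p)"
proof
  fix x assume x: "x \<in> Hpi S \<Gamma> p"
  have "hinner x z = 0" if ts: "ts \<in> lists S" and z: "z \<in> ann ts" for ts z
  proof (rule prod_apply_zip_orthogonal[OF ts])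
    fix as assume as: "as \<in> listset (map \<Gamma> ts)"
    note zs = zip_listset(1)[OF ts as]
    have "hinner (prod_apply p (zip ts as) x) z = hinner (pw p (zip ts as) x) z"
      using pw_eq_prod_apply[OF x zs] by simp
    also have "\<dots> = hinner x (pw p (zip ts as) z)"
      unfolding pw_eq by (rule hinner_proj_commute) (use zs in simp)
    also have "\<dots> = 0" using z as ann_iff[OF ts] by simp
    finally show "hinner (prod_apply p (zip ts as) x) z = 0" .
  qed
  then show "x \<in> orth (Nset S \<Gamma> p)" unfolding Nset_eq orth_def by blast
qed

text \<open>On a joint eigenvector with eigenvalues 0 and 1 a word acts as the product of the
  eigenvalues, a number blind to the order of the factors.\<close>

lemma prod_apply_eigenvector:
  assumes "set xs \<subseteq> \<Lambda>" "\<And>t a. (t, a) \<in> set xs \<Longrightarrow> p t a v = v \<or> p t a v = 0"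
  shows "prod_apply p xs v = (if \<forall>(t, a)\<in>set xs. p t a v = v then v else 0)"
  using assms
proof (induction xs)
  case (Cons u xs)
  obtain t a where u: "u = (t, a)" by (cases u)
  have xs: "set xs \<subseteq> \<Lambda>" using Cons.prems by auto
  have "prod_apply p xs 0 = 0" using linear_0[OF bounded_linear.linear[OF bounded_linear_prod_apply[OF xs]]] .
  moreover have "p t a v = v \<or> p t a v = 0" using Cons.prems(2) u by auto
  moreover have "prod_apply p xs v = (if \<forall>(t, a)\<in>set xs. p t a v = v then v else 0)"
    using Cons.prems xs by (intro Cons.IH) auto
  ultimately show ?case by (auto simp: u)
qed simp

text \<open>Both words are bounded operators, so they may be applied termwise to the expansion of x,
  and its terms are joint eigenvectors of all factors.\<close>

lemma Hpi''_subset_Hpi: "Hpi'' S \<Gamma> p \<subseteq> Hpi S \<Gamma> p"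
proof
  fix x assume x: "x \<in> Hpi'' S \<Gamma> p"
  show "x \<in> Hpi S \<Gamma> p"
    unfolding Hpi_def commutes_on_def mem_Collect_eq
  proof (intro ballI impI)
    fix xs ys assume "xs \<in> pi_list S \<Gamma>" "ys \<in> pi_list S \<Gamma>"
      and eq: "mset (map (\<lambda>(t, a). p t a) xs) = mset (map (\<lambda>(t, a). p t a) ys)"
    then have xs: "set xs \<subseteq> \<Lambda>" and ys: "set ys \<subseteq> \<Lambda>" by (auto simp: pi_list_iff)
    \<comment> \<open>Every index of either word occurs here, so a component in the joint range has
      a definite value at each index used.\<close>
    define ts where "ts = map fst (xs @ ys)"
    have ts: "ts \<in> lists S" using xs ys unfolding ts_def lists_eq_set by force
    have sum: "((\<lambda>as. pw p (zip ts as) x) has_sum x) (listset (map \<Gamma> ts))"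
      using x ts unfolding Hpi''_def by blast
    have eq': "prod_apply p xs v = prod_apply p ys v"
      if as: "as \<in> listset (map \<Gamma> ts)" and v: "v \<in> Rng (set (zip ts as))" for as v
    proof -
      note zs = zip_listset[OF ts as]
      have ev: "p t b v = v \<or> p t b v = 0" if tb: "(t, b) \<in> set (xs @ ys)" for t b
      proof -
        have "t \<in> set ts" using tb unfolding ts_def by force
        then obtain a where a: "(t, a) \<in> set (zip ts as)"
          using zs(2) by (metis in_set_impl_in_set_zip1)
        have m: "t \<in> S" "a \<in> \<Gamma> t" "b \<in> \<Gamma> t" using a zs(1) tb xs ys by auto
        show ?thesis using p_distinct[OF m] Rng_D[OF v zs(1) a] by (cases "a = b") auto
      qed
      \<comment> \<open>Whether all factors fix v is read off from the set of operators, since the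
        words need not contain the same pairs.\<close>
      have "(\<forall>(t, a)\<in>set xs. p t a v = v) \<longleftrightarrow> (\<forall>q\<in>set (map (\<lambda>(t, a). p t a) xs). q v = v)" by auto
      also have "\<dots> \<longleftrightarrow> (\<forall>q\<in>set (map (\<lambda>(t, a). p t a) ys). q v = v)" using mset_eq_setD[OF eq] by simp
      also have "\<dots> \<longleftrightarrow> (\<forall>(t, a)\<in>set ys. p t a v = v)" by auto
      finally have "(\<forall>(t, a)\<in>set xs. p t a v = v) \<longleftrightarrow> (\<forall>(t, a)\<in>set ys. p t a v = v)" .
      then show ?thesis
        using prod_apply_eigenvector[OF xs, of v] prod_apply_eigenvector[OF ys, of v] ev by auto
    qed
    have "((\<lambda>as. prod_apply p xs (pw p (zip ts as) x)) has_sum prod_apply p xs x) (listset (map \<Gamma> ts))"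
      by (rule has_sum_bounded_linear[OF bounded_linear_prod_apply[OF xs] sum])
    moreover have "((\<lambda>as. prod_apply p ys (pw p (zip ts as) x)) has_sum prod_apply p ys x) (listset (map \<Gamma> ts))"
      by (rule has_sum_bounded_linear[OF bounded_linear_prod_apply[OF ys] sum])
    moreover have "prod_apply p xs (pw p (zip ts as) x) = prod_apply p ys (pw p (zip ts as) x)"
      if "as \<in> listset (map \<Gamma> ts)" for as
      by (rule eq'[OF that]) (simp add: pw_eq zip_listset(1)[OF ts that])
    ultimately show "prod_apply p xs x = prod_apply p ys x"
      using has_sum_unique by (metis (no_types, lifting) has_sum_cong)
  qed
qed

lemma Hpi_eqs:
  "Hpi S \<Gamma> p = Hpi' S \<Gamma> p" "Hpi' S \<Gamma> p = Hpi'' S \<Gamma> p" "Hpi'' S \<Gamma> p = orth (Nset S \<Gamma> p)"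
  using Hpi_subset_Hpi' Hpi'_subset_Hpi Hpi_subset_orth Hpi''_subset_Hpi Hpi''_eq_orth by auto

lemma Hpi_eq_orth: "Hpi S \<Gamma> p = orth (Nset S \<Gamma> p)"
  using Hpi_eqs by simp

lemma closed_csubspace_Hpi [simp]: "closed_csubspace (Hpi S \<Gamma> p)"
  by (simp add: Hpi_eq_orth)

lemma pw_Hpi: "x \<in> Hpi S \<Gamma> p \<Longrightarrow> set xs \<subseteq> \<Lambda> \<Longrightarrow> pw p xs x \<in> Hpi S \<Gamma> p"
  using Hpi_invariant pw_eq_prod_apply by simp

end

section \<open>The probability measures\<close>

text \<open>Translates unordered sums of nonnegative reals, as delivered by Parseval's identity,
  into the integrals over counting measure in which discrete laws are described.\<close>

lemma nn_integral_count_space_has_sum: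
  fixes g :: "'i \<Rightarrow> real"
  assumes "(g has_sum s) A" "\<And>i. i \<in> A \<Longrightarrow> g i \<ge> 0"
  shows "(\<integral>\<^sup>+ i. ennreal (g i) \<partial>count_space A) = ennreal s"
proof -
  have "(\<lambda>i. norm (g i)) summable_on A"
    using assms by (subst summable_on_cong[where g = g]) (auto simp: summable_on_def)
  then have "Infinite_Set_Sum.abs_summable_on g A" by (simp only: abs_summable_equivalent)
  then show ?thesis
    using assms by (simp add: nn_integral_conv_infsetsum infsetsum_infsum infsumI)
qed

context projection_family
begin

section \<open>Joint ranges indexed by functions on finite sets\<close>

text \<open>The extension theorem is indexed by finite sets of coordinates; graphs replace tuples
  along a list by functions on such a set.\<close>

definition graph :: "'s set \<Rightarrow> ('s \<Rightarrow> 'a) \<Rightarrow> ('s \<times> 'a) set" where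
  "graph J w = (\<lambda>t. (t, w t)) ` J"

lemma graph_subset: "J \<subseteq> S \<Longrightarrow> w \<in> PiE J \<Gamma> \<Longrightarrow> graph J w \<subseteq> \<Lambda>"
  by (auto simp: graph_def)

lemma orthogonal_family_PiE:
  assumes J: "J \<subseteq> S"
  shows "orthogonal_family (\<lambda>w. Rng (graph J w)) (PiE J \<Gamma>)"
proof
  fix w assume "w \<in> PiE J \<Gamma>"
  then show "closed_csubspace (Rng (graph J w))" using graph_subset[OF J] by simp
next
  fix v w x y
  assume v: "v \<in> PiE J \<Gamma>" and w: "w \<in> PiE J \<Gamma>" and "v \<noteq> w"
    and xy: "x \<in> Rng (graph J v)" "y \<in> Rng (graph J w)"
  obtain t where t: "t \<in> J" "v t \<noteq> w t" using \<open>v \<noteq> w\<close> v w by (metis PiE_ext)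
  have "(t, v t) \<in> graph J v" "(t, w t) \<in> graph J w" using t by (auto simp: graph_def)
  then show "hinner x y = 0"
    using Rng_orthogonal[OF graph_subset[OF J v] graph_subset[OF J w] _ _ t(2) xy] by blast
qed

lemma zip_eq_graph:
  assumes "distinct ts" "as \<in> listset (map \<Gamma> ts)" "ts \<in> lists S"
  obtains w where "w \<in> PiE (set ts) \<Gamma>" "set (zip ts as) = graph (set ts) w"
proof -
  note z = zip_listset[OF assms(3,2)]
  define w where "w = (\<lambda>t\<in>set ts. the (map_of (zip ts as) t))"
  have w: "w (ts ! i) = as ! i" if "i < length ts" for i
    using that assms(1) z(2) by (simp add: w_def map_of_zip_nth)
  have eq: "set (zip ts as) = graph (set ts) w"
    unfolding graph_def set_zip using w z(2) by (auto simp: set_conv_nth image_iff)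
  have "w \<in> PiE (set ts) \<Gamma>"
  proof (rule PiE_I)
    fix t assume "t \<in> set ts"
    then have "(t, w t) \<in> set (zip ts as)" unfolding eq graph_def by blast
    then show "w t \<in> \<Gamma> t" using z(1) by auto
  qed (simp add: w_def)
  with eq show thesis using that by blast
qed

text \<open>On vectors of the commuting subspace Parseval's identity has no defect: whatever
  annihilates the family lies in N, to which x is orthogonal.\<close>

lemma has_sum_norm_PiE:
  assumes J: "finite J" "J \<subseteq> S" and x: "x \<in> Hpi S \<Gamma> p"
  shows "((\<lambda>w. (norm (proj_onto (Rng (graph J w)) x))\<^sup>2) has_sum (norm x)\<^sup>2) (PiE J \<Gamma>)"
proof -
  interpret orthogonal_family "\<lambda>w. Rng (graph J w)" "PiE J \<Gamma>" by (rule orthogonal_family_PiE[OF J(2)])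
  obtain ts where ts: "set ts = J" "distinct ts" using finite_distinct_list[OF J(1)] by blast
  have tsS: "ts \<in> lists S" using ts J by auto
  have "annih \<subseteq> ann ts"
  proof
    fix z assume z: "z \<in> annih"
    show "z \<in> ann ts" unfolding ann_iff[OF tsS]
    proof
      fix as assume as: "as \<in> listset (map \<Gamma> ts)"
      obtain w where "w \<in> PiE J \<Gamma>" "set (zip ts as) = graph J w"
        using zip_eq_graph[OF ts(2) as tsS] ts(1) by metis
      then show "pw p (zip ts as) z = 0" using z by (simp add: annih_iff pw_eq)
    qed
  qed
  then have "annih \<subseteq> Nset S \<Gamma> p" using tsS unfolding Nset_eq by blast
  then have "x \<in> orth annih" using x unfolding Hpi_eq_orth orth_def by blast
  then have "proj_onto annih x = 0" using proj_onto_eq_0_iff[OF closed_csubspace_annih] by blast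
  then show ?thesis using has_sum_norm_proj[of x] by simp
qed

section \<open>Cylinder events and uniqueness of the measure\<close>

lemma space_Msig: "space (Msig S \<Gamma>) = Omega S \<Gamma>"
  by (auto simp: Msig_def space_measure_of_conv)

lemma sets_Msig_generator:
  "sets (Msig S \<Gamma>) = sigma_sets (Omega S \<Gamma>) {{w \<in> Omega S \<Gamma>. w t = a} | t a. t \<in> S \<and> a \<in> \<Gamma> t}"
  unfolding Msig_def by (rule sets_measure_of) auto

lemma cyl_Nil: "cyl S \<Gamma> [] = Omega S \<Gamma>"
  by (simp add: cyl_def)

lemma cyl_append: "cyl S \<Gamma> (xs @ ys) = cyl S \<Gamma> xs \<inter> cyl S \<Gamma> ys"
  by (auto simp: cyl_def split_beta)

lemma cyl_in_sets: "xs \<in> pi_list S \<Gamma> \<Longrightarrow> cyl S \<Gamma> xs \<in> sets (Msig S \<Gamma>)"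
proof (induction xs)
  case Nil
  then show ?case using sets.top[of "Msig S \<Gamma>"] by (simp add: cyl_Nil space_Msig)
next
  case (Cons u xs)
  obtain t a where u: "u = (t, a)" "t \<in> S" "a \<in> \<Gamma> t" using Cons.prems by (cases u) (auto simp: pi_list_def)
  have "cyl S \<Gamma> [u] = {w \<in> Omega S \<Gamma>. w t = a}" by (auto simp: u cyl_def)
  then have "cyl S \<Gamma> [u] \<in> sets (Msig S \<Gamma>)"
    unfolding sets_Msig_generator using u by (intro sigma_sets.Basic) auto
  moreover have "cyl S \<Gamma> xs \<in> sets (Msig S \<Gamma>)" using Cons by (auto simp: pi_list_def)
  ultimately show ?case using cyl_append[of "[u]" xs] by auto
qed

text \<open>The one-coordinate events are replaced by all cylinders because the latter are stable
  under intersection, by concatenation of lists, and include the whole space, by the empty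
  list.\<close>

lemma sets_Msig: "sets (Msig S \<Gamma>) = sigma_sets (Omega S \<Gamma>) (cyl S \<Gamma> ` pi_list S \<Gamma>)"
proof
  show "sets (Msig S \<Gamma>) \<subseteq> sigma_sets (Omega S \<Gamma>) (cyl S \<Gamma> ` pi_list S \<Gamma>)"
    unfolding sets_Msig_generator
  proof (rule sigma_sets_subseteq, safe)
    fix t a assume "t \<in> S" "a \<in> \<Gamma> t"
    then show "{w \<in> Omega S \<Gamma>. w t = a} \<in> cyl S \<Gamma> ` pi_list S \<Gamma>"
      by (intro image_eqI[of _ _ "[(t, a)]"]) (auto simp: cyl_def pi_list_def)
  qed
  show "sigma_sets (Omega S \<Gamma>) (cyl S \<Gamma> ` pi_list S \<Gamma>) \<subseteq> sets (Msig S \<Gamma>)"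
    unfolding space_Msig[symmetric] using cyl_in_sets by (intro sets.sigma_sets_subset) blast
qed

lemma Int_stable_cyl: "Int_stable (cyl S \<Gamma> ` pi_list S \<Gamma>)"
proof (rule Int_stableI, safe)
  fix xs ys assume "xs \<in> pi_list S \<Gamma>" "ys \<in> pi_list S \<Gamma>"
  then show "cyl S \<Gamma> xs \<inter> cyl S \<Gamma> ys \<in> cyl S \<Gamma> ` pi_list S \<Gamma>"
    by (intro image_eqI[of _ _ "xs @ ys"]) (auto simp: cyl_append pi_list_def)
qed

lemma cyl_generator_Pow: "cyl S \<Gamma> ` pi_list S \<Gamma> \<subseteq> Pow (Omega S \<Gamma>)"
  by (auto simp: cyl_def)

lemma is_Pphi_unique:
  assumes "is_Pphi S \<Gamma> p x P" "is_Pphi S \<Gamma> p x P'"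
  shows "P = P'"
proof (rule measure_eqI_generator_eq[OF Int_stable_cyl cyl_generator_Pow])
  interpret P: prob_space P using assms unfolding is_Pphi_def by simp
  interpret P': prob_space P' using assms unfolding is_Pphi_def by simp
  show "emeasure P X = emeasure P' X" if "X \<in> cyl S \<Gamma> ` pi_list S \<Gamma>" for X
    using that assms unfolding P.emeasure_eq_measure P'.emeasure_eq_measure is_Pphi_def by auto
  show "sets P = sigma_sets (Omega S \<Gamma>) (cyl S \<Gamma> ` pi_list S \<Gamma>)"
    "sets P' = sigma_sets (Omega S \<Gamma>) (cyl S \<Gamma> ` pi_list S \<Gamma>)"
    using assms by (auto simp: is_Pphi_def sets_Msig)
  show "range (\<lambda>_. Omega S \<Gamma>) \<subseteq> cyl S \<Gamma> ` pi_list S \<Gamma>"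
    using cyl_Nil by (auto simp: pi_list_def intro!: image_eqI[of _ _ "[]"])
  show "emeasure P (Omega S \<Gamma>) \<noteq> \<infinity>" using P.emeasure_finite by simp
qed auto

section \<open>Finite-dimensional laws\<close>

text \<open>Extended by 0 so as to be a density on the whole function type, the form in which
  \<open>embed_pmf\<close> takes it.\<close>

definition fweight :: "'h \<Rightarrow> 's set \<Rightarrow> ('s \<Rightarrow> 'a) \<Rightarrow> real" where
  "fweight x J w = (if w \<in> PiE J \<Gamma> then (norm (proj_onto (Rng (graph J w)) x))\<^sup>2 else 0)"

definition fpmf :: "'h \<Rightarrow> 's set \<Rightarrow> ('s \<Rightarrow> 'a) pmf" where
  "fpmf x J = embed_pmf (fweight x J)"

end

locale unit_vector = projection_family S \<Gamma> p
  for S :: "'s set" and \<Gamma> :: "'s \<Rightarrow> 'a set" and p :: "'s \<Rightarrow> 'a \<Rightarrow> 'h::chilbert \<Rightarrow> 'h" +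
  fixes x :: 'h
  assumes x: "x \<in> Hpi S \<Gamma> p" and norm_x: "norm x = 1"
begin

lemma pmf_fpmf:
  assumes J: "finite J" "J \<subseteq> S"
  shows "pmf (fpmf x J) w = fweight x J w"
  unfolding fpmf_def
proof (rule pmf_embed_pmf)
  have "(fweight x J has_sum 1) UNIV"
    using has_sum_norm_PiE[OF J x] norm_x
    by (subst has_sum_cong_neutral[where T = "PiE J \<Gamma>" and g = "\<lambda>w. (norm (proj_onto (Rng (graph J w)) x))\<^sup>2"])
       (auto simp: fweight_def)
  then have "(\<integral>\<^sup>+ w. ennreal (fweight x J w) \<partial>count_space UNIV) = ennreal 1"
    by (rule nn_integral_count_space_has_sum) (simp add: fweight_def)
  then show "(\<integral>\<^sup>+ w. ennreal (fweight x J w) \<partial>count_space UNIV) = 1" by simp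
qed (simp add: fweight_def)

lemma set_fpmf: "finite J \<Longrightarrow> J \<subseteq> S \<Longrightarrow> set_pmf (fpmf x J) \<subseteq> PiE J \<Gamma>"
  by (auto simp: set_pmf_iff pmf_fpmf fweight_def split: if_splits)

text \<open>Let y be the projection of x onto the joint range of X. Points compatible with X give y
  and x the same component, all other points give y none; Parseval's identity for y, which is again
  in the commuting subspace, sums the weights to ||y||^2.\<close>

lemma measure_fpmf_cylinder:
  assumes J: "finite J" "J \<subseteq> S" and X: "X \<subseteq> \<Lambda>" "fst ` X \<subseteq> J" "finite X"
  shows "measure (fpmf x J) {w \<in> PiE J \<Gamma>. \<forall>(t, a)\<in>X. w t = a} = (norm (proj_onto (Rng X) x))\<^sup>2"
proof -
  let ?A = "{w \<in> PiE J \<Gamma>. \<forall>(t, a)\<in>X. w t = a}"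
  define y where "y = proj_onto (Rng X) x"
  obtain xs where xs: "set xs = X" using finite_list[OF X(3)] by blast
  have y: "y \<in> Hpi S \<Gamma> p" using pw_Hpi[OF x, of xs] X(1) xs by (simp add: y_def pw_eq)
  have yR: "y \<in> Rng X" unfolding y_def using X(1) by simp
  have in_A: "proj_onto (Rng (graph J w)) y = proj_onto (Rng (graph J w)) x" if "w \<in> ?A" for w
  proof -
    have "X \<subseteq> graph J w" using that X(2) unfolding graph_def by force
    then show ?thesis unfolding y_def
      using graph_subset[OF J(2)] that X(1) by (intro proj_onto_subset Rng_antimono) auto
  qed
  have out_A: "proj_onto (Rng (graph J w)) y = 0" if w: "w \<in> PiE J \<Gamma> - ?A" for w
  proof -
    obtain t a where ta: "(t, a) \<in> X" "a \<noteq> w t" using w by auto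
    have "(t, w t) \<in> graph J w" using ta(1) X(2) by (force simp: graph_def)
    moreover have g: "graph J w \<subseteq> \<Lambda>" using graph_subset[OF J(2)] w by auto
    ultimately have "y \<in> orth (Rng (graph J w))"
      unfolding orth_def using Rng_orthogonal[OF X(1) _ ta(1) _ ta(2) yR] by blast
    then show ?thesis using proj_onto_eq_0_iff[OF closed_csubspace_Rng[OF g]] by blast
  qed
  have "((\<lambda>w. (norm (proj_onto (Rng (graph J w)) y))\<^sup>2) has_sum (norm y)\<^sup>2) (PiE J \<Gamma>)"
    by (rule has_sum_norm_PiE[OF J y])
  then have "(pmf (fpmf x J) has_sum (norm y)\<^sup>2) ?A"
    by (subst has_sum_cong_neutral[where T = "PiE J \<Gamma>" and g = "\<lambda>w. (norm (proj_onto (Rng (graph J w)) y))\<^sup>2"])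
       (use in_A out_A in \<open>auto simp: pmf_fpmf[OF J] fweight_def\<close>)
  then have "(\<integral>\<^sup>+ w. ennreal (pmf (fpmf x J) w) \<partial>count_space ?A) = ennreal ((norm y)\<^sup>2)"
    by (rule nn_integral_count_space_has_sum) simp
  then have "emeasure (fpmf x J) ?A = ennreal ((norm y)\<^sup>2)" by (simp only: nn_integral_pmf)
  then show ?thesis by (simp add: y_def measure_def)
qed

text \<open>Consistency: up to null sets, the fibre of the restriction map over w is the cylinder
  that prescribes w on J.\<close>

lemma map_fpmf_restrict:
  assumes "J \<subseteq> H" "finite H" "H \<subseteq> S"
  shows "map_pmf (\<lambda>w. restrict w J) (fpmf x H) = fpmf x J"
proof (rule pmf_eqI)
  fix w
  have J: "finite J" "J \<subseteq> S" using assms finite_subset by auto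
  have H: "w' \<in> PiE H \<Gamma>" if "pmf (fpmf x H) w' \<noteq> 0" for w'
    using that set_fpmf[OF assms(2,3)] by (auto simp: set_pmf_iff)
  show "pmf (map_pmf (\<lambda>w. restrict w J) (fpmf x H)) w = pmf (fpmf x J) w"
  proof (cases "w \<in> PiE J \<Gamma>")
    case True
    have "pmf (map_pmf (\<lambda>w. restrict w J) (fpmf x H)) w
        = measure (fpmf x H) ((\<lambda>w. restrict w J) -` {w})" by (rule pmf_map)
    also have "\<dots> = measure (fpmf x H) {w' \<in> PiE H \<Gamma>. \<forall>(t, a)\<in>graph J w. w' t = a}"
    proof (rule measure_prob_cong_0)
      fix w' assume "w' \<in> (\<lambda>w. restrict w J) -` {w} - {w' \<in> PiE H \<Gamma>. \<forall>(t, a)\<in>graph J w. w' t = a}"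
      then have "w' \<notin> PiE H \<Gamma>" by (auto simp: graph_def)
      then show "pmf (fpmf x H) w' = 0" using H by blast
    next
      fix w' assume w': "w' \<in> {w' \<in> PiE H \<Gamma>. \<forall>(t, a)\<in>graph J w. w' t = a} - (\<lambda>w. restrict w J) -` {w}"
      have "restrict w' J = w"
      proof (rule PiE_ext[OF _ True])
        show "restrict w' J \<in> PiE J \<Gamma>" using w' assms(1) by (auto simp: PiE_iff)
      qed (use w' in \<open>auto simp: graph_def\<close>)
      then show "pmf (fpmf x H) w' = 0" using w' by simp
    qed
    also have "\<dots> = (norm (proj_onto (Rng (graph J w)) x))\<^sup>2"
      using assms J True by (intro measure_fpmf_cylinder graph_subset) (auto simp: graph_def)
    finally show ?thesis using True by (simp add: pmf_fpmf[OF J] fweight_def)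
  next
    case False
    have "w \<notin> (\<lambda>w. restrict w J) ` set_pmf (fpmf x H)"
      using set_fpmf[OF assms(2,3)] False assms(1) by (auto simp: PiE_iff Pi_iff subset_iff) 
    then have "pmf (map_pmf (\<lambda>w. restrict w J) (fpmf x H)) w = 0" by (rule pmf_map_outside)
    then show ?thesis using False by (simp add: pmf_fpmf[OF J] fweight_def)
  qed
qed

section \<open>Real coding and Kolmogorov extension\<close>

definition code :: "'s set \<Rightarrow> ('s \<Rightarrow> 'a) \<Rightarrow> 's \<Rightarrow> real" where
  "code J w = (\<lambda>t\<in>J. real (to_nat_on (\<Gamma> t) (w t)))"

text \<open>Total on purpose: for nonempty \<open>\<Gamma> t\<close>, \<open>from_nat_into\<close>
  takes values in \<open>\<Gamma> t\<close> at every number, so real points that code nothing are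
  still sent into the path space and no null set has to be removed.\<close>

definition decode :: "('s \<Rightarrow> real) \<Rightarrow> 's \<Rightarrow> 'a" where
  "decode r = (\<lambda>t\<in>S. from_nat_into (\<Gamma> t) (nat \<lfloor>r t\<rfloor>))"

lemma measurable_code: "code J \<in> measurable (measure_pmf q) (PiM J (\<lambda>_. borel))"
  by (auto simp: code_def space_PiM)

definition Q :: "'s set \<Rightarrow> ('s \<Rightarrow> real) measure" where
  "Q J = distr (measure_pmf (fpmf x J)) (PiM J (\<lambda>_. borel)) (code J)"

text \<open>An empty sum would make the unit vector x vanish.\<close>

lemma \<Gamma>_nonempty: "t \<in> S \<Longrightarrow> \<Gamma> t \<noteq> {}"
  using has_sum_p[of t x] norm_x has_sum_unique[OF has_sum_empty, of "\<lambda>a. p t a x" x] by auto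

text \<open>Coding acts coordinatewise and so commutes with restriction; consistency of the discrete
  laws passes to their images.\<close>

sublocale polish_projective S Q
proof (rule polish_projective.intro, rule projective_family.intro)
  fix J H :: "'s set" assume JH: "J \<subseteq> H" "finite H" "H \<subseteq> S"
  have r: "(\<lambda>f. restrict f J) \<in> measurable (PiM H (\<lambda>_. borel::real measure)) (PiM J (\<lambda>_. borel))"
    by (rule measurable_restrict_subset[OF JH(1)])
  have c: "code J \<in> measurable (count_space UNIV) (PiM J (\<lambda>_. borel))"
    by (auto simp: code_def space_PiM)
  have "distr (Q H) (PiM J (\<lambda>_. borel)) (\<lambda>f. restrict f J)
      = distr (fpmf x H) (PiM J (\<lambda>_. borel)) ((\<lambda>f. restrict f J) \<circ> code H)"
    unfolding Q_def by (rule distr_distr[OF r measurable_code])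
  also have "(\<lambda>f. restrict f J) \<circ> code H = code J \<circ> (\<lambda>w. restrict w J)"
    using JH(1) by (auto simp: code_def fun_eq_iff)
  also have "distr (fpmf x H) (PiM J (\<lambda>_. borel)) (code J \<circ> (\<lambda>w. restrict w J))
      = distr (distr (fpmf x H) (count_space UNIV) (\<lambda>w. restrict w J)) (PiM J (\<lambda>_. borel)) (code J)"
    by (rule distr_distr[OF c, symmetric]) simp
  also have "\<dots> = Q J"
    unfolding Q_def map_pmf_rep_eq[symmetric] map_fpmf_restrict[OF JH] ..
  finally show "Q J = distr (Q H) (PiM J (\<lambda>_. borel)) (\<lambda>f. restrict f J)" ..
next
  fix J :: "'s set"
  show "prob_space (Q J)" unfolding Q_def
    by (rule prob_space.prob_space_distr[OF prob_space_measure_pmf measurable_code])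
qed

lemma measurable_decode_component:
  assumes "t \<in> J"
  shows "{r \<in> space (PiM J (\<lambda>_. borel::real measure)). from_nat_into (\<Gamma> t) (nat \<lfloor>r t\<rfloor>) = a} \<in> sets (PiM J (\<lambda>_. borel))"
proof -
  have "(\<lambda>r. \<lfloor>r t\<rfloor>) \<in> measurable (PiM J (\<lambda>_. borel::real measure)) (count_space UNIV)"
    using measurable_component_singleton[OF assms, of "\<lambda>_. borel::real measure"] by measurable
  then have "(\<lambda>r. \<lfloor>r t\<rfloor>) -` {k. from_nat_into (\<Gamma> t) (nat k) = a} \<inter> space (PiM J (\<lambda>_. borel::real measure))
      \<in> sets (PiM J (\<lambda>_. borel))"
    by (rule measurable_sets) simp
  then show ?thesis by (simp add: vimage_def Int_def conj_commute)
qed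

lemma space_lim: "space lim = space (PiM S (\<lambda>_. borel::real measure))"
  and sets_lim': "sets lim = sets (PiM S (\<lambda>_. borel::real measure))"
  using sets_lim sets_eq_imp_space_eq[OF sets_lim] by simp_all

lemma measurable_decode: "decode \<in> measurable lim (Msig S \<Gamma>)"
  unfolding Msig_def
proof (rule measurable_measure_of)
  show "decode \<in> space lim \<rightarrow> Omega S \<Gamma>"
    using \<Gamma>_nonempty by (auto simp: decode_def Omega_def from_nat_into)
  fix A assume "A \<in> {{w \<in> Omega S \<Gamma>. w t = a} |t a. t \<in> S \<and> a \<in> \<Gamma> t}"
  then obtain t a where A: "A = {w \<in> Omega S \<Gamma>. w t = a}" "t \<in> S" by blast
  have "decode -` A \<inter> space lim = {r \<in> space (PiM S (\<lambda>_. borel::real measure)). from_nat_into (\<Gamma> t) (nat \<lfloor>r t\<rfloor>) = a}"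
    using \<Gamma>_nonempty A(2) by (auto simp: A(1) space_lim decode_def Omega_def from_nat_into)
  then show "decode -` A \<inter> space lim \<in> sets lim"
    using measurable_decode_component[OF A(2)] sets_lim' by simp
qed auto

definition Pmeas :: "('s \<Rightarrow> 'a) measure" where "Pmeas = distr lim (Msig S \<Gamma>) decode"

text \<open>The preimage of the cylinder under \<open>decode\<close> depends on the coordinates in J
  only, so its measure is that of \<open>X\<close> under \<open>Q J\<close>. There decoding undoes
  coding, and the discrete law of the cylinder remains.\<close>

lemma measure_Pmeas_cyl:
  assumes xs: "xs \<in> pi_list S \<Gamma>"
  shows "measure Pmeas (cyl S \<Gamma> xs) = (norm (pw p xs x))\<^sup>2"
proof -
  define J where "J = fst ` set xs"
  have xs': "set xs \<subseteq> \<Lambda>" using xs by (simp add: pi_list_iff)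
  then have J: "finite J" "J \<subseteq> S" by (auto simp: J_def)
  define X where "X = {r \<in> space (PiM J (\<lambda>_. borel::real measure)). \<forall>(t, a)\<in>set xs. from_nat_into (\<Gamma> t) (nat \<lfloor>r t\<rfloor>) = a}"
  have "X = (\<Inter>u\<in>set xs. {r \<in> space (PiM J (\<lambda>_. borel::real measure)). from_nat_into (\<Gamma> (fst u)) (nat \<lfloor>r (fst u)\<rfloor>) = snd u})
      \<inter> space (PiM J (\<lambda>_. borel::real measure))"
    unfolding X_def by force
  also have "\<dots> \<in> sets (PiM J (\<lambda>_. borel))"
  proof (cases "set xs = {}")
    case False
    then show ?thesis
      by (intro sets.Int sets.finite_INT sets.top measurable_decode_component) (auto simp: J_def)
  qed simp
  finally have X: "X \<in> sets (PiM J (\<lambda>_. borel))" .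
  have eq: "from_nat_into (\<Gamma> t) (nat \<lfloor>code J w t\<rfloor>) = w t" if "w \<in> PiE J \<Gamma>" "t \<in> J" for w t
    using that J countable_\<Gamma>[of t] by (auto simp: code_def PiE_iff)
  have iff: "w \<in> code J -` X \<longleftrightarrow> (\<forall>(t, a)\<in>set xs. w t = a)" if "w \<in> PiE J \<Gamma>" for w
  proof -
    have "code J w \<in> space (PiM J (\<lambda>_. borel::real measure))" by (simp add: code_def space_PiM)
    then have "w \<in> code J -` X \<longleftrightarrow> (\<forall>(t, a)\<in>set xs. from_nat_into (\<Gamma> t) (nat \<lfloor>code J w t\<rfloor>) = a)"
      by (simp add: X_def)
    also have "\<dots> \<longleftrightarrow> (\<forall>(t, a)\<in>set xs. w t = a)"
      using eq[OF that] unfolding J_def by (intro ball_cong) force+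
    finally show ?thesis .
  qed
  have "decode -` cyl S \<Gamma> xs \<inter> space lim = prod_emb S (\<lambda>_. borel) J X"
  proof (rule set_eqI)
    fix r
    have "decode r \<in> Omega S \<Gamma>"
      using \<Gamma>_nonempty by (auto simp: decode_def Omega_def from_nat_into)
    moreover have "decode r (fst u) = from_nat_into (\<Gamma> (fst u)) (nat \<lfloor>r (fst u)\<rfloor>)"
      "restrict r J (fst u) = r (fst u)" if "u \<in> set xs" for u
      using that xs' by (auto simp: decode_def J_def)
    ultimately show "r \<in> decode -` cyl S \<Gamma> xs \<inter> space lim \<longleftrightarrow> r \<in> prod_emb S (\<lambda>_. borel) J X"
      by (auto simp: cyl_def X_def space_lim prod_emb_iff split_beta space_PiM PiE_iff)
  qed
  then have "measure Pmeas (cyl S \<Gamma> xs) = measure lim (prod_emb S (\<lambda>_. borel) J X)"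
    unfolding Pmeas_def by (simp add: measure_distr[OF measurable_decode cyl_in_sets[OF xs]])
  also have "\<dots> = measure (Q J) X" by (rule measure_lim_emb[OF J(2,1) X])
  also have "\<dots> = measure (fpmf x J) (code J -` X)"
    unfolding Q_def by (simp add: measure_distr[OF measurable_code X])
  also have "\<dots> = measure (fpmf x J) {w \<in> PiE J \<Gamma>. \<forall>(t, a)\<in>set xs. w t = a}"
  \<comment> \<open>The two sets agree only inside \<open>PiE J \<Gamma>\<close>; outside it the
    discrete law has no mass.\<close>
  proof (rule measure_prob_cong_0)
    fix w assume w: "w \<in> code J -` X - {w \<in> PiE J \<Gamma>. \<forall>(t, a)\<in>set xs. w t = a}"
    show "pmf (fpmf x J) w = 0"
    proof (cases "w \<in> PiE J \<Gamma>")
      case True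
      then show ?thesis using w iff[OF True] by simp
    qed (simp add: pmf_fpmf[OF J] fweight_def)
  next
    fix w assume w: "w \<in> {w \<in> PiE J \<Gamma>. \<forall>(t, a)\<in>set xs. w t = a} - code J -` X"
    then show "pmf (fpmf x J) w = 0" using iff[of w] by simp
  qed
  also have "\<dots> = (norm (proj_onto (Rng (set xs)) x))\<^sup>2"
    by (rule measure_fpmf_cylinder[OF J xs']) (auto simp: J_def)
  finally show ?thesis by (simp add: pw_eq)
qed

end

lemma norm_hat: "x \<noteq> 0 \<Longrightarrow> norm (hat x) = 1"
  by (simp add: hat_def)

context projection_family
begin

lemma hat_Hpi: "x \<in> Hpi S \<Gamma> p \<Longrightarrow> hat x \<in> Hpi S \<Gamma> p"
  unfolding hat_def by (rule csubspace_scaleR[OF closed_csubspaceD(2)[OF closed_csubspace_Hpi]])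

lemma is_Pphi_exists:
  assumes "x \<in> Hpi S \<Gamma> p - {0}"
  shows "\<exists>P. is_Pphi S \<Gamma> p x P"
proof -
  interpret unit_vector S \<Gamma> p "hat x"
    by unfold_locales (use assms in \<open>auto simp: norm_hat hat_Hpi\<close>)
  have "is_Pphi S \<Gamma> p x Pmeas"
    unfolding is_Pphi_def
  proof (intro conjI ballI)
    show "sets Pmeas = sets (Msig S \<Gamma>)" by (simp add: Pmeas_def)
    show "prob_space Pmeas" unfolding Pmeas_def by (rule P.prob_space_distr[OF measurable_decode])
    fix xs assume xs: "xs \<in> pi_list S \<Gamma>"
    show "measure Pmeas (cyl S \<Gamma> xs) = (norm (pw p xs (hat x)))\<^sup>2" by (rule measure_Pmeas_cyl[OF xs])
    then show "measure Pmeas (cyl S \<Gamma> xs) = (norm (prod_apply p xs (hat x)))\<^sup>2"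
      using pw_eq_prod_apply[of "hat x" xs] x xs by (simp add: pi_list_iff)
  qed
  then show ?thesis ..
qed

lemma is_Pphi_Pphi: "x \<in> Hpi S \<Gamma> p - {0} \<Longrightarrow> is_Pphi S \<Gamma> p x (Pphi S \<Gamma> p x)"
  unfolding Pphi_def using is_Pphi_exists is_Pphi_unique by (metis theI)

lemma is_Pphi_ex1: "x \<in> Hpi S \<Gamma> p - {0} \<Longrightarrow> \<exists>!P. is_Pphi S \<Gamma> p x P"
  using is_Pphi_exists is_Pphi_unique by blast

end

section \<open>Integration against a projection valued measure\<close>

text \<open>Stated for an arbitrary projection valued measure because the uniqueness proof applies
  the same calculus to a competitor.\<close>

locale pvm_on =
  fixes K :: "'h::chilbert set" and M :: "'b measure" and E :: "'b set \<Rightarrow> 'h \<Rightarrow> 'h"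
  assumes K: "closed_csubspace K" and pvm: "is_pvm K (space M) (sets M) E"
begin

lemmas K_add = csubspace_add[OF closed_csubspaceD(2)[OF K]]
  and K_diff = csubspace_diff[OF closed_csubspaceD(2)[OF K]]
  and K_hscale = csubspace_hscale[OF closed_csubspaceD(2)[OF K]]
  and K_scaleR = csubspace_scaleR[OF closed_csubspaceD(2)[OF K]]
  and K_sum = csubspace_sum[OF closed_csubspaceD(2)[OF K]]
  and K_0 = csubspace_0[OF closed_csubspaceD(2)[OF K]]

lemma E_proj: "A \<in> sets M \<Longrightarrow> is_proj_on K (E A)"
  using pvm unfolding is_pvm_def by blast

lemma E_K: "A \<in> sets M \<Longrightarrow> x \<in> K \<Longrightarrow> E A x \<in> K"
  and E_add: "A \<in> sets M \<Longrightarrow> x \<in> K \<Longrightarrow> y \<in> K \<Longrightarrow> E A (x + y) = E A x + E A y"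
  and E_hscale: "A \<in> sets M \<Longrightarrow> x \<in> K \<Longrightarrow> E A (hscale c x) = hscale c (E A x)"
  and E_idem: "A \<in> sets M \<Longrightarrow> x \<in> K \<Longrightarrow> E A (E A x) = E A x"
  and E_adjoint: "A \<in> sets M \<Longrightarrow> x \<in> K \<Longrightarrow> y \<in> K \<Longrightarrow> hinner (E A x) y = hinner x (E A y)"
  using E_proj[of A] unfolding is_proj_on_def by blast+

lemma E_scaleR: "A \<in> sets M \<Longrightarrow> x \<in> K \<Longrightarrow> E A (r *\<^sub>R x) = r *\<^sub>R E A x"
  using E_hscale[of A x "complex_of_real r"] by (simp add: hscale_of_real)

lemma E_diff: "A \<in> sets M \<Longrightarrow> x \<in> K \<Longrightarrow> y \<in> K \<Longrightarrow> E A (x - y) = E A x - E A y"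
  using E_add[of A x "(-1) *\<^sub>R y"] E_scaleR[of A y "-1"] K_scaleR[of y "-1"] by simp

lemma E_0: "A \<in> sets M \<Longrightarrow> E A 0 = 0"
  using E_scaleR[of A 0 0] K_0 by simp

lemma E_setsum: "A \<in> sets M \<Longrightarrow> (\<And>i. i \<in> I \<Longrightarrow> g i \<in> K) \<Longrightarrow> E A (sum g I) = (\<Sum>i\<in>I. E A (g i))"
  by (induction I rule: infinite_finite_induct) (auto simp: E_0 E_add K_sum)

lemma E_space: "x \<in> K \<Longrightarrow> E (space M) x = x"
  using pvm unfolding is_pvm_def by blast

lemma E_sums: "range A \<subseteq> sets M \<Longrightarrow> disjoint_family A \<Longrightarrow> x \<in> K \<Longrightarrow> (\<lambda>i. E (A i) x) sums E (\<Union>(range A)) x"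
  using pvm unfolding is_pvm_def by blast

text \<open>The constant sequence of empty sets is disjoint, so its constant terms are summable and
  must tend to 0.\<close>

lemma E_empty: "x \<in> K \<Longrightarrow> E {} x = 0"
proof -
  assume x: "x \<in> K"
  have "(\<lambda>i::nat. E {} x) sums E (\<Union>(range (\<lambda>_::nat. {}))) x"
    by (rule E_sums[OF _ _ x]) (auto simp: disjoint_family_on_def)
  then have "(\<lambda>i::nat. E {} x) \<longlonglongrightarrow> 0" by (intro summable_LIMSEQ_zero) (auto simp: sums_iff)
  then show ?thesis by (simp add: LIMSEQ_const_iff)
qed

lemma E_union:
  assumes A: "A \<in> sets M" "B \<in> sets M" "A \<inter> B = {}" and x: "x \<in> K"
  shows "E (A \<union> B) x = E A x + E B x"
proof -
  have "(\<lambda>i. E (binaryset A B i) x) sums E (\<Union>(range (binaryset A B))) x"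
    using A by (intro E_sums[OF _ _ x])
      (auto simp: range_binaryset_eq disjoint_family_on_def binaryset_def)
  moreover have "(\<lambda>i. E (binaryset A B i) x) sums (\<Sum>i\<in>{0, Suc 0}. E (binaryset A B i) x)"
    by (rule sums_finite) (auto simp: binaryset_def E_empty x)
  ultimately have "E (\<Union>(range (binaryset A B))) x = (\<Sum>i\<in>{0, Suc 0}. E (binaryset A B i) x)"
    by (rule sums_unique2)
  then show ?thesis by (simp add: UN_binaryset_eq) (simp add: binaryset_def)
qed

lemma E_finite_UN:
  assumes "finite I" "\<And>i. i \<in> I \<Longrightarrow> A i \<in> sets M" "disjoint_family_on A I" and x: "x \<in> K"
  shows "E (\<Union>i\<in>I. A i) x = (\<Sum>i\<in>I. E (A i) x)"
  using assms(1-3)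
proof (induction I rule: finite_induct)
  case (insert i I)
  have "E (A i \<union> (\<Union>j\<in>I. A j)) x = E (A i) x + E (\<Union>j\<in>I. A j) x"
    using insert by (intro E_union[OF _ _ _ x]) (auto simp: disjoint_family_on_def)
  moreover have "disjoint_family_on A I" using insert.prems(2) by (auto simp: disjoint_family_on_def)
  ultimately show ?case using insert by simp
qed (simp add: E_empty x)

lemma norm_E_sq: "A \<in> sets M \<Longrightarrow> x \<in> K \<Longrightarrow> hinner (E A x) x = complex_of_real ((norm (E A x))\<^sup>2)"
  by (metis E_K E_adjoint E_idem hinner_norm)

text \<open>The definition grants only some bound; the constant 1 comes from ||E A x||^2 = <E A x,
  x> and the Cauchy-Schwarz inequality.\<close>

lemma norm_E_le:
  assumes "A \<in> sets M" "x \<in> K" shows "norm (E A x) \<le> norm x"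
proof -
  have "norm (E A x) * norm (E A x) \<le> norm (E A x) * norm x"
    using hinner_Cauchy_Schwarz[of "E A x" x] norm_E_sq[OF assms] by (simp add: power2_eq_square norm_mult)
  then show ?thesis by (cases "norm (E A x) = 0") auto
qed

lemma E_compl: "A \<in> sets M \<Longrightarrow> x \<in> K \<Longrightarrow> E (space M - A) x = x - E A x"
  using E_union[of A "space M - A" x] E_space[of x] sets.sets_into_space[of A M]
  by (simp add: Un_absorb1 algebra_simps)

text \<open>For y in the range of E B, additivity gives ||E (A \<union> B) y||^2 = ||E A y||^2 +
  ||y||^2, and contractivity leaves no room for the first summand.\<close>

lemma E_disjoint:
  assumes A: "A \<in> sets M" "B \<in> sets M" "A \<inter> B = {}" and x: "x \<in> K"
  shows "E A (E B x) = 0"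
proof -
  define y where "y = E B x"
  have y: "y \<in> K" using A x by (simp add: y_def E_K)
  have AB: "A \<union> B \<in> sets M" using A by auto
  have "E (A \<union> B) y = E A y + y" using E_union[OF A y] by (simp add: y_def E_idem A x)
  then have "hinner (E (A \<union> B) y) y = hinner (E A y) y + hinner y y" by (simp add: hinner_add_left)
  then have "complex_of_real ((norm (E (A \<union> B) y))\<^sup>2) = complex_of_real ((norm (E A y))\<^sup>2 + (norm y)\<^sup>2)"
    using norm_E_sq[OF AB y] norm_E_sq[OF A(1) y] hinner_norm[of y] by simp
  then have "(norm (E (A \<union> B) y))\<^sup>2 = (norm (E A y))\<^sup>2 + (norm y)\<^sup>2" by (simp only: of_real_eq_iff)
  moreover have "(norm (E (A \<union> B) y))\<^sup>2 \<le> (norm y)\<^sup>2" using norm_E_le[OF AB y] by (rule power_mono) simp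
  ultimately show ?thesis by (simp add: y_def)
qed

text \<open>Both sets are split along their intersection; the two differences contribute nothing by
  disjointness.\<close>

lemma E_Int:
  assumes A: "A \<in> sets M" "B \<in> sets M" and x: "x \<in> K"
  shows "E A (E B x) = E (A \<inter> B) x"
proof -
  have s: "A \<inter> B \<in> sets M" "B - A \<in> sets M" "A - B \<in> sets M" using A by auto
  note k = E_K[OF s(1) x] E_K[OF s(2) x]
  have "E B x = E (A \<inter> B) x + E (B - A) x"
  proof -
    have "A \<inter> B \<union> (B - A) = B" "A \<inter> B \<inter> (B - A) = {}" by auto
    then show ?thesis using E_union[OF s(1,2) _ x] by simp
  qed
  then have "E A (E B x) = E A (E (A \<inter> B) x) + E A (E (B - A) x)" by (simp add: E_add A k)
  also have "E A (E (B - A) x) = 0" by (rule E_disjoint[OF A(1) s(2) _ x]) auto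
  also have "E A (E (A \<inter> B) x) = E (A \<inter> B) (E (A \<inter> B) x) + E (A - B) (E (A \<inter> B) x)"
  proof -
    have "A \<inter> B \<union> (A - B) = A" "A \<inter> B \<inter> (A - B) = {}" by auto
    then show ?thesis using E_union[OF s(1,3) _ k(1)] by simp
  qed
  also have "E (A - B) (E (A \<inter> B) x) = 0" by (rule E_disjoint[OF s(3,1) _ x]) auto
  finally show ?thesis by (simp add: E_idem s x)
qed

lemma E_orthogonal:
  assumes "A \<in> sets M" "B \<in> sets M" "A \<inter> B = {}" "x \<in> K" "y \<in> K"
  shows "hinner (E A x) (E B y) = 0"
  using assms E_adjoint[of A x "E B y"] E_disjoint[of A B y] by (simp add: E_K)

section \<open>Scalar spectral measures\<close>

definition mu :: "'h \<Rightarrow> 'b measure" where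
  "mu x = measure_of (space M) (sets M) (\<lambda>A. ennreal ((norm (E A x))\<^sup>2))"

lemma sets_mu [simp, measurable_cong]: "sets (mu x) = sets M" and space_mu [simp]: "space (mu x) = space M"
  by (simp_all add: mu_def)

text \<open>Countable additivity is the vector identity \<open>E_sums\<close> paired with x, because
  <E A x, x> = ||E A x||^2.\<close>

lemma emeasure_mu:
  assumes x: "x \<in> K" and A: "A \<in> sets M"
  shows "emeasure (mu x) A = ennreal ((norm (E A x))\<^sup>2)"
  unfolding mu_def
proof (rule emeasure_measure_of_sigma[OF _ _ _ A])
  show "positive (sets M) (\<lambda>A. ennreal ((norm (E A x))\<^sup>2))" by (simp add: positive_def E_empty x)
  show "countably_additive (sets M) (\<lambda>A. ennreal ((norm (E A x))\<^sup>2))"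
    unfolding countably_additive_def
  proof (intro allI impI)
    fix A :: "nat \<Rightarrow> 'b set"
    assume A: "range A \<subseteq> sets M" "disjoint_family A" "\<Union>(range A) \<in> sets M"
    have bl: "bounded_linear (\<lambda>y. Re (hinner y x))"
      by (rule bounded_linear_compose[OF bounded_linear_Re hinner.bounded_linear_left])
    have "(\<lambda>i. Re (hinner (E (A i) x) x)) sums Re (hinner (E (\<Union>(range A)) x) x)"
      by (rule bounded_linear.sums[OF bl E_sums[OF A(1,2) x]])
    then have "(\<lambda>i. (norm (E (A i) x))\<^sup>2) sums (norm (E (\<Union>(range A)) x))\<^sup>2"
      using A by (simp add: norm_E_sq x range_subsetD)
    then show "(\<Sum>i. ennreal ((norm (E (A i) x))\<^sup>2)) = ennreal ((norm (E (\<Union>(range A)) x))\<^sup>2)"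
      by (intro suminf_ennreal_eq) auto
  qed
qed (rule sets.sigma_algebra_axioms)

lemma finite_measure_mu: "x \<in> K \<Longrightarrow> finite_measure (mu x)"
  by (rule finite_measureI) (simp add: emeasure_mu)

lemma measure_mu: "x \<in> K \<Longrightarrow> A \<in> sets M \<Longrightarrow> measure (mu x) A = (norm (E A x))\<^sup>2"
  by (simp add: measure_def emeasure_mu)

section \<open>Integrals of simple functions\<close>

definition T :: "('b \<Rightarrow> real) \<Rightarrow> 'h \<Rightarrow> 'h" where
  "T s x = (\<Sum>v\<in>s ` space M. v *\<^sub>R E (s -` {v} \<inter> space M) x)"

text \<open>Independence of the representation: two simple functions can then be evaluated on one
  common partition.\<close>

lemma T_eq_partition:
  assumes s: "simple_function M s" and I: "finite I" "\<And>i. i \<in> I \<Longrightarrow> A i \<in> sets M" "disjoint_family_on A I"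
    "(\<Union>i\<in>I. A i) = space M" and c: "\<And>i w. i \<in> I \<Longrightarrow> w \<in> A i \<Longrightarrow> s w = c i" and x: "x \<in> K"
  shows "T s x = (\<Sum>i\<in>I. c i *\<^sub>R E (A i) x)"
proof -
  have fin: "finite (s ` space M)" and lev: "s -` {v} \<inter> space M \<in> sets M" for v
    using simple_functionD[OF s] by auto
  have sub: "A i \<subseteq> space M" if "i \<in> I" for i using I(2)[OF that] by (rule sets.sets_into_space)
  have "E (s -` {v} \<inter> space M) x = (\<Sum>i\<in>I. if c i = v then E (A i) x else 0)" for v
  proof -
    have "s -` {v} \<inter> space M = (\<Union>i\<in>I. s -` {v} \<inter> A i)" using I(4) by auto
    also have "E \<dots> x = (\<Sum>i\<in>I. E (s -` {v} \<inter> A i) x)"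
    proof (rule E_finite_UN[OF I(1) _ _ x])
      fix i assume i: "i \<in> I"
      have "s -` {v} \<inter> A i = (s -` {v} \<inter> space M) \<inter> A i" using sub[OF i] by auto
      then show "s -` {v} \<inter> A i \<in> sets M" using lev I(2)[OF i] by simp
    next
      show "disjoint_family_on (\<lambda>i. s -` {v} \<inter> A i) I" using I(3) by (auto simp: disjoint_family_on_def)
    qed
    also have "\<dots> = (\<Sum>i\<in>I. if c i = v then E (A i) x else 0)"
    proof (rule sum.cong[OF refl])
      fix i assume i: "i \<in> I"
      have "s -` {v} \<inter> A i = (if c i = v then A i else {})" using c[OF i] by auto
      then show "E (s -` {v} \<inter> A i) x = (if c i = v then E (A i) x else 0)" by (simp add: E_empty x)
    qed
    finally show ?thesis .
  qed
  then have "T s x = (\<Sum>v\<in>s ` space M. \<Sum>i\<in>I. if c i = v then v *\<^sub>R E (A i) x else 0)"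
    unfolding T_def by (simp add: scaleR_sum_right if_distrib[of "scaleR _"] cong: if_cong)
  also have "\<dots> = (\<Sum>i\<in>I. \<Sum>v\<in>s ` space M. if c i = v then v *\<^sub>R E (A i) x else 0)" by (rule sum.swap)
  also have "\<dots> = (\<Sum>i\<in>I. c i *\<^sub>R E (A i) x)"
  proof (rule sum.cong[OF refl])
    fix i assume i: "i \<in> I"
    show "(\<Sum>v\<in>s ` space M. if c i = v then v *\<^sub>R E (A i) x else 0) = c i *\<^sub>R E (A i) x"
    \<comment> \<open>An empty cell may carry a value that \<open>s\<close> never takes, and then
      the inner sum is empty; the right side vanishes too, since E {} x = 0.\<close>
    proof (cases "A i = {}")
      case True
      then show ?thesis by (simp add: E_empty x sum.neutral)
    next
      case False
      then obtain w where "w \<in> A i" by auto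
      then have "c i \<in> s ` space M" using c[OF i] sub[OF i] by (metis imageI subsetD)
      then show ?thesis using fin by (simp add: sum.delta)
    qed
  qed
  finally show ?thesis .
qed

lemma T_diff:
  assumes s: "simple_function M s" "simple_function M s'" and x: "x \<in> K"
  shows "T (\<lambda>w. s w - s' w) x = T s x - T s' x"
proof -
  define I where "I = s ` space M \<times> s' ` space M"
  define A where "A = (\<lambda>(v, v'). (s -` {v} \<inter> space M) \<inter> (s' -` {v'} \<inter> space M))"
  have I: "finite I" "\<And>i. i \<in> I \<Longrightarrow> A i \<in> sets M" "disjoint_family_on A I" "(\<Union>i\<in>I. A i) = space M"
    using simple_functionD[OF s(1)] simple_functionD[OF s(2)]
    by (auto simp: I_def A_def disjoint_family_on_def split: prod.splits)
  have "T s x = (\<Sum>i\<in>I. fst i *\<^sub>R E (A i) x)"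
    by (rule T_eq_partition[OF s(1) I _ x]) (auto simp: A_def)
  moreover have "T s' x = (\<Sum>i\<in>I. snd i *\<^sub>R E (A i) x)"
    by (rule T_eq_partition[OF s(2) I _ x]) (auto simp: A_def)
  moreover have "T (\<lambda>w. s w - s' w) x = (\<Sum>i\<in>I. (fst i - snd i) *\<^sub>R E (A i) x)"
    by (rule T_eq_partition[OF simple_function_diff[OF s] I _ x]) (auto simp: A_def)
  ultimately show ?thesis by (simp add: sum_subtractf scaleR_diff_left)
qed

context
  fixes s :: "'b \<Rightarrow> real"
  assumes s: "simple_function M s"
begin

lemma levels: "finite (s ` space M)" "s -` {v} \<inter> space M \<in> sets M"
  using simple_functionD[OF s] by auto

lemma T_K: "x \<in> K \<Longrightarrow> T s x \<in> K"
  unfolding T_def by (intro K_sum K_scaleR E_K levels)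

lemma T_add: "x \<in> K \<Longrightarrow> y \<in> K \<Longrightarrow> T s (x + y) = T s x + T s y"
  unfolding T_def by (simp add: E_add levels scaleR_add_right sum.distrib)

lemma T_hscale: "x \<in> K \<Longrightarrow> T s (hscale c x) = hscale c (T s x)"
proof -
  interpret h: bounded_linear "hscale c :: 'h \<Rightarrow> 'h" by (rule bounded_linear_hscale)
  show "x \<in> K \<Longrightarrow> ?thesis"
    unfolding T_def by (simp add: E_hscale levels h.sum h.scaleR)
qed

lemma T_adjoint: "x \<in> K \<Longrightarrow> y \<in> K \<Longrightarrow> hinner (T s x) y = hinner x (T s y)"
  unfolding T_def hinner.sum_left hinner.sum_right
  by (simp add: hinner_scaleR_left hinner_scaleR_right E_adjoint levels)

lemma T_E: "A \<in> sets M \<Longrightarrow> x \<in> K \<Longrightarrow> T s (E A x) = E A (T s x)"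
  unfolding T_def by (simp add: E_setsum E_scaleR K_scaleR E_K E_Int levels) (simp add: Int_commute)

text \<open>The isometry behind the construction: distinct level sets are disjoint, so all cross
  terms of <T s x, T s x> vanish.\<close>

lemma norm_T_sq:
  assumes x: "x \<in> K"
  shows "ennreal ((norm (T s x))\<^sup>2) = (\<integral>\<^sup>+ w. ennreal ((s w)\<^sup>2) \<partial>mu x)"
proof -
  let ?L = "\<lambda>v. s -` {v} \<inter> space M"
  have "hinner (T s x) (T s x) = (\<Sum>u\<in>s ` space M. \<Sum>v\<in>s ` space M. hinner (u *\<^sub>R E (?L u) x) (v *\<^sub>R E (?L v) x))"
    unfolding T_def hinner.sum_left by (simp add: hinner.sum_right)
  also have "\<dots> = (\<Sum>u\<in>s ` space M. \<Sum>v\<in>s ` space M. if u = v then complex_of_real (u\<^sup>2 * (norm (E (?L u) x))\<^sup>2) else 0)"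
  proof (intro sum.cong refl)
    fix u v
    show "hinner (u *\<^sub>R E (?L u) x) (v *\<^sub>R E (?L v) x)
        = (if u = v then complex_of_real (u\<^sup>2 * (norm (E (?L u) x))\<^sup>2) else 0)"
    proof (cases "u = v")
      case True
      then show ?thesis by (simp add: hinner_norm power_mult_distrib)
    next
      case False
      then have "hinner (E (?L u) x) (E (?L v) x) = 0" by (intro E_orthogonal levels x) auto
      then show ?thesis using False by (simp add: hinner_scaleR_left hinner_scaleR_right)
    qed
  qed
  also have "\<dots> = complex_of_real (\<Sum>u\<in>s ` space M. u\<^sup>2 * (norm (E (?L u) x))\<^sup>2)"
    using levels(1) by simp
  finally have "(norm (T s x))\<^sup>2 = (\<Sum>u\<in>s ` space M. u\<^sup>2 * (norm (E (?L u) x))\<^sup>2)"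
    unfolding hinner_norm by (simp only: of_real_eq_iff)
  then have "ennreal ((norm (T s x))\<^sup>2) = (\<Sum>u\<in>s ` space M. ennreal (u\<^sup>2) * emeasure (mu x) (?L u))"
    by (simp add: sum_ennreal[symmetric] ennreal_mult' emeasure_mu x levels)
  also have "\<dots> = (\<Sum>u\<in>s ` space M. \<integral>\<^sup>+ w. ennreal (u\<^sup>2) * indicator (?L u) w \<partial>mu x)"
    by (simp add: levels nn_integral_cmult_indicator)
  also have "\<dots> = (\<integral>\<^sup>+ w. (\<Sum>u\<in>s ` space M. ennreal (u\<^sup>2) * indicator (?L u) w) \<partial>mu x)"
    by (rule nn_integral_sum[symmetric], rule borel_measurable_times_ennreal)
       (simp_all add: levels borel_measurable_indicator)
  also have "\<dots> = (\<integral>\<^sup>+ w. ennreal ((s w)\<^sup>2) \<partial>mu x)"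
  proof (rule nn_integral_cong)
    fix w assume w: "w \<in> space (mu x)"
    have "(\<Sum>u\<in>s ` space M. ennreal (u\<^sup>2) * indicator (?L u) w) = (\<Sum>u\<in>s ` space M. if u = s w then ennreal (u\<^sup>2) else 0)"
      using w by (intro sum.cong) (auto simp: indicator_def)
    then show "(\<Sum>u\<in>s ` space M. ennreal (u\<^sup>2) * indicator (?L u) w) = ennreal ((s w)\<^sup>2)"
      using w levels(1) by simp
  qed
  finally show ?thesis .
qed

lemma hinner_T_self:
  assumes x: "x \<in> K"
  shows "hinner x (T s x) = complex_of_real (integral\<^sup>L (mu x) s)"
proof -
  interpret finite_measure "mu x" by (rule finite_measure_mu[OF x])
  let ?L = "\<lambda>v. s -` {v} \<inter> space M"
  have "integral\<^sup>L (mu x) s = (\<integral>w. (\<Sum>u\<in>s ` space M. u * indicator (?L u) w) \<partial>mu x)"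
  proof (rule Bochner_Integration.integral_cong[OF refl])
    fix w assume w: "w \<in> space (mu x)"
    have "(\<Sum>u\<in>s ` space M. u * indicator (?L u) w) = (\<Sum>u\<in>s ` space M. if u = s w then u else 0)"
      using w by (intro sum.cong) (auto simp: indicator_def)
    then show "s w = (\<Sum>u\<in>s ` space M. u * indicator (?L u) w)" using w levels(1) by simp
  qed
  also have "\<dots> = (\<Sum>u\<in>s ` space M. u * measure (mu x) (?L u))"
    by (subst Bochner_Integration.integral_sum)
       (auto simp: levels emeasure_mu x intro!: integrable_mult_right integrable_real_indicator)
  also have "complex_of_real \<dots> = (\<Sum>u\<in>s ` space M. hinner x (u *\<^sub>R E (?L u) x))"
    by (simp add: measure_mu x levels hinner_scaleR_right E_adjoint[symmetric] norm_E_sq scaleR_conv_of_real)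
  also have "\<dots> = hinner x (T s x)" unfolding T_def by (simp add: hinner.sum_right)
  finally show ?thesis ..
qed

end

end

text \<open>The approximating sequence is fixed independently of the vector, so that linearity of the limit
  operator is immediate.\<close>

locale pvm_function = pvm_on K M E
  for K :: "'h::chilbert set" and M :: "'b measure" and E :: "'b set \<Rightarrow> 'h \<Rightarrow> 'h" +
  fixes f :: "'b \<Rightarrow> real" and s :: "nat \<Rightarrow> 'b \<Rightarrow> real"
  assumes f [measurable]: "f \<in> borel_measurable M"
    and s: "\<And>n. simple_function M (s n)"
    and s_lim: "\<And>w. w \<in> space M \<Longrightarrow> (\<lambda>n. s n w) \<longlonglongrightarrow> f w"
    and s_le: "\<And>n w. w \<in> space M \<Longrightarrow> \<bar>s n w\<bar> \<le> 2 * \<bar>f w\<bar>"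
begin

section \<open>Domain and limit operator\<close>

lemma s_measurable [measurable]: "s n \<in> borel_measurable M"
  by (rule borel_measurable_simple_function[OF s])

definition D :: "'h set" where "D = {x \<in> K. (\<integral>\<^sup>+ w. ennreal ((f w)\<^sup>2) \<partial>mu x) < \<infinity>}"

lemma D_K: "x \<in> D \<Longrightarrow> x \<in> K"
  and D_fin: "x \<in> D \<Longrightarrow> (\<integral>\<^sup>+ w. ennreal ((f w)\<^sup>2) \<partial>mu x) < \<infinity>"
  by (auto simp: D_def)

lemma s_sq_le: "w \<in> space M \<Longrightarrow> (s n w)\<^sup>2 \<le> 4 * (f w)\<^sup>2"
  using power_mono[OF s_le[of w n], of 2] by (simp add: power_mult_distrib)

lemma norm_T_le:
  assumes x: "x \<in> K"
  shows "ennreal ((norm (T (s n) x))\<^sup>2) \<le> 4 * (\<integral>\<^sup>+ w. ennreal ((f w)\<^sup>2) \<partial>mu x)"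
proof -
  have "ennreal ((norm (T (s n) x))\<^sup>2) = (\<integral>\<^sup>+ w. ennreal ((s n w)\<^sup>2) \<partial>mu x)" by (rule norm_T_sq[OF s x])
  also have "\<dots> \<le> (\<integral>\<^sup>+ w. 4 * ennreal ((f w)\<^sup>2) \<partial>mu x)"
  proof (rule nn_integral_mono)
    fix w assume "w \<in> space (mu x)"
    then have "ennreal ((s n w)\<^sup>2) \<le> ennreal (4 * (f w)\<^sup>2)" using s_sq_le by (intro ennreal_leI) simp
    then show "ennreal ((s n w)\<^sup>2) \<le> 4 * ennreal ((f w)\<^sup>2)" by (simp add: ennreal_mult)
  qed
  also have "\<dots> = 4 * (\<integral>\<^sup>+ w. ennreal ((f w)\<^sup>2) \<partial>mu x)" by (rule nn_integral_cmult) simp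
  finally show ?thesis .
qed

text \<open>Fatou's lemma. Together with \<open>norm_T_le\<close> it describes D as the set of x
  with bounded \<open>T (s n) x\<close>; since each \<open>T (s n)\<close> is linear, closure of D
  under addition and scaling becomes the triangle inequality and homogeneity of the norm.\<close>

lemma D_I_bounded:
  assumes x: "x \<in> K" and C: "\<And>n. norm (T (s n) x) \<le> C"
  shows "x \<in> D"
proof -
  have "(\<integral>\<^sup>+ w. ennreal ((f w)\<^sup>2) \<partial>mu x) = (\<integral>\<^sup>+ w. liminf (\<lambda>n. ennreal ((s n w)\<^sup>2)) \<partial>mu x)"
  proof (rule nn_integral_cong)
    fix w assume "w \<in> space (mu x)"
    then have "(\<lambda>n. ennreal ((s n w)\<^sup>2)) \<longlonglongrightarrow> ennreal ((f w)\<^sup>2)"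
      by (intro tendsto_ennrealI tendsto_power s_lim) simp
    then show "ennreal ((f w)\<^sup>2) = liminf (\<lambda>n. ennreal ((s n w)\<^sup>2))"
      by (intro lim_imp_Liminf[symmetric]) auto
  qed
  also have "\<dots> \<le> liminf (\<lambda>n. \<integral>\<^sup>+ w. ennreal ((s n w)\<^sup>2) \<partial>mu x)"
    by (rule nn_integral_liminf) simp
  also have "\<dots> \<le> liminf (\<lambda>n::nat. ennreal (C\<^sup>2))"
    using C by (intro Liminf_mono always_eventually allI) (auto simp: norm_T_sq[OF s x, symmetric] intro!: ennreal_leI power_mono)
  also have "\<dots> = ennreal (C\<^sup>2)" by (simp add: Liminf_const)
  also have "\<dots> < \<infinity>" by simp
  finally show ?thesis using x by (simp add: D_def)
qed

lemma D_bounded: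
  assumes x: "x \<in> D"
  obtains C where "\<And>n. norm (T (s n) x) \<le> C"
proof -
  obtain r where r: "r \<ge> 0" "4 * (\<integral>\<^sup>+ w. ennreal ((f w)\<^sup>2) \<partial>mu x) = ennreal r"
    using D_fin[OF x] by (cases "4 * (\<integral>\<^sup>+ w. ennreal ((f w)\<^sup>2) \<partial>mu x)") (auto simp: ennreal_mult_eq_top_iff)
  have "(norm (T (s n) x))\<^sup>2 \<le> r" for n
    using norm_T_le[OF D_K[OF x], of n] r by (simp add: ennreal_le_iff)
  then have "norm (T (s n) x) \<le> sqrt r" for n by (simp add: real_le_rsqrt)
  then show thesis by (rule that)
qed

lemma csubspace_D: "csubspace D"
  unfolding csubspace_def
proof (intro conjI ballI allI)
  have "T (s n) 0 = 0" for n unfolding T_def by (simp add: E_0 levels[OF s])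
  then show "0 \<in> D" by (intro D_I_bounded[OF K_0, of 0]) simp
next
  fix x y assume x: "x \<in> D" and y: "y \<in> D"
  obtain C C' where "\<And>n. norm (T (s n) x) \<le> C" "\<And>n. norm (T (s n) y) \<le> C'"
    using D_bounded[OF x] D_bounded[OF y] by metis
  then have "norm (T (s n) (x + y)) \<le> C + C'" for n
    unfolding T_add[OF s D_K[OF x] D_K[OF y]] by (rule norm_triangle_mono)
  then show "x + y \<in> D" by (rule D_I_bounded[OF K_add[OF D_K[OF x] D_K[OF y]]])
next
  fix c x assume x: "x \<in> D"
  obtain C where "\<And>n. norm (T (s n) x) \<le> C" using D_bounded[OF x] by metis
  then have "norm (T (s n) (hscale c x)) \<le> cmod c * C" for n
    unfolding T_hscale[OF s D_K[OF x]] norm_hscale by (rule mult_left_mono) simp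
  then show "hscale c x \<in> D" by (rule D_I_bounded[OF K_hscale[OF D_K[OF x]]])
qed

lemma L2_approx:
  assumes x: "x \<in> D"
  shows "(\<lambda>n. \<integral>\<^sup>+ w. ennreal ((s n w - f w)\<^sup>2) \<partial>mu x) \<longlonglongrightarrow> 0"
proof -
  have "(\<lambda>n. \<integral>\<^sup>+ w. ennreal ((s n w - f w)\<^sup>2) \<partial>mu x) \<longlonglongrightarrow> (\<integral>\<^sup>+ w. 0 \<partial>mu x)"
  proof (rule nn_integral_dominated_convergence[where w = "\<lambda>w. 9 * ennreal ((f w)\<^sup>2)"])
    show "(\<integral>\<^sup>+ w. 9 * ennreal ((f w)\<^sup>2) \<partial>mu x) < \<infinity>"
      using D_fin[OF x] by (simp add: nn_integral_cmult ennreal_mult_less_top)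
    show "AE w in mu x. ennreal ((s n w - f w)\<^sup>2) \<le> 9 * ennreal ((f w)\<^sup>2)" for n
    proof (rule AE_I2)
      fix w assume "w \<in> space (mu x)"
      then have "\<bar>s n w - f w\<bar> \<le> 3 * \<bar>f w\<bar>" using s_le[of w n] by simp
      then have "\<bar>s n w - f w\<bar>\<^sup>2 \<le> (3 * \<bar>f w\<bar>)\<^sup>2" by (rule power_mono) simp
      then have "ennreal ((s n w - f w)\<^sup>2) \<le> ennreal (9 * (f w)\<^sup>2)"
        by (intro ennreal_leI) (simp add: power_mult_distrib)
      then show "ennreal ((s n w - f w)\<^sup>2) \<le> 9 * ennreal ((f w)\<^sup>2)" by (simp add: ennreal_mult)
    qed
    show "AE w in mu x. (\<lambda>n. ennreal ((s n w - f w)\<^sup>2)) \<longlonglongrightarrow> 0"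
    proof (rule AE_I2)
      fix w assume "w \<in> space (mu x)"
      then have "(\<lambda>n. ennreal ((s n w - f w)\<^sup>2)) \<longlonglongrightarrow> ennreal ((f w - f w)\<^sup>2)"
        by (intro tendsto_ennrealI tendsto_power tendsto_diff s_lim tendsto_const) simp
      then show "(\<lambda>n. ennreal ((s n w - f w)\<^sup>2)) \<longlonglongrightarrow> 0" by simp
    qed
  qed simp_all
  then show ?thesis by simp
qed

definition Q :: "'h \<Rightarrow> 'h" where "Q x = lim (\<lambda>n. T (s n) x)"

text \<open>By the isometry, distances between approximants are L^2 distances between the simple
  functions, which are Cauchy because these converge to f.\<close>

lemma T_tendsto_Q:
  assumes x: "x \<in> D"
  shows "(\<lambda>n. T (s n) x) \<longlonglongrightarrow> Q x"
proof -
  let ?e = "\<lambda>n. \<integral>\<^sup>+ w. ennreal ((s n w - f w)\<^sup>2) \<partial>mu x"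
  have le: "ennreal ((norm (T (s m) x - T (s n) x))\<^sup>2) \<le> 2 * ?e m + 2 * ?e n" for m n
  proof -
    have "ennreal ((norm (T (s m) x - T (s n) x))\<^sup>2) = (\<integral>\<^sup>+ w. ennreal ((s m w - s n w)\<^sup>2) \<partial>mu x)"
      using norm_T_sq[OF simple_function_diff[OF s s] D_K[OF x], of m n] T_diff[OF s s D_K[OF x], of m n] by simp
    also have "\<dots> \<le> (\<integral>\<^sup>+ w. 2 * ennreal ((s m w - f w)\<^sup>2) + 2 * ennreal ((s n w - f w)\<^sup>2) \<partial>mu x)"
    proof (rule nn_integral_mono)
      fix w
      \<comment> \<open>This square is the gap in (a-b)^2 \<le> 2a^2 + 2b^2, where a and b are the
        two errors \<open>s m w - f w\<close> and \<open>s n w - f w\<close>.\<close>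
      have "0 \<le> ((s m w - f w) + (s n w - f w))\<^sup>2" by simp
      then have "(s m w - s n w)\<^sup>2 \<le> 2 * (s m w - f w)\<^sup>2 + 2 * (s n w - f w)\<^sup>2"
        by (simp add: power2_eq_square algebra_simps)
      then have "ennreal ((s m w - s n w)\<^sup>2) \<le> ennreal (2 * (s m w - f w)\<^sup>2 + 2 * (s n w - f w)\<^sup>2)"
        by (rule ennreal_leI)
      then show "ennreal ((s m w - s n w)\<^sup>2) \<le> 2 * ennreal ((s m w - f w)\<^sup>2) + 2 * ennreal ((s n w - f w)\<^sup>2)"
        by (simp add: ennreal_mult ennreal_plus)
    qed
    also have "\<dots> = 2 * ?e m + 2 * ?e n" by (simp add: nn_integral_add nn_integral_cmult)
    finally show ?thesis .
  qed
  have "Cauchy (\<lambda>n. T (s n) x)"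
  proof (rule CauchyI)
    fix e :: real assume e: "e > 0"
    \<comment> \<open>Two errors enter with factor 2 each, so a quarter of the squared tolerance
      suffices for each.\<close>
    have "eventually (\<lambda>n. ?e n < ennreal (e\<^sup>2 / 4)) sequentially"
      by (rule order_tendstoD(2)[OF L2_approx[OF x]]) (use e in simp)
    then obtain N where N: "\<And>n. n \<ge> N \<Longrightarrow> ?e n < ennreal (e\<^sup>2 / 4)"
      unfolding eventually_sequentially by blast
    have "norm (T (s m) x - T (s n) x) < e" if mn: "m \<ge> N" "n \<ge> N" for m n
    proof (rule power2_less_imp_less)
      obtain a b where ab: "?e m = ennreal a" "a \<ge> 0" "?e n = ennreal b" "b \<ge> 0"
        using N[OF mn(1)] N[OF mn(2)] by (cases "?e m"; cases "?e n") auto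
      have "a < e\<^sup>2 / 4" "b < e\<^sup>2 / 4" using N[OF mn(1)] N[OF mn(2)] ab by (auto simp: ennreal_less_iff)
      moreover have "ennreal ((norm (T (s m) x - T (s n) x))\<^sup>2) \<le> ennreal (2 * a + 2 * b)"
        using le[of m n] ab by (simp add: ennreal_mult ennreal_plus)
      then have "(norm (T (s m) x - T (s n) x))\<^sup>2 \<le> 2 * a + 2 * b" using ab by (subst (asm) ennreal_le_iff) auto
      ultimately show "(norm (T (s m) x - T (s n) x))\<^sup>2 < e\<^sup>2" by simp
    qed (use e in simp)
    then show "\<exists>N. \<forall>m\<ge>N. \<forall>n\<ge>N. norm (T (s m) x - T (s n) x) < e" by blast
  qed
  then show ?thesis unfolding Q_def by (simp add: Cauchy_convergent_iff convergent_LIMSEQ_iff)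
qed

lemma Q_K: "x \<in> D \<Longrightarrow> Q x \<in> K"
  by (rule closed_csubspace_LIMSEQ[OF K T_K[OF s D_K] T_tendsto_Q])

lemma Q_add:
  assumes x: "x \<in> D" and y: "y \<in> D" shows "Q (x + y) = Q x + Q y"
proof (rule LIMSEQ_unique[OF T_tendsto_Q[OF csubspace_add[OF csubspace_D x y]]])
  show "(\<lambda>n. T (s n) (x + y)) \<longlonglongrightarrow> Q x + Q y"
    unfolding T_add[OF s D_K[OF x] D_K[OF y]] by (intro tendsto_add T_tendsto_Q x y)
qed

lemma Q_hscale:
  assumes x: "x \<in> D" shows "Q (hscale c x) = hscale c (Q x)"
proof (rule LIMSEQ_unique[OF T_tendsto_Q[OF csubspace_hscale[OF csubspace_D x]]])
  show "(\<lambda>n. T (s n) (hscale c x)) \<longlonglongrightarrow> hscale c (Q x)"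
    unfolding T_hscale[OF s D_K[OF x]] by (intro bounded_linear.tendsto[OF bounded_linear_hscale] T_tendsto_Q x)
qed

lemma Q_symmetric:
  assumes x: "x \<in> D" and y: "y \<in> D" shows "hinner (Q x) y = hinner x (Q y)"
proof (rule LIMSEQ_unique)
  show "(\<lambda>n. hinner (T (s n) x) y) \<longlonglongrightarrow> hinner (Q x) y"
    by (intro hinner.tendsto tendsto_const T_tendsto_Q x)
  show "(\<lambda>n. hinner (T (s n) x) y) \<longlonglongrightarrow> hinner x (Q y)"
    unfolding T_adjoint[OF s D_K[OF x] D_K[OF y]] by (intro hinner.tendsto tendsto_const T_tendsto_Q y)
qed

lemma norm_Q_sq:
  assumes x: "x \<in> D"
  shows "ennreal ((norm (Q x))\<^sup>2) = (\<integral>\<^sup>+ w. ennreal ((f w)\<^sup>2) \<partial>mu x)"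
proof (rule LIMSEQ_unique)
  show "(\<lambda>n. ennreal ((norm (T (s n) x))\<^sup>2)) \<longlonglongrightarrow> ennreal ((norm (Q x))\<^sup>2)"
    by (intro tendsto_ennrealI tendsto_power tendsto_norm T_tendsto_Q x)
  show "(\<lambda>n. ennreal ((norm (T (s n) x))\<^sup>2)) \<longlonglongrightarrow> (\<integral>\<^sup>+ w. ennreal ((f w)\<^sup>2) \<partial>mu x)"
    unfolding norm_T_sq[OF s D_K[OF x]]
  proof (rule nn_integral_dominated_convergence[where w = "\<lambda>w. 4 * ennreal ((f w)\<^sup>2)"])
    show "(\<integral>\<^sup>+ w. 4 * ennreal ((f w)\<^sup>2) \<partial>mu x) < \<infinity>"
      using D_fin[OF x] by (simp add: nn_integral_cmult ennreal_mult_less_top)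
    show "AE w in mu x. ennreal ((s n w)\<^sup>2) \<le> 4 * ennreal ((f w)\<^sup>2)" for n
    proof (rule AE_I2)
      fix w assume "w \<in> space (mu x)"
      then have "ennreal ((s n w)\<^sup>2) \<le> ennreal (4 * (f w)\<^sup>2)" using s_sq_le by (intro ennreal_leI) simp
      then show "ennreal ((s n w)\<^sup>2) \<le> 4 * ennreal ((f w)\<^sup>2)" by (simp add: ennreal_mult)
    qed
    show "AE w in mu x. (\<lambda>n. ennreal ((s n w)\<^sup>2)) \<longlonglongrightarrow> ennreal ((f w)\<^sup>2)"
      by (intro AE_I2 tendsto_ennrealI tendsto_power s_lim) simp
  qed simp_all
qed

lemma hinner_Q_self:
  assumes x: "x \<in> D"
  shows "hinner x (Q x) = complex_of_real (integral\<^sup>L (mu x) f)"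
proof (rule LIMSEQ_unique)
  interpret finite_measure "mu x" by (rule finite_measure_mu[OF D_K[OF x]])
  have f2: "integrable (mu x) (\<lambda>w. (f w)\<^sup>2)"
    using D_fin[OF x] by (intro integrableI_bounded) auto
  \<comment> \<open>Square integrability gives integrability because the measure is finite: 2|f|
    \<le> 1 + f^2.\<close>
  have "integrable (mu x) (\<lambda>w. 2 * \<bar>f w\<bar>)"
  proof (rule Bochner_Integration.integrable_bound)
    show "integrable (mu x) (\<lambda>w. 1 + (f w)\<^sup>2)" using f2 by (intro Bochner_Integration.integrable_add) auto
    show "AE w in mu x. norm (2 * \<bar>f w\<bar>) \<le> norm (1 + (f w)\<^sup>2)"
    proof (rule AE_I2)
      fix w
      have "0 \<le> (\<bar>f w\<bar> - 1)\<^sup>2" by simp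
      then have "2 * \<bar>f w\<bar> \<le> 1 + (f w)\<^sup>2" by (simp add: power2_diff)
      then show "norm (2 * \<bar>f w\<bar>) \<le> norm (1 + (f w)\<^sup>2)" by simp
    qed
  qed simp
  then have "(\<lambda>n. integral\<^sup>L (mu x) (s n)) \<longlonglongrightarrow> integral\<^sup>L (mu x) f"
    by (intro integral_dominated_convergence[where w = "\<lambda>w. 2 * \<bar>f w\<bar>"]) (auto simp: s_lim s_le)
  then show "(\<lambda>n. hinner x (T (s n) x)) \<longlonglongrightarrow> complex_of_real (integral\<^sup>L (mu x) f)"
    unfolding hinner_T_self[OF s D_K[OF x]] by (rule tendsto_of_real)
  show "(\<lambda>n. hinner x (T (s n) x)) \<longlonglongrightarrow> hinner x (Q x)"
    by (intro hinner.tendsto tendsto_const T_tendsto_Q x)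
qed

section \<open>Truncation and self-adjointness\<close>

definition cut :: "nat \<Rightarrow> 'b set" where "cut n = {w \<in> space M. \<bar>f w\<bar> \<le> real n}"

lemma cut_sets [measurable]: "cut n \<in> sets M"
  unfolding cut_def by measurable

lemma E_cut_D:
  assumes x: "x \<in> K"
  shows "E (cut n) x \<in> D"
proof -
  define y where "y = E (cut n) x"
  have y: "y \<in> K" unfolding y_def by (rule E_K[OF cut_sets x])
  interpret finite_measure "mu y" by (rule finite_measure_mu[OF y])
  have "emeasure (mu y) (space M - cut n) = 0"
  proof -
    have "E (space M - cut n) y = 0"
      unfolding y_def by (rule E_disjoint[OF _ cut_sets _ x]) auto
    then show ?thesis using emeasure_mu[OF y sets.compl_sets[OF cut_sets[of n]]] by simp
  qed
  then have "AE w in mu y. w \<in> cut n"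
    by (intro AE_I[where N = "space M - cut n"]) auto
  then have "(\<integral>\<^sup>+ w. ennreal ((f w)\<^sup>2) \<partial>mu y) \<le> (\<integral>\<^sup>+ w. ennreal ((real n)\<^sup>2) \<partial>mu y)"
  proof (intro nn_integral_mono_AE, eventually_elim)
    fix w assume "w \<in> cut n"
    then have "\<bar>f w\<bar>\<^sup>2 \<le> (real n)\<^sup>2" unfolding cut_def by (intro power_mono) auto
    then show "ennreal ((f w)\<^sup>2) \<le> ennreal ((real n)\<^sup>2)" by (intro ennreal_leI) simp
  qed
  also have "\<dots> < \<infinity>" by (simp add: ennreal_mult_less_top emeasure_mu[OF y])
  finally show ?thesis using y by (simp add: D_def y_def)
qed

text \<open>The squared distance to x is the spectral measure of the set where |f| exceeds n, and
  these sets decrease to the empty set. With \<open>E_cut_D\<close> this makes D dense in K.\<close>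

lemma E_cut_tendsto:
  assumes x: "x \<in> K"
  shows "(\<lambda>n. E (cut n) x) \<longlonglongrightarrow> x"
proof -
  interpret finite_measure "mu x" by (rule finite_measure_mu[OF x])
  have "(\<lambda>n. measure (mu x) (space M - cut n)) \<longlonglongrightarrow> measure (mu x) (\<Inter>n. space M - cut n)"
  proof (rule finite_Lim_measure_decseq)
    show "decseq (\<lambda>n. space M - cut n)"
      unfolding decseq_def cut_def using order_trans by fastforce
  qed auto
  also have "(\<Inter>n. space M - cut n) = {}"
    unfolding cut_def using real_arch_simple by fastforce
  finally have "(\<lambda>n. (norm (x - E (cut n) x))\<^sup>2) \<longlonglongrightarrow> 0"
    by (simp add: measure_mu x sets.compl_sets E_compl)
  then have "(\<lambda>n. sqrt ((norm (x - E (cut n) x))\<^sup>2)) \<longlonglongrightarrow> sqrt 0" by (rule tendsto_real_sqrt)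
  then have "(\<lambda>n. norm (E (cut n) x - x)) \<longlonglongrightarrow> 0" by (simp add: norm_minus_commute)
  then show ?thesis by (simp add: LIM_zero_iff tendsto_norm_zero_iff)
qed

text \<open>The approximants commute with E (cut n), so they stay in its range; contractivity of E
  (cut n) carries this to the limit.\<close>

lemma Q_E_cut:
  assumes x: "x \<in> K"
  shows "E (cut n) (Q (E (cut n) x)) = Q (E (cut n) x)"
proof (rule LIMSEQ_unique)
  have d: "E (cut n) x \<in> D" by (rule E_cut_D[OF x])
  show "(\<lambda>m. T (s m) (E (cut n) x)) \<longlonglongrightarrow> Q (E (cut n) x)" by (rule T_tendsto_Q[OF d])
  have eq: "T (s m) (E (cut n) x) = E (cut n) (T (s m) (E (cut n) x))" for m
    by (simp add: T_E[OF s] cut_sets x E_idem T_K[OF s] E_K)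
  have "(\<lambda>m. E (cut n) (T (s m) (E (cut n) x)) - E (cut n) (Q (E (cut n) x))) \<longlonglongrightarrow> 0"
  proof (rule Lim_null_comparison)
    show "(\<lambda>m. norm (T (s m) (E (cut n) x) - Q (E (cut n) x))) \<longlonglongrightarrow> 0"
      using T_tendsto_Q[OF d] by (simp add: LIM_zero_iff tendsto_norm_zero_iff)
    have "norm (E (cut n) (T (s m) (E (cut n) x) - Q (E (cut n) x))) \<le> norm (T (s m) (E (cut n) x) - Q (E (cut n) x))" for m
      by (intro norm_E_le cut_sets K_diff T_K[OF s] Q_K d D_K)
    then show "eventually (\<lambda>m. norm (E (cut n) (T (s m) (E (cut n) x)) - E (cut n) (Q (E (cut n) x)))
        \<le> norm (T (s m) (E (cut n) x) - Q (E (cut n) x))) sequentially"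
      by (simp add: E_diff cut_sets T_K[OF s] Q_K d D_K)
  qed
  then show "(\<lambda>m. T (s m) (E (cut n) x)) \<longlonglongrightarrow> E (cut n) (Q (E (cut n) x))"
    using eq by (simp add: LIM_zero_iff)
qed

text \<open>The adjoint relation cannot be tested on y itself. It is tested on the truncated image w
  = Q (E (cut n) y), which lies in D because Q preserves the range of the truncation.\<close>

lemma Q_maximal:
  assumes y: "y \<in> K" and z: "z \<in> K" and adj: "\<And>x. x \<in> D \<Longrightarrow> hinner (Q x) y = hinner x z"
  shows "y \<in> D"
proof -
  have bound: "norm (Q (E (cut n) y)) \<le> norm z" for n
  proof -
    define w where "w = Q (E (cut n) y)"
    have d: "E (cut n) y \<in> D" by (rule E_cut_D[OF y])
    have w: "w \<in> K" unfolding w_def by (rule Q_K[OF d])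
    have Ew: "E (cut n) w = w" unfolding w_def by (rule Q_E_cut[OF y])
    then have wD: "w \<in> D" using E_cut_D[OF w, of n] by simp
    have "E (cut n) (Q w) = Q w" using Q_E_cut[OF w, of n] Ew by simp
    \<comment> \<open>As Q w lies in the range of the truncation, y may be replaced by its
      truncation, and symmetry of Q turns the product into <w,w>. By hypothesis it is also <w,z>,
      whence ||w|| \<le> ||z||.\<close>
    then have "hinner (Q w) y = hinner (Q w) (E (cut n) y)"
      using E_adjoint[OF cut_sets Q_K[OF wD] y] by metis
    also have "\<dots> = hinner w w" using Q_symmetric[OF wD d] by (simp add: w_def)
    finally have "hinner w w = hinner w z" using adj[OF wD] by simp
    then have "norm w * norm w = cmod (hinner w z)"
      unfolding hinner_norm by (metis abs_norm_cancel norm_of_real norm_power power2_eq_square real_norm_def)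
    then have "norm w * norm w \<le> norm w * norm z"
      using hinner_Cauchy_Schwarz[of w z] by simp
    then show ?thesis unfolding w_def[symmetric] by (cases "norm w = 0") auto
  qed
  \<comment> \<open>The factor 2 is the square root of the 4 in \<open>norm_T_le\<close>. With m
    fixed, the truncation in the previous bound is removed by n tending to infinity.\<close>
  have "norm (T (s m) y) \<le> 2 * norm z" for m
  proof (rule LIMSEQ_le_const2)
    have "(\<lambda>n. E (cut n) (T (s m) y)) \<longlonglongrightarrow> T (s m) y" by (rule E_cut_tendsto[OF T_K[OF s y]])
    then show "(\<lambda>n. norm (E (cut n) (T (s m) y))) \<longlonglongrightarrow> norm (T (s m) y)" by (rule tendsto_norm)
    have "norm (E (cut n) (T (s m) y)) \<le> 2 * norm z" for n
    proof -
      have d: "E (cut n) y \<in> D" by (rule E_cut_D[OF y])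
      have "ennreal ((norm (T (s m) (E (cut n) y)))\<^sup>2) \<le> 4 * ennreal ((norm (Q (E (cut n) y)))\<^sup>2)"
        unfolding norm_Q_sq[OF d] by (rule norm_T_le[OF D_K[OF d]])
      also have "\<dots> = ennreal ((2 * norm (Q (E (cut n) y)))\<^sup>2)"
        by (simp add: power_mult_distrib ennreal_mult)
      finally have "(norm (T (s m) (E (cut n) y)))\<^sup>2 \<le> (2 * norm (Q (E (cut n) y)))\<^sup>2"
        by (simp add: ennreal_le_iff)
      then have "norm (T (s m) (E (cut n) y)) \<le> 2 * norm (Q (E (cut n) y))" by (rule power2_le_imp_le) simp
      then show ?thesis using bound[of n] by (simp add: T_E[OF s cut_sets y])
    qed
    then show "\<exists>N. \<forall>n\<ge>N. norm (E (cut n) (T (s m) y)) \<le> 2 * norm z" by blast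
  qed
  then show ?thesis by (rule D_I_bounded[OF y])
qed

lemma self_adjoint_Q: "self_adjoint_in K Q D"
  unfolding self_adjoint_in_def
proof (intro conjI ballI allI impI)
  show "K \<subseteq> closure D"
  proof
    fix x assume x: "x \<in> K"
    show "x \<in> closure D"
      unfolding closure_sequential
      by (intro exI[of _ "\<lambda>n. E (cut n) x"] conjI allI E_cut_D[OF x] E_cut_tendsto[OF x])
  qed
  fix y assume "y \<in> K" "\<exists>z\<in>K. \<forall>x\<in>D. hinner (Q x) y = hinner x z"
  then show "y \<in> D" using Q_maximal by blast
qed (auto simp: D_K csubspace_D Q_K Q_add Q_hscale Q_symmetric)

section \<open>The spectral decomposition as an image under f\<close>

lemma spec_meas_eq:
  assumes x: "x \<in> K"
  shows "spec_meas (\<lambda>B. E (f -` B \<inter> space M)) x = distr (mu x) borel f"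
proof -
  have "spec_meas (\<lambda>B. E (f -` B \<inter> space M)) x
      = measure_of UNIV (sets borel) (emeasure (distr (mu x) borel f))"
    unfolding spec_meas_def
  proof (rule measure_of_eq)
    fix B assume "B \<in> sigma_sets UNIV (sets (borel :: real measure))"
    then have B: "B \<in> sets borel" using sets.sigma_sets_eq[of "borel :: real measure"] by simp
    have fB: "f -` B \<inter> space M \<in> sets M" by (rule measurable_sets[OF f B])
    show "ennreal ((norm (E (f -` B \<inter> space M) x))\<^sup>2) = emeasure (distr (mu x) borel f) B"
      using emeasure_distr[of f "mu x" borel B] B by (simp add: emeasure_mu[OF x fB])
  qed simp
  also have "\<dots> = distr (mu x) borel f"
    using measure_of_of_measure[of "distr (mu x) borel f"] by simp
  finally show ?thesis .
qed

lemma is_pvm_pushforward: "is_pvm K UNIV (sets borel) (\<lambda>B. E (f -` B \<inter> space M))"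
  unfolding is_pvm_def
proof (intro conjI ballI allI impI)
  show "is_proj_on K (E (f -` B \<inter> space M))" if "B \<in> sets borel" for B
    by (rule E_proj[OF measurable_sets[OF f that]])
  show "E (f -` UNIV \<inter> space M) x = x" if "x \<in> K" for x using that by (simp add: E_space)
  fix A :: "nat \<Rightarrow> real set" and x
  assume A: "range A \<subseteq> sets borel" "disjoint_family A" and x: "x \<in> K"
  have "(\<lambda>i. E (f -` A i \<inter> space M) x) sums E (\<Union>(range (\<lambda>i. f -` A i \<inter> space M))) x"
  proof (rule E_sums[OF _ _ x])
    show "range (\<lambda>i. f -` A i \<inter> space M) \<subseteq> sets M" using A(1) measurable_sets[OF f] by blast
    show "disjoint_family (\<lambda>i. f -` A i \<inter> space M)" using A(2) by (auto simp: disjoint_family_on_def)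
  qed
  also have "\<Union>(range (\<lambda>i. f -` A i \<inter> space M)) = f -` \<Union>(range A) \<inter> space M" by auto
  finally show "(\<lambda>i. E (f -` A i \<inter> space M) x) sums E (f -` \<Union>(range A) \<inter> space M) x" .
qed

lemma spec_decomp_Q: "has_spec_decomp K Q D (\<lambda>B. E (f -` B \<inter> space M))"
  unfolding has_spec_decomp_def
proof (intro conjI ballI allI)
  have "(\<integral>\<^sup>+ l. ennreal (l\<^sup>2) \<partial>spec_meas (\<lambda>B. E (f -` B \<inter> space M)) x) = (\<integral>\<^sup>+ w. ennreal ((f w)\<^sup>2) \<partial>mu x)"
    if "x \<in> K" for x
    unfolding spec_meas_eq[OF that] by (rule nn_integral_distr) simp_all
  then show "D = {x \<in> K. (\<integral>\<^sup>+ l. ennreal (l\<^sup>2) \<partial>spec_meas (\<lambda>B. E (f -` B \<inter> space M)) x) < \<infinity>}"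
    by (auto simp: D_def)
  show "hinner x (Q x) = complex_of_real (integral\<^sup>L (spec_meas (\<lambda>B. E (f -` B \<inter> space M)) x) (\<lambda>l. l))"
    if x: "x \<in> D" for x
    unfolding spec_meas_eq[OF D_K[OF x]] hinner_Q_self[OF x] by (subst integral_distr) simp_all
qed (auto simp: is_pvm_pushforward Q_K Q_add Q_hscale)

end

context pvm_on
begin

theorem spectral_integral_exists:
  fixes f :: "'b \<Rightarrow> real"
  assumes f: "f \<in> borel_measurable M"
  defines "D \<equiv> {x \<in> K. (\<integral>\<^sup>+ w. ennreal ((f w)\<^sup>2) \<partial>mu x) < \<infinity>}"
  obtains Q where "self_adjoint_in K Q D"
    "\<And>x. x \<in> D \<Longrightarrow> hinner x (Q x) = complex_of_real (integral\<^sup>L (mu x) f)"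
    "has_spec_decomp K Q D (\<lambda>B. E (f -` B \<inter> space M))"
proof -
  \<comment> \<open>With base point 0 the bound reads |s i w| \<le> 2|f w|; it is the source of the
    dominating constants 4 = 2^2 and 9 = (2+1)^2.\<close>
  obtain s where s: "\<forall>i. simple_function M (s i)" "\<forall>w\<in>space M. (\<lambda>i. s i w) \<longlonglongrightarrow> f w"
      "\<forall>i. \<forall>w\<in>space M. dist (s i w) 0 \<le> 2 * dist (f w) 0"
    using borel_measurable_implies_sequence_metric[OF f, of 0] by (elim exE conjE)
  interpret F: pvm_function K M E f s
    by unfold_locales (use f s in \<open>auto simp: dist_real_def\<close>)
  have D: "D = F.D" by (simp add: D_def F.D_def)
  show thesis
    by (rule that[of F.Q]) (simp_all add: D F.self_adjoint_Q F.hinner_Q_self F.spec_decomp_Q)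
qed

end

section \<open>The projection valued measure on path space\<close>

lemma hscale_hat: "x \<noteq> 0 \<Longrightarrow> hscale (complex_of_real (norm x)) (hat x) = x"
  by (simp add: hat_def hscale_of_real)

lemma hat_eq_hscale: "hat x = hscale (complex_of_real (inverse (norm x))) x"
  by (simp only: hat_def hscale_of_real)

lemma proj_onto_hat: "closed_csubspace V \<Longrightarrow> proj_onto V (hat x) = inverse (norm x) *\<^sub>R proj_onto V x"
  using proj_onto_hscale[of V "complex_of_real (inverse (norm x))" x]
  unfolding hat_eq_hscale hscale_of_real[symmetric] .

lemma norm_proj_onto_hat:
  assumes "closed_csubspace V" "x \<noteq> 0"
  shows "(norm x)\<^sup>2 * (norm (proj_onto V (hat x)))\<^sup>2 = (norm (proj_onto V x))\<^sup>2"
  using assms(2) by (simp add: proj_onto_hat[OF assms(1)] power_mult_distrib power_inverse)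

lemma is_proj_on_proj_onto:
  assumes K: "closed_csubspace K" and V: "closed_csubspace V" "V \<subseteq> K"
  shows "is_proj_on K (proj_onto V)"
  unfolding is_proj_on_def
proof (intro conjI ballI allI)
  show "\<exists>B. \<forall>x\<in>K. norm (proj_onto V x) \<le> B * norm x"
    by (intro exI[of _ 1]) (simp add: norm_proj_le[OF V(1)])
qed (use proj_onto_in[OF V(1)] V(2) in
      \<open>auto simp: proj_onto_add[OF V(1)] proj_onto_hscale[OF V(1)] proj_onto_idem[OF V(1)] hinner_proj_commute[OF V(1)]\<close>)

context projection_family
begin

abbreviation "\<H> \<equiv> Hpi S \<Gamma> p"
abbreviation "\<M> \<equiv> Msig S \<Gamma>"
abbreviation "\<P> \<equiv> Pphi S \<Gamma> p"

section \<open>Events and their subspaces\<close>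

text \<open>Taken from the formula in part (d), although linearity is not yet known: no choice is
  made, and what remains is to exhibit some closed subspace with the right projection.\<close>

definition HA :: "('s \<Rightarrow> 'a) set \<Rightarrow> 'h set" where
  "HA A = {x \<in> \<H>. x = 0 \<or> measure (\<P> x) A = 1}"

text \<open>The factor undoes the normalization in \<open>hat\<close>, so that the weight is
  comparable with squared norms of projections of x itself, and it sets the value 0 at the zero
  vector, which has no measure of its own.\<close>

definition mass :: "'h \<Rightarrow> ('s \<Rightarrow> 'a) set \<Rightarrow> real" where
  "mass x A = (norm x)\<^sup>2 * measure (\<P> x) A"

lemma mass_0 [simp]: "mass 0 A = 0"
  by (simp add: mass_def)

lemma P_props:
  assumes "x \<in> \<H>" "x \<noteq> 0"
  shows sets_P: "sets (\<P> x) = sets \<M>" and space_P: "space (\<P> x) = Omega S \<Gamma>" and prob_space_P: "prob_space (\<P> x)"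
    and measure_P_cyl: "xs \<in> pi_list S \<Gamma> \<Longrightarrow> measure (\<P> x) (cyl S \<Gamma> xs) = (norm (pw p xs (hat x)))\<^sup>2"
proof -
  have "is_Pphi S \<Gamma> p x (\<P> x)" using is_Pphi_Pphi[of x] assms by simp
  then show "sets (\<P> x) = sets \<M>" "prob_space (\<P> x)"
    "xs \<in> pi_list S \<Gamma> \<Longrightarrow> measure (\<P> x) (cyl S \<Gamma> xs) = (norm (pw p xs (hat x)))\<^sup>2"
    unfolding is_Pphi_def by blast+
  then show "space (\<P> x) = Omega S \<Gamma>" using sets_eq_imp_space_eq space_Msig by metis
qed

lemma mass_cyl:
  assumes x: "x \<in> \<H>" and xs: "xs \<in> pi_list S \<Gamma>"
  shows "mass x (cyl S \<Gamma> xs) = (norm (pw p xs x))\<^sup>2"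
proof -
  have R: "closed_csubspace (Rng (set xs))" using xs by (simp add: pi_list_iff)
  show ?thesis
  proof (cases "x = 0")
    case True
    have "proj_onto (Rng (set xs)) 0 = 0"
      by (rule proj_onto_id[OF R csubspace_0[OF closed_csubspaceD(2)[OF R]]])
    then show ?thesis using True by (simp add: pw_eq)
  next
    case False
    show ?thesis unfolding mass_def measure_P_cyl[OF x False xs] pw_eq by (rule norm_proj_onto_hat[OF R False])
  qed
qed

lemma mass_compl:
  assumes "x \<in> \<H>" "A \<in> sets \<M>"
  shows "mass x (Omega S \<Gamma> - A) = (norm x)\<^sup>2 - mass x A"
proof (cases "x = 0")
  case False
  interpret prob_space "\<P> x" by (rule prob_space_P[OF assms(1) False])
  have "measure (\<P> x) (Omega S \<Gamma> - A) = 1 - measure (\<P> x) A"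
    using prob_compl[of A] assms(2) sets_P[OF assms(1) False] space_P[OF assms(1) False] by simp
  then show ?thesis by (simp add: mass_def right_diff_distrib)
qed simp

lemma mass_sums:
  assumes "x \<in> \<H>" "range A \<subseteq> sets \<M>" "disjoint_family A"
  shows "(\<lambda>i. mass x (A i)) sums mass x (\<Union>i. A i)"
proof (cases "x = 0")
  case False
  interpret prob_space "\<P> x" by (rule prob_space_P[OF assms(1) False])
  show ?thesis unfolding mass_def
    using assms sets_P[OF assms(1) False] by (intro sums_mult finite_measure_UNION) auto
qed simp

lemma mass_disjoint:
  assumes x: "x \<in> \<H>" and A: "A \<in> sets \<M>" "B \<in> sets \<M>" "A \<inter> B = {}" and full: "mass x A = (norm x)\<^sup>2"
  shows "mass x B = 0"
proof (cases "x = 0")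
  case False
  interpret prob_space "\<P> x" by (rule prob_space_P[OF x False])
  have "measure (\<P> x) A + measure (\<P> x) B = measure (\<P> x) (A \<union> B)"
    using A sets_P[OF x False] by (intro finite_measure_Union[symmetric]) auto
  also have "\<dots> \<le> 1" by simp
  finally have "measure (\<P> x) B \<le> 0" using full False by (simp add: mass_def)
  then have "measure (\<P> x) B = 0" using measure_nonneg[of "\<P> x" B] by linarith
  then show ?thesis by (simp add: mass_def)
qed simp

definition represents :: "'h set \<Rightarrow> ('s \<Rightarrow> 'a) set \<Rightarrow> bool" where
  "represents V A \<longleftrightarrow> closed_csubspace V \<and> V \<subseteq> \<H> \<and> (\<forall>x\<in>\<H>. (norm (proj_onto V x))\<^sup>2 = mass x A)"

text \<open>A vector lies in V exactly when projecting onto V preserves its norm, that is, when all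
  its mass is on A; so V is determined by A.\<close>

lemma represents_HA:
  assumes "represents V A" shows "HA A = V"
proof -
  have V: "closed_csubspace V" "V \<subseteq> \<H>" and m: "\<And>x. x \<in> \<H> \<Longrightarrow> (norm (proj_onto V x))\<^sup>2 = mass x A"
    using assms by (auto simp: represents_def)
  have "x \<in> HA A \<longleftrightarrow> x \<in> V" if x: "x \<in> \<H>" for x
  proof -
    have "x \<in> V \<longleftrightarrow> (norm (proj_onto V x))\<^sup>2 = (norm x)\<^sup>2"
      unfolding norm_proj_eq_iff[OF V(1), symmetric] by (simp add: power2_eq_iff_nonneg)
    also have "\<dots> \<longleftrightarrow> x = 0 \<or> measure (\<P> x) A = 1" unfolding m[OF x] by (simp add: mass_def)
    finally show ?thesis using x by (simp add: HA_def)
  qed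
  then show ?thesis using V(2) by (auto simp: HA_def)
qed

text \<open>Orthogonality comes from probability: a vector of the i-th subspace has its whole mass
  on A i, hence none on the disjoint A j, so its projection onto the j-th subspace is 0. The closed
  span then represents the union by Parseval's identity and countable additivity.\<close>

lemma represents_UN:
  assumes A: "range A \<subseteq> sets \<M>" "disjoint_family A" and rep: "\<And>i::nat. represents (HA (A i)) (A i)"
  shows "represents (HA (\<Union>i. A i)) (\<Union>i. A i)"
    "\<And>x. (\<lambda>i. proj_onto (HA (A i)) x) sums proj_onto (HA (\<Union>i. A i)) x"
proof -
  have V: "closed_csubspace (HA (A i))" "HA (A i) \<subseteq> \<H>" for i using rep[of i] by (auto simp: represents_def)
  have m: "(norm (proj_onto (HA (A i)) x))\<^sup>2 = mass x (A i)" if "x \<in> \<H>" for x i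
    using rep[of i] that by (auto simp: represents_def)
  interpret orthogonal_family "\<lambda>i. HA (A i)" UNIV
  proof
    fix i j x y assume "i \<noteq> j" and x: "x \<in> HA (A i)" and y: "y \<in> HA (A j)"
    then have disj: "A i \<inter> A j = {}" using A(2) by (auto simp: disjoint_family_on_def)
    have xH: "x \<in> \<H>" using x V by auto
    have "mass x (A i) = (norm x)\<^sup>2" using m[OF xH, of i] proj_onto_id[OF V(1) x] by simp
    then have "mass x (A j) = 0" using A(1) by (intro mass_disjoint[OF xH _ _ disj]) auto
    then have "proj_onto (HA (A j)) x = 0" using m[OF xH, of j] by simp
    then have "x \<in> orth (HA (A j))" using proj_onto_eq_0_iff[OF V(1)] by blast
    then show "hinner x y = 0" using y by (rule orthD)
  qed (rule V)
  let ?V = "orth annih"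
  have sums: "(\<lambda>i. proj_onto (HA (A i)) x) sums proj_onto ?V x" for x
    unfolding proj_orth_annih by (rule has_sum_imp_sums[OF has_sum_proj])
  have "represents ?V (\<Union>i. A i)"
    unfolding represents_def
  proof (intro conjI ballI)
    \<comment> \<open>A vector of the closed span is the limit of the partial sums of its
      components, all of them in the closed commuting subspace.\<close>
    show "?V \<subseteq> \<H>"
    proof
      fix v assume "v \<in> ?V"
      then have "proj_onto ?V v = v" by (simp add: proj_onto_id)
      then have lim: "(\<lambda>n. \<Sum>i<n. proj_onto (HA (A i)) v) \<longlonglongrightarrow> v" using sums[of v] by (simp add: sums_def)
      have "(\<Sum>i<n. proj_onto (HA (A i)) v) \<in> \<H>" for n
        by (rule csubspace_sum[OF closed_csubspaceD(2)[OF closed_csubspace_Hpi]])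
           (rule subsetD[OF V(2) proj_onto_in[OF V(1)]])
      then show "v \<in> \<H>" using lim by (rule closed_csubspace_LIMSEQ[OF closed_csubspace_Hpi])
    qed
    fix x assume x: "x \<in> \<H>"
    have "(\<lambda>i. (norm (proj_onto (HA (A i)) x))\<^sup>2) sums (norm (proj_onto ?V x))\<^sup>2"
      unfolding proj_orth_annih by (rule has_sum_imp_sums[OF has_sum_norm_proj])
    then have "(\<lambda>i. mass x (A i)) sums (norm (proj_onto ?V x))\<^sup>2" unfolding m[OF x] .
    then show "(norm (proj_onto ?V x))\<^sup>2 = mass x (\<Union>i. A i)"
      using mass_sums[OF x A] by (rule sums_unique2)
  qed simp
  with represents_HA[OF this] sums
  show "represents (HA (\<Union>i. A i)) (\<Union>i. A i)"
    "\<And>x. (\<lambda>i. proj_onto (HA (A i)) x) sums proj_onto (HA (\<Union>i. A i)) x" by simp_all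
qed

text \<open>The projection onto the joint range maps the commuting subspace into itself, so on
  vectors of that subspace intersecting the range with it changes nothing.\<close>

lemma represents_cyl:
  assumes xs: "xs \<in> pi_list S \<Gamma>"
  shows "represents (Rng (set xs) \<inter> \<H>) (cyl S \<Gamma> xs)" "\<And>x. x \<in> \<H> \<Longrightarrow> proj_onto (Rng (set xs) \<inter> \<H>) x = pw p xs x"
proof -
  have R: "closed_csubspace (Rng (set xs))" and xs': "set xs \<subseteq> \<Lambda>" using xs by (auto simp: pi_list_iff)
  have V: "closed_csubspace (Rng (set xs) \<inter> \<H>)" by (rule closed_csubspace_Int[OF R closed_csubspace_Hpi])
  show eq: "proj_onto (Rng (set xs) \<inter> \<H>) x = pw p xs x" if "x \<in> \<H>" for x
  proof (rule proj_onto_unique[OF closed_csubspaceD(2)[OF V]])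
    show "pw p xs x \<in> Rng (set xs) \<inter> \<H>" using pw_Hpi[OF that xs'] R by (simp add: pw_eq)
    show "hinner (x - pw p xs x) z = 0" if "z \<in> Rng (set xs) \<inter> \<H>" for z
      using that hinner_proj_residual[OF R] by (simp add: pw_eq)
  qed
  show "represents (Rng (set xs) \<inter> \<H>) (cyl S \<Gamma> xs)"
    unfolding represents_def using V eq mass_cyl[OF _ xs] by simp
qed

lemma represents_sets:
  assumes "A \<in> sets \<M>" shows "represents (HA A) A"
  using Int_stable_cyl cyl_generator_Pow assms[unfolded sets_Msig]
proof (induction rule: sigma_sets_induct_disjoint)
  case (basic A)
  then obtain xs where "xs \<in> pi_list S \<Gamma>" "A = cyl S \<Gamma> xs" by blast
  then show ?case using represents_cyl(1)[of xs] represents_HA by metis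
next
  case empty
  have "mass x {} = 0" for x by (simp add: mass_def)
  moreover have "proj_onto {0} x = 0" for x :: 'h using proj_onto_in[of "{0}" x] by simp
  ultimately have "represents {0} {}"
    unfolding represents_def by (simp add: csubspace_0 closed_csubspaceD(2))
  then show ?case using represents_HA by metis
next
  case (compl A)
  have A: "A \<in> sets \<M>" using compl.hyps by (simp add: sets_Msig)
  have V: "closed_csubspace (HA A)" "HA A \<subseteq> \<H>" and m: "\<And>x. x \<in> \<H> \<Longrightarrow> (norm (proj_onto (HA A) x))\<^sup>2 = mass x A"
    using compl.IH by (auto simp: represents_def)
  \<comment> \<open>The complement is taken inside the commuting subspace; on vectors of that
    subspace its projection is x minus the projection onto \<open>HA A\<close>.\<close>
  let ?W = "orth (HA A) \<inter> \<H>"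
  have W: "closed_csubspace ?W" by (rule closed_csubspace_Int) simp_all
  have "(norm (proj_onto ?W x))\<^sup>2 = mass x (Omega S \<Gamma> - A)" if x: "x \<in> \<H>" for x
  proof -
    have "proj_onto ?W x = x - proj_onto (HA A) x"
    proof (rule proj_onto_unique[OF closed_csubspaceD(2)[OF W]])
      have "proj_onto (HA A) x \<in> \<H>" using V proj_onto_in[OF V(1)] by blast
      then have "x - proj_onto (HA A) x \<in> \<H>"
        using x by (intro csubspace_diff closed_csubspaceD(2)[OF closed_csubspace_Hpi])
      then show "x - proj_onto (HA A) x \<in> ?W" using proj_onto_residual_in_orth[OF V(1)] by blast
      fix z assume "z \<in> ?W"
      then have "hinner (proj_onto (HA A) x) z = 0" using orthD(2) proj_onto_in[OF V(1)] by (metis IntD1)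
      then show "hinner (x - (x - proj_onto (HA A) x)) z = 0" by simp
    qed
    then show ?thesis
      using norm_proj_Pythagoras[OF V(1), of x] mass_compl[OF x A] m[OF x] by simp
  qed
  then have "represents ?W (Omega S \<Gamma> - A)" unfolding represents_def using W by simp
  then show ?case using represents_HA by metis
next
  case (union A)
  then show ?case using represents_UN(1)[of A] by (simp add: sets_Msig)
qed

lemma HA_props:
  assumes "A \<in> sets \<M>"
  shows closed_csubspace_HA: "closed_csubspace (HA A)" and HA_subset: "HA A \<subseteq> \<H>"
    and norm_proj_HA: "x \<in> \<H> \<Longrightarrow> (norm (proj_onto (HA A) x))\<^sup>2 = mass x A"
  using represents_sets[OF assms] by (auto simp: represents_def)

lemma proj_HA_cyl: "xs \<in> pi_list S \<Gamma> \<Longrightarrow> x \<in> \<H> \<Longrightarrow> proj_onto (HA (cyl S \<Gamma> xs)) x = pw p xs x"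
  using represents_HA[OF represents_cyl(1)] represents_cyl(2) by simp

lemma HA_Omega: "HA (Omega S \<Gamma>) = \<H>"
proof -
  have "measure (\<P> x) (Omega S \<Gamma>) = 1" if "x \<in> \<H>" "x \<noteq> 0" for x
    using prob_space.prob_space[OF prob_space_P[OF that]] space_P[OF that] by simp
  then show ?thesis by (auto simp: HA_def)
qed

lemma is_pvm_HA: "is_pvm \<H> (Omega S \<Gamma>) (sets \<M>) (\<lambda>A. proj_onto (HA A))"
  unfolding is_pvm_def
proof (intro conjI ballI allI impI)
  show "is_proj_on \<H> (proj_onto (HA A))" if "A \<in> sets \<M>" for A
    by (rule is_proj_on_proj_onto[OF closed_csubspace_Hpi closed_csubspace_HA[OF that] HA_subset[OF that]])
  show "proj_onto (HA (Omega S \<Gamma>)) x = x" if "x \<in> \<H>" for x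
    unfolding HA_Omega by (rule proj_onto_id[OF closed_csubspace_Hpi that])
  show "(\<lambda>i. proj_onto (HA (A i)) x) sums proj_onto (HA (\<Union>(range A))) x"
    if "range A \<subseteq> sets \<M>" "disjoint_family A" for A :: "nat \<Rightarrow> ('s \<Rightarrow> 'a) set" and x
    using that by (intro represents_UN(2) represents_sets) auto
qed

sublocale PV: pvm_on \<H> \<M> "\<lambda>A. proj_onto (HA A)"
  by unfold_locales (simp_all add: is_pvm_HA space_Msig)

section \<open>Uniqueness, decompositions and probabilities\<close>

lemma pvm_unique:
  assumes q: "is_pvm \<H> (Omega S \<Gamma>) (sets \<M>) q"
    and cyl: "\<And>xs x. xs \<in> pi_list S \<Gamma> \<Longrightarrow> x \<in> \<H> \<Longrightarrow> q (cyl S \<Gamma> xs) x = pw p xs x"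
    and A: "A \<in> sets \<M>" and x: "x \<in> \<H>"
  shows "q A x = proj_onto (HA A) x"
proof -
  interpret q: pvm_on \<H> \<M> q by unfold_locales (simp_all add: q space_Msig)
  show ?thesis
    using Int_stable_cyl cyl_generator_Pow A[unfolded sets_Msig]
  proof (induction rule: sigma_sets_induct_disjoint)
    case (basic A)
    then show ?case using cyl proj_HA_cyl x by auto
  next
    case empty
    then show ?case by (simp add: q.E_empty PV.E_empty x)
  next
    case (compl A)
    then have "A \<in> sets \<M>" by (simp add: sets_Msig)
    then show ?case using q.E_compl[OF _ x] PV.E_compl[OF _ x] compl.IH by (simp add: space_Msig)
  next
    case (union A)
    then have A: "range A \<subseteq> sets \<M>" by (simp add: sets_Msig)
    show ?case
      using q.E_sums[OF A union.hyps(1) x] PV.E_sums[OF A union.hyps(1) x] union.IH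
      by (simp add: sums_unique2)
  qed
qed

lemma orth_Hpi: "orth \<H> = closure (Nset S \<Gamma> p)"
  unfolding Hpi_eq_orth by (rule orth_orth_closure[OF csubspace_Nset])

text \<open>A vector is first projected onto the commuting subspace; the projection is then split
  between the event and its complement, while the residual is the third component.\<close>

lemma orth_decomp3_HA:
  assumes A: "A \<in> sets \<M>"
  shows "orth_decomp3 (HA A) (HA (Omega S \<Gamma> - A)) (orth \<H>)"
  unfolding orth_decomp3_def
proof (intro conjI ballI allI)
  have Ac: "Omega S \<Gamma> - A \<in> sets \<M>" using sets.compl_sets[OF A] by (simp add: space_Msig)
  note V = closed_csubspace_HA[OF A] closed_csubspace_HA[OF Ac] and sub = HA_subset[OF A] HA_subset[OF Ac]
  show "hinner u v = 0" if u: "u \<in> HA A" and v: "v \<in> HA (Omega S \<Gamma> - A)" for u v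
    using PV.E_orthogonal[OF A Ac _ subsetD[OF sub(1) u] subsetD[OF sub(2) v]]
      proj_onto_id[OF V(1) u] proj_onto_id[OF V(2) v] by simp
  show "hinner u w = 0" if "u \<in> HA A" "w \<in> orth \<H>" for u w
    using orthD(2)[OF that(2) subsetD[OF sub(1) that(1)]] .
  show "hinner u w = 0" if "u \<in> HA (Omega S \<Gamma> - A)" "w \<in> orth \<H>" for u w
    using orthD(2)[OF that(2) subsetD[OF sub(2) that(1)]] .
  fix x
  define y where "y = proj_onto \<H> x"
  have y: "y \<in> \<H>" unfolding y_def by (rule proj_onto_in[OF closed_csubspace_Hpi])
  have "x = proj_onto (HA A) y + proj_onto (HA (Omega S \<Gamma> - A)) y + (x - y)"
    using PV.E_compl[OF A y] by (simp add: space_Msig)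
  moreover have "x - y \<in> orth \<H>" unfolding y_def by (rule proj_onto_residual_in_orth[OF closed_csubspace_Hpi])
  ultimately show "\<exists>u\<in>HA A. \<exists>v\<in>HA (Omega S \<Gamma> - A). \<exists>w\<in>orth \<H>. x = u + v + w"
    using proj_onto_in[OF V(1)] proj_onto_in[OF V(2)] by blast
qed

lemma measure_P_eq:
  assumes "x \<in> \<H>" "x \<noteq> 0" "A \<in> sets \<M>"
  shows "measure (\<P> x) A = (norm (proj_onto (HA A) (hat x)))\<^sup>2"
proof -
  have "(norm x)\<^sup>2 * (norm (proj_onto (HA A) (hat x)))\<^sup>2 = (norm x)\<^sup>2 * measure (\<P> x) A"
    using norm_proj_onto_hat[OF closed_csubspace_HA[OF assms(3)] assms(2)] norm_proj_HA[OF assms(3,1)]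
    by (simp add: mass_def)
  then show ?thesis using assms(2) by simp
qed

lemma orth_HA:
  assumes A: "A \<in> sets \<M>"
  shows "orth (HA A) = {x. proj_onto \<H> x = 0 \<or> measure (\<P> (proj_onto \<H> x)) A = 0}"
proof -
  have "x \<in> orth (HA A) \<longleftrightarrow> proj_onto \<H> x = 0 \<or> measure (\<P> (proj_onto \<H> x)) A = 0" for x
  proof -
    have "x \<in> orth (HA A) \<longleftrightarrow> proj_onto (HA A) x = 0"
      using proj_onto_eq_0_iff[OF closed_csubspace_HA[OF A]] by blast
    also have "\<dots> \<longleftrightarrow> proj_onto (HA A) (proj_onto \<H> x) = 0"
      unfolding proj_onto_subset[OF closed_csubspace_HA[OF A] closed_csubspace_Hpi HA_subset[OF A]] ..
    also have "\<dots> \<longleftrightarrow> (norm (proj_onto (HA A) (proj_onto \<H> x)))\<^sup>2 = 0" by simp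
    also have "\<dots> \<longleftrightarrow> mass (proj_onto \<H> x) A = 0"
      unfolding norm_proj_HA[OF A proj_onto_in[OF closed_csubspace_Hpi]] ..
    also have "\<dots> \<longleftrightarrow> proj_onto \<H> x = 0 \<or> measure (\<P> (proj_onto \<H> x)) A = 0"
      by (simp add: mass_def)
    finally show ?thesis .
  qed
  then show ?thesis by blast
qed

text \<open>For y the projection of x onto \<open>HA A\<close>, multiplicativity gives mass of B
  under y = mass of A \<inter> B under x, while ||y||^2 is the mass of A under x.\<close>

lemma conditional_P:
  assumes x: "x \<in> \<H>" "x \<noteq> 0" and A: "A \<in> sets \<M>" and B: "B \<in> sets \<M>" and pos: "measure (\<P> x) A \<noteq> 0"
  shows "measure (\<P> x) (A \<inter> B) / measure (\<P> x) A = measure (\<P> (proj_onto (HA A) x)) B"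
proof -
  define y where "y = proj_onto (HA A) x"
  have y: "y \<in> \<H>" unfolding y_def by (rule PV.E_K[OF A x(1)])
  have ny: "(norm y)\<^sup>2 = mass x A" unfolding y_def by (rule norm_proj_HA[OF A x(1)])
  then have "(norm y)\<^sup>2 \<noteq> 0" using x(2) pos by (simp add: mass_def)
  then have y0: "y \<noteq> 0" by auto
  have "(norm y)\<^sup>2 * measure (\<P> y) B = (norm (proj_onto (HA B) y))\<^sup>2"
    using norm_proj_HA[OF B y] by (simp add: mass_def)
  also have "proj_onto (HA B) y = proj_onto (HA (A \<inter> B)) x"
    unfolding y_def using PV.E_Int[OF B A x(1)] by (simp add: Int_commute)
  also have "(norm (proj_onto (HA (A \<inter> B)) x))\<^sup>2 = mass x (A \<inter> B)"
    by (rule norm_proj_HA[OF sets.Int[OF A B] x(1)])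
  finally have "measure (\<P> x) A * measure (\<P> y) B = measure (\<P> x) (A \<inter> B)"
    unfolding ny mass_def using x(2) by simp
  then show ?thesis unfolding y_def[symmetric] using pos by (simp add: field_simps)
qed

section \<open>Observables\<close>

text \<open>Identifies the scalar spectral measure of a normalized vector with its probability
  measure, which turns the general spectral integral into a statement about expectations.\<close>

lemma mu_hat:
  assumes "x \<in> \<H>" "x \<noteq> 0"
  shows "PV.mu (hat x) = \<P> x"
proof (rule measure_eqI)
  interpret prob_space "\<P> x" by (rule prob_space_P[OF assms])
  show "sets (PV.mu (hat x)) = sets (\<P> x)" by (simp add: sets_P[OF assms])
  fix A assume "A \<in> sets (PV.mu (hat x))"
  then have "A \<in> sets \<M>" by simp
  then show "emeasure (PV.mu (hat x)) A = emeasure (\<P> x) A"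
    by (simp add: PV.emeasure_mu hat_Hpi assms emeasure_eq_measure measure_P_eq)
qed

text \<open>The spectral integral yields a domain described by the unnormalized measures, the claim
  one described by probabilities. They agree because a domain that is a subspace contains x exactly
  when it contains the normalized vector, for nonzero x.\<close>

lemma observable:
  fixes f :: "('s \<Rightarrow> 'a) \<Rightarrow> real"
  assumes f: "f \<in> borel_measurable \<M>"
  defines "D \<equiv> {x \<in> \<H>. x = 0 \<or> (\<integral>\<^sup>+ w. ennreal ((f w)\<^sup>2) \<partial>\<P> x) < \<infinity>}"
  shows "\<exists>Q. self_adjoint_in \<H> Q D
    \<and> (\<forall>x\<in>D - {0}. complex_of_real (integral\<^sup>L (\<P> x) f) = hinner (hat x) (Q (hat x)))
    \<and> has_spec_decomp \<H> Q D (\<lambda>B. proj_onto (HA (f -` B \<inter> Omega S \<Gamma>)))"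
proof -
  let ?D = "{x \<in> \<H>. (\<integral>\<^sup>+ w. ennreal ((f w)\<^sup>2) \<partial>PV.mu x) < \<infinity>}"
  obtain Q where Q: "self_adjoint_in \<H> Q ?D"
    "\<And>x. x \<in> ?D \<Longrightarrow> hinner x (Q x) = complex_of_real (integral\<^sup>L (PV.mu x) f)"
    "has_spec_decomp \<H> Q ?D (\<lambda>B. proj_onto (HA (f -` B \<inter> space \<M>)))"
    using PV.spectral_integral_exists[OF f] by blast
  have sub: "csubspace ?D" using Q(1) unfolding self_adjoint_in_def by blast
  have hat_iff: "x \<in> ?D \<longleftrightarrow> hat x \<in> ?D" if "x \<noteq> 0" for x
  proof
    show "x \<in> ?D \<Longrightarrow> hat x \<in> ?D"
      unfolding hat_eq_hscale by (rule csubspace_hscale[OF sub])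
    show "hat x \<in> ?D \<Longrightarrow> x \<in> ?D"
      using csubspace_hscale[OF sub, of "hat x" "complex_of_real (norm x)"] unfolding hscale_hat[OF that] .
  qed
  have "x \<in> ?D \<longleftrightarrow> x \<in> D" if x: "x \<in> \<H>" for x
  proof (cases "x = 0")
    case True
    then show ?thesis using csubspace_0[OF sub] x by (simp add: D_def)
  next
    case False
    then show ?thesis using hat_iff[OF False] x hat_Hpi[OF x] by (simp add: mu_hat D_def)
  qed
  then have D: "?D = D" unfolding D_def by blast
  have "complex_of_real (integral\<^sup>L (\<P> x) f) = hinner (hat x) (Q (hat x))" if x: "x \<in> D - {0}" for x
  proof -
    have "x \<in> \<H>" "x \<noteq> 0" using x by (auto simp: D_def)
    moreover have "hat x \<in> ?D" using hat_iff[of x] x D by blast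
    ultimately show ?thesis using Q(2)[of "hat x"] by (simp add: mu_hat)
  qed
  then show ?thesis using Q(1,3) unfolding D space_Msig by blast
qed

end

theorem theorem1:
  fixes S :: "'s set" and \<Gamma> :: "'s \<Rightarrow> 'a set" and p :: "'s \<Rightarrow> 'a \<Rightarrow> 'h::chilbert \<Rightarrow> 'h"
  assumes "setting S \<Gamma> p"
  defines "H\<pi> \<equiv> Hpi S \<Gamma> p" and "N \<equiv> Nset S \<Gamma> p" and "\<Omega> \<equiv> Omega S \<Gamma>" and "M \<equiv> Msig S \<Gamma>"
    and "P \<equiv> Pphi S \<Gamma> p"
  shows
    \<comment> \<open>(a)\<close>
    "csubspace N \<and> H\<pi> = Hpi' S \<Gamma> p \<and> Hpi' S \<Gamma> p = Hpi'' S \<Gamma> p \<and> Hpi'' S \<Gamma> p = orth N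
     \<comment> \<open>(b)\<close>
   \<and> (\<forall>x\<in>H\<pi> - {0}. \<exists>!Q. is_Pphi S \<Gamma> p x Q)
   \<and> (\<exists>HA :: ('s \<Rightarrow> 'a) set \<Rightarrow> 'h set.
       \<comment> \<open>(c)\<close>
       (\<forall>A\<in>sets M. closed (HA A) \<and> csubspace (HA A) \<and> HA A \<subseteq> H\<pi>)
     \<and> is_pvm H\<pi> \<Omega> (sets M) (\<lambda>A. proj_onto (HA A))
     \<and> (\<forall>xs\<in>pi_list S \<Gamma>. \<forall>x\<in>H\<pi>. proj_onto (HA (cyl S \<Gamma> xs)) x = pw p xs x)
     \<and> (\<forall>q. is_pvm H\<pi> \<Omega> (sets M) q \<and> (\<forall>xs\<in>pi_list S \<Gamma>. \<forall>x\<in>H\<pi>. q (cyl S \<Gamma> xs) x = pw p xs x)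
           \<longrightarrow> (\<forall>A\<in>sets M. \<forall>x\<in>H\<pi>. q A x = proj_onto (HA A) x))
     \<and> HA \<Omega> = H\<pi>
     \<and> orth H\<pi> = closure N
     \<and> (\<forall>A\<in>sets M. orth_decomp3 (HA A) (HA (\<Omega> - A)) (orth H\<pi>)
                  \<and> orth_decomp3 (HA A) (HA (\<Omega> - A)) (closure N))
       \<comment> \<open>(d)\<close>
     \<and> (\<forall>x\<in>H\<pi> - {0}. \<forall>A\<in>sets M. measure (P x) A = (norm (proj_onto (HA A) (hat x)))\<^sup>2)
     \<and> (\<forall>A\<in>sets M. HA A = {x\<in>H\<pi>. x = 0 \<or> measure (P x) A = 1})
     \<and> (\<forall>A\<in>sets M. orth (HA A) = {x. proj_onto H\<pi> x = 0 \<or> measure (P (proj_onto H\<pi> x)) A = 0})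
       \<comment> \<open>(e)\<close>
     \<and> (\<forall>x\<in>H\<pi> - {0}. \<forall>A\<in>sets M. \<forall>B\<in>sets M. measure (P x) A \<noteq> 0 \<longrightarrow>
          measure (P x) (A \<inter> B) / measure (P x) A = measure (P (proj_onto (HA A) x)) B)
       \<comment> \<open>(f)\<close>
     \<and> (\<forall>f \<in> (borel_measurable M :: (('s \<Rightarrow> 'a) \<Rightarrow> real) set).
          \<exists>Q :: 'h \<Rightarrow> 'h.
            let D = {x\<in>H\<pi>. x = 0 \<or> (\<integral>\<^sup>+ w. ennreal ((f w)\<^sup>2) \<partial>P x) < \<infinity>} in
            self_adjoint_in H\<pi> Q D
            \<and> (\<forall>x\<in>D - {0}. complex_of_real (integral\<^sup>L (P x) f) = hinner (hat x) (Q (hat x)))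
            \<and> has_spec_decomp H\<pi> Q D (\<lambda>B. proj_onto (HA (f -` B \<inter> \<Omega>))))
     \<and> (\<forall>f \<in> (borel_measurable M :: (('s \<Rightarrow> 'a) \<Rightarrow> real) set). \<forall>g \<in> (borel_measurable M :: (('s \<Rightarrow> 'a) \<Rightarrow> real) set).
          \<forall>B \<in> (sets borel :: real set set). \<forall>C \<in> (sets borel :: real set set).
          \<forall>x\<in>H\<pi>. proj_onto (HA (f -` B \<inter> \<Omega>)) (proj_onto (HA (g -` C \<inter> \<Omega>)) x)
                = proj_onto (HA (g -` C \<inter> \<Omega>)) (proj_onto (HA (f -` B \<inter> \<Omega>)) x)))"
proof -
  interpret projection_family S \<Gamma> p by unfold_locales (rule assms)
  show ?thesis
    unfolding H\<pi>_def N_def \<Omega>_def M_def P_def Let_def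
  proof (intro conjI exI[of _ HA] ballI allI impI)
    fix f :: "('s \<Rightarrow> 'a) \<Rightarrow> real" assume f: "f \<in> borel_measurable (Msig S \<Gamma>)"
    from observable[OF f] show "\<exists>Q. self_adjoint_in (Hpi S \<Gamma> p) Q
        {x \<in> Hpi S \<Gamma> p. x = 0 \<or> (\<integral>\<^sup>+ w. ennreal ((f w)\<^sup>2) \<partial>Pphi S \<Gamma> p x) < \<infinity>}
      \<and> (\<forall>x\<in>{x \<in> Hpi S \<Gamma> p. x = 0 \<or> (\<integral>\<^sup>+ w. ennreal ((f w)\<^sup>2) \<partial>Pphi S \<Gamma> p x) < \<infinity>} - {0}.
          complex_of_real (integral\<^sup>L (Pphi S \<Gamma> p x) f) = hinner (hat x) (Q (hat x)))
      \<and> has_spec_decomp (Hpi S \<Gamma> p) Q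
        {x \<in> Hpi S \<Gamma> p. x = 0 \<or> (\<integral>\<^sup>+ w. ennreal ((f w)\<^sup>2) \<partial>Pphi S \<Gamma> p x) < \<infinity>}
        (\<lambda>B. proj_onto (HA (f -` B \<inter> Omega S \<Gamma>)))" .
  next
    fix f g :: "('s \<Rightarrow> 'a) \<Rightarrow> real" and B C :: "real set" and x
    assume fg: "f \<in> borel_measurable (Msig S \<Gamma>)" "g \<in> borel_measurable (Msig S \<Gamma>)"
      and BC: "B \<in> sets borel" "C \<in> sets borel" and x: "x \<in> Hpi S \<Gamma> p"
    have fB: "f -` B \<inter> Omega S \<Gamma> \<in> sets (Msig S \<Gamma>)" and gC: "g -` C \<inter> Omega S \<Gamma> \<in> sets (Msig S \<Gamma>)"
      using measurable_sets[OF fg(1) BC(1)] measurable_sets[OF fg(2) BC(2)] by (simp_all add: space_Msig)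
    show "proj_onto (HA (f -` B \<inter> Omega S \<Gamma>)) (proj_onto (HA (g -` C \<inter> Omega S \<Gamma>)) x)
        = proj_onto (HA (g -` C \<inter> Omega S \<Gamma>)) (proj_onto (HA (f -` B \<inter> Omega S \<Gamma>)) x)"
      unfolding PV.E_Int[OF fB gC x] PV.E_Int[OF gC fB x] by (simp only: Int_commute)
  next
    fix q A x
    assume q: "is_pvm (Hpi S \<Gamma> p) (Omega S \<Gamma>) (sets (Msig S \<Gamma>)) q
        \<and> (\<forall>xs\<in>pi_list S \<Gamma>. \<forall>x\<in>Hpi S \<Gamma> p. q (cyl S \<Gamma> xs) x = pw p xs x)"
      and A: "A \<in> sets (Msig S \<Gamma>)" and x: "x \<in> Hpi S \<Gamma> p"
    show "q A x = proj_onto (HA A) x"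
      by (rule pvm_unique[OF conjunct1[OF q] _ A x]) (use q in blast)
  next
    fix A assume A: "A \<in> sets (Msig S \<Gamma>)"
    show "HA A = {x \<in> Hpi S \<Gamma> p. x = 0 \<or> measure (Pphi S \<Gamma> p x) A = 1}" by (rule HA_def)
    show "orth (HA A) = {x. proj_onto (Hpi S \<Gamma> p) x = 0 \<or> measure (Pphi S \<Gamma> p (proj_onto (Hpi S \<Gamma> p) x)) A = 0}"
      by (rule orth_HA[OF A])
    show "orth_decomp3 (HA A) (HA (Omega S \<Gamma> - A)) (orth (Hpi S \<Gamma> p))" by (rule orth_decomp3_HA[OF A])
    then show "orth_decomp3 (HA A) (HA (Omega S \<Gamma> - A)) (closure (Nset S \<Gamma> p))" by (simp only: orth_Hpi)
    show "closed (HA A)" "csubspace (HA A)" "HA A \<subseteq> Hpi S \<Gamma> p"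
      using closed_csubspace_HA[OF A] HA_subset[OF A] by (auto dest: closed_csubspaceD)
  next
    fix x A B
    assume "x \<in> Hpi S \<Gamma> p - {0}" "A \<in> sets (Msig S \<Gamma>)" "B \<in> sets (Msig S \<Gamma>)" "measure (Pphi S \<Gamma> p x) A \<noteq> 0"
    then show "measure (Pphi S \<Gamma> p x) (A \<inter> B) / measure (Pphi S \<Gamma> p x) A
        = measure (Pphi S \<Gamma> p (proj_onto (HA A) x)) B"
      by (intro conditional_P) auto
  next
    fix x A assume "x \<in> Hpi S \<Gamma> p - {0}" "A \<in> sets (Msig S \<Gamma>)"
    then show "measure (Pphi S \<Gamma> p x) A = (norm (proj_onto (HA A) (hat x)))\<^sup>2"
      by (intro measure_P_eq) auto
  qed (fact csubspace_Nset Hpi_eqs is_Pphi_ex1 is_pvm_HA proj_HA_cyl HA_Omega orth_Hpi)+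
qed

end
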